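(* Fix integers $q\ge 6$ and $p\ge 1$. (i) If $p\le q-1$, then $\operatorname{ex}(n,C_q,P_{p+1})=0$ for every $n$. (ii) If $p=q$, then \[ \operatorname{ex}(n,C_q,P_{q+1})=\left\lfloor\frac nq\right\rfloor\frac{(q-1)!}{2} \] for every $n$. (iii) If $p\ge q+2$, or if $q$ is even and $p=q+1$, then, for all sufficiently large $n$ (depending on $p,q$), \[ \operatorname{ex}(n,C_q,P_{p+1})=N\bigl(C_q,H(n,p-1)\bigr). \]
   Context: All graphs are finite and simple. $C_q$ is the cycle with $q$ vertices and $P_{p+1}$ is the path with $p+1$ vertices (and $p$ edges). For graphs $T,G$, $N(T,G)$ is the number of unlabeled copies of $T$ in $G$, i.e. the number of subgraphs of $G$ isomorphic to $T$. For a graph $F$, $\operatorname{ex}(n,T,F)$ is the maximum of $N(T,G)$ over all $n$-vertex graphs $G$ with no subgraph isomorphic to $F$. For $L\ge 2$ put $a=\lfloor L/2\rfloor$ and define \[ H(n,L)=\begin{cases}K_a\vee\overline{K}_{n-a},&L=2a,\\ K_a\vee(\overline{K}_{n-a}+e),&L=2a+1,\end{cases} \] where $\vee$ denotes the join, $\overline{K}_{m}$ is the edgeless graph on $m$ vertices, and $\overline{K}_{n-a}+e$ is $\overline{K}_{n-a}$ with one edge $e$ added. *)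

theory Defs
  imports Complex_Main
begin

datatype 'a graph = Graph (verts: "'a set") (edges: "'a set set")

definition simple_graph :: "'a graph \<Rightarrow> bool" where
  "simple_graph G \<longleftrightarrow> finite (verts G) \<and> (\<forall>e\<in>edges G. e \<subseteq> verts G \<and> card e = 2)"

definition subgraph :: "'a graph \<Rightarrow> 'a graph \<Rightarrow> bool" where
  "subgraph S G \<longleftrightarrow> simple_graph S \<and> verts S \<subseteq> verts G \<and> edges S \<subseteq> edges G"

definition isomorphic :: "'a graph \<Rightarrow> 'b graph \<Rightarrow> bool" where
  "isomorphic G H \<longleftrightarrow> (\<exists>f. bij_betw f (verts G) (verts H) \<and>
     (\<forall>u\<in>verts G. \<forall>v\<in>verts G. {u, v} \<in> edges G \<longleftrightarrow> {f u, f v} \<in> edges H))"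

definition num_copies :: "'t graph \<Rightarrow> 'a graph \<Rightarrow> nat" where
  "num_copies T G = card {S. subgraph S G \<and> isomorphic S T}"

definition free_of :: "'f graph \<Rightarrow> 'a graph \<Rightarrow> bool" where
  "free_of F G \<longleftrightarrow> \<not> (\<exists>S. subgraph S G \<and> isomorphic S F)"

text \<open>Every finite graph is isomorphic to one whose vertices are natural numbers, so taking
  the host graphs over \<^typ>\<open>nat\<close> loses nothing. The set below is finite, and it is
  nonempty as soon as \<open>F\<close> has an edge (lemmas at the end of this theory).\<close>

definition ex_values :: "nat \<Rightarrow> 't graph \<Rightarrow> 'f graph \<Rightarrow> nat set" where
  "ex_values n T F =
     {num_copies T G | G :: nat graph. simple_graph G \<and> card (verts G) = n \<and> free_of F G}"

definition gen_ex :: "nat \<Rightarrow> 't graph \<Rightarrow> 'f graph \<Rightarrow> nat" where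
  "gen_ex n T F = Max (ex_values n T F)"

text \<open>A cycle only for \<open>q \<ge> 3\<close>.\<close>

definition cycle_graph :: "nat \<Rightarrow> nat graph" where
  "cycle_graph q = Graph {..<q} {{i, (i + 1) mod q} | i. i < q}"

text \<open>The parameter is the number of vertices, so \<open>path_graph (p + 1)\<close> has \<open>p\<close> edges.\<close>

definition path_graph :: "nat \<Rightarrow> nat graph" where
  "path_graph k = Graph {..<k} {{i, i + 1} | i. i + 1 < k}"

definition complete_graph :: "nat \<Rightarrow> nat graph" where
  "complete_graph k = Graph {..<k} {{u, v} | u v. u < k \<and> v < k \<and> u \<noteq> v}"

definition empty_graph :: "nat \<Rightarrow> nat graph" where
  "empty_graph k = Graph {..<k} {}"

definition add_edge :: "'a set \<Rightarrow> 'a graph \<Rightarrow> 'a graph" where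
  "add_edge e G = Graph (verts G) (insert e (edges G))"

definition graph_join :: "'a graph \<Rightarrow> 'b graph \<Rightarrow> ('a + 'b) graph" where
  "graph_join G H = Graph (verts G <+> verts H)
     ((`) Inl ` edges G \<union> (`) Inr ` edges H \<union>
      {{Inl u, Inr v} | u v. u \<in> verts G \<and> v \<in> verts H})"

text \<open>Meaningful for \<open>n \<ge> L div 2\<close>, and for \<open>n \<ge> L div 2 + 2\<close> if \<open>L\<close> is odd, so that the
  vertices 0 and 1 of the added edge exist.\<close>

definition H_graph :: "nat \<Rightarrow> nat \<Rightarrow> (nat + nat) graph" where
  "H_graph n L =
     (let a = L div 2 in
      if even L then graph_join (complete_graph a) (empty_graph (n - a))
      else graph_join (complete_graph a) (add_edge {0, 1} (empty_graph (n - a))))"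

lemma simple_graph_cycle: "3 \<le> q \<Longrightarrow> simple_graph (cycle_graph q)"
proof -
  assume q: "3 \<le> q"
  have "i \<noteq> (i + 1) mod q" if "i < q" for i
    using that q by (cases "i + 1 = q") auto
  then show ?thesis
    using q by (auto simp: simple_graph_def cycle_graph_def card_2_iff)
qed

lemma simple_graph_path: "simple_graph (path_graph k)"
  by (auto simp: simple_graph_def path_graph_def)

lemma simple_graph_complete: "simple_graph (complete_graph k)"
  by (auto simp: simple_graph_def complete_graph_def)

lemma simple_graph_empty: "simple_graph (empty_graph k)"
  by (auto simp: simple_graph_def empty_graph_def)

lemma simple_graph_add_edge:
  "simple_graph G \<Longrightarrow> e \<subseteq> verts G \<Longrightarrow> card e = 2 \<Longrightarrow> simple_graph (add_edge e G)"
  by (auto simp: simple_graph_def add_edge_def)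

lemma simple_graph_join:
  "simple_graph G \<Longrightarrow> simple_graph H \<Longrightarrow> simple_graph (graph_join G H)"
  by (auto simp: simple_graph_def graph_join_def card_image)

lemma simple_graph_H:
  assumes "L div 2 + 2 \<le> n"
  shows "simple_graph (H_graph n L)" "card (verts (H_graph n L)) = n"
proof -
  have "simple_graph (add_edge {0, 1} (empty_graph (n - L div 2)))"
    using assms by (intro simple_graph_add_edge simple_graph_empty) (auto simp: empty_graph_def)
  then show "simple_graph (H_graph n L)"
    by (auto simp: H_graph_def Let_def
        intro!: simple_graph_join simple_graph_complete simple_graph_empty)
  show "card (verts (H_graph n L)) = n"
    using assms by (auto simp: H_graph_def Let_def graph_join_def add_edge_def
        complete_graph_def empty_graph_def card_Plus)
qed

lemma finite_ex_values: "finite (ex_values n T F)"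
proof (rule finite_subset)
  show "ex_values n T F \<subseteq> {..2 ^ n * 2 ^ 2 ^ n}"
  proof
    fix x assume "x \<in> ex_values n T F"
    then obtain G :: "nat graph" where G: "simple_graph G" "card (verts G) = n"
      and x: "x = num_copies T G" by (auto simp: ex_values_def)
    let ?V = "verts G"
    let ?X = "(\<lambda>(V, E). Graph V E) ` (Pow ?V \<times> Pow (Pow ?V))"
    have fin: "finite ?V" using G by (simp add: simple_graph_def)
    have "S \<in> ?X" if "subgraph S G" for S
    proof (cases S)
      case (Graph V E)
      then have "(V, E) \<in> Pow ?V \<times> Pow (Pow ?V)"
        using that G by (fastforce simp: subgraph_def simple_graph_def)
      then show ?thesis using Graph by force
    qed
    then have "x \<le> card ?X"
      unfolding x num_copies_def using fin by (intro card_mono) auto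
    also have "\<dots> \<le> card (Pow ?V \<times> Pow (Pow ?V))"
      using fin by (intro card_image_le) auto
    also have "\<dots> = 2 ^ n * 2 ^ 2 ^ n"
      using fin G by (simp add: card_Pow card_cartesian_product)
    finally show "x \<in> {..2 ^ n * 2 ^ 2 ^ n}" by simp
  qed
qed simp

lemma ex_values_nonempty:
  assumes F: "simple_graph F" "edges F \<noteq> {}"
  shows "ex_values n T F \<noteq> {}"
proof -
  obtain u v where uv: "{u, v} \<in> edges F" "u \<in> verts F" "v \<in> verts F"
    using F unfolding simple_graph_def card_2_iff by (metis all_not_in_conv insert_subset)
  have "free_of F (empty_graph n)"
    unfolding free_of_def
  proof
    assume "\<exists>S. subgraph S (empty_graph n) \<and> isomorphic S F"
    then obtain S where S: "subgraph S (empty_graph n)" and iso: "isomorphic S F"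
      by blast
    have "edges S = {}"
      using S by (simp add: subgraph_def empty_graph_def)
    with iso obtain f where f: "bij_betw f (verts S) (verts F)"
      and e: "\<forall>x\<in>verts S. \<forall>y\<in>verts S. {f x, f y} \<notin> edges F"
      unfolding isomorphic_def by blast
    from f uv obtain x y where "x \<in> verts S" "f x = u" "y \<in> verts S" "f y = v"
      unfolding bij_betw_def by (metis imageE)
    then show False using e uv by auto
  qed
  moreover have "card (verts (empty_graph n)) = n" by (simp add: empty_graph_def)
  ultimately show ?thesis
    using simple_graph_empty[of n] by (auto simp: ex_values_def)
qed

end

theory Submission
  imports Defs "HOL-Library.FuncSet"
begin

text \<open>
  A copy of \<open>C\<^sub>q\<close> in a graph is counted through the \<open>2q\<close> cyclic lists of vertices that run
  once around it (\<open>cycs\<close>). Since the factor \<open>2q\<close> is the same for all graphs, numbers of copies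
  can be compared by comparing numbers of lists, and everything except the translation at the
  end is about a finite symmetric relation without a path on \<open>p + 1\<close> vertices.

  If \<open>p < q\<close>, then \<open>C\<^sub>q\<close> itself contains the forbidden path. If \<open>p = q\<close>, then a vertex outside a
  \<open>C\<^sub>q\<close> with a neighbour on it would extend the cycle to a path on \<open>q + 1\<close> vertices; so the vertex
  set of a \<open>C\<^sub>q\<close> is a whole component, there are at most \<open>\<lfloor>n/q\<rfloor>\<close> such sets, and each carries at
  most the \<open>(q-1)!/2\<close> cycles of a complete graph. Disjoint complete graphs reach this bound.

  The remaining case is an asymptotic argument with stability. Put \<open>r = \<lfloor>q/2\<rfloor>\<close> and
  \<open>a = \<lfloor>(p-1)/2\<rfloor>\<close>, so that \<open>p\<close> is \<open>2a+1\<close> or \<open>2a+2\<close>.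

  Upper bound. A graph without long paths is degenerate, so its vertices can be ranked such that
  each has at most \<open>p\<close> neighbours of higher rank. Given the rank-local minima of a cycle, each
  other vertex is one of boundedly many upper neighbours of a known vertex. There are at most
  \<open>r\<close> local minima; cycles with fewer are negligible, and up to rotation the others have their
  minima at all odd positions. Call a vertex high if its degree is at least \<open>\<epsilon>n\<close>; there are
  boundedly many of these. A vertex between two minima that is not high costs a factor \<open>\<epsilon>\<close>, since
  the next minimum can then be chosen among few neighbours. What is left are cycles in which high
  vertices (hubs) alternate with low ones, up to one irregular spot if \<open>q\<close> is odd.

  Fix the low vertices of such a cycle apart from one, and suppose that each of them shares its set
  of hubs with many other vertices. Then any two hubs of the same low vertex can be joined through
  a fresh low vertex, and the hubs of all the fixed low vertices can be threaded into one path.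
  The forbidden path bounds the number \<open>m\<close> of these hubs by \<open>a\<close> (\<open>card_spanned_le\<close>). If \<open>q\<close> is even,
  there are at most \<open>m (m-1) \<dots> (m-r+1)\<close> ways to choose the hubs and at most \<open>n\<close> ways to choose the
  last low vertex. If \<open>q\<close> is odd, the irregular spot is a hub and a low vertex, with at most
  \<open>(a-r) n\<close> choices, or an edge between two low vertices. In the second case a dense set of such
  edges would contain two disjoint low paths that prolong the hub path at both ends, which leaves
  about \<open>2 (a-m) n\<close> choices (\<open>card_low_arcs_le\<close>). The gain \<open>2 (a-m)\<close> is more than outweighed by the
  loss of hubs (\<open>falling_trade_off\<close>), so in all cases the main term is the one of the claimed
  extremal graph.

  Stability. Equality in the main term forces almost all choices of low vertices to have one common
  set of \<open>a\<close> hubs. Hence a graph with as many cycles as the extremal graph contains a set \<open>T\<close> of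
  \<open>a\<close> vertices to which all but \<open>\<eta>n\<close> vertices are completely joined (\<open>many_cycles_imp_hub_set\<close>).

  Exactness. Once \<open>T\<close> is there, a path outside \<open>T\<close> that ends next to \<open>T\<close> can be prolonged through
  all of \<open>T\<close> and is therefore very short. Every cycle meeting \<open>T\<close> uses only edges at \<open>T\<close>, plus a
  single fixed edge if \<open>p = 2a+2\<close>; the other cycles live on the few vertices not adjacent to \<open>T\<close>
  (\<open>cycs_structure\<close>). Joining these \<open>m \<le> \<eta>n\<close> vertices to \<open>T\<close> instead creates of the order of
  \<open>m n^(r-1)\<close> cycles and destroys at most a constant times \<open>m^r\<close>, so the extremal graph has at
  least as many cycles (\<open>card_cycs_le_hub_rel\<close>).
\<close>

section \<open>Falling factorials\<close>

text \<open>
  The subtraction is truncated, so the value is \<open>0\<close> for \<open>k > m\<close>, as it should be for the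
  number of injective lists.
\<close>

definition falling :: "nat \<Rightarrow> nat \<Rightarrow> nat" where
  "falling m k = (\<Prod>i<k. m - i)"

lemma falling_0 [simp]: "falling m 0 = 1"
  by (simp add: falling_def)

lemma falling_Suc: "falling m (Suc k) = falling m k * (m - k)"
  by (simp add: falling_def)

lemma card_distinct_lists:
  assumes "finite A"
  shows "card {xs. length xs = k \<and> distinct xs \<and> set xs \<subseteq> A} = falling (card A) k"
proof (cases "k \<le> card A")
  case True
  have "falling (card A) k = \<Prod>{card A - k + 1 .. card A}"
    unfolding falling_def using True
    by (intro prod.reindex_bij_witness[of _ "\<lambda>j. card A - j" "\<lambda>i. card A - i"]) auto
  then show ?thesis
    using card_lists_distinct_length_eq[OF assms True] by simp
next
  case False
  have "{xs. length xs = k \<and> distinct xs \<and> set xs \<subseteq> A} = {}"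
    using False assms by (auto dest: card_mono simp: distinct_card[symmetric])
  moreover have "falling (card A) k = 0"
    using False by (auto simp: falling_def intro!: bexI[of _ "card A"])
  ultimately show ?thesis by (simp only: card.empty)
qed

lemma finite_distinct_lists:
  "finite A \<Longrightarrow> finite {xs. length xs = k \<and> distinct xs \<and> set xs \<subseteq> A}"
  by (rule finite_subset[OF _ finite_lists_length_eq[of A k]]) auto

lemma falling_mono: "m \<le> m' \<Longrightarrow> falling m k \<le> falling m' k"
  unfolding falling_def by (intro prod_mono) auto

lemma power_le_falling: "(m - k) ^ k \<le> falling m k"
proof -
  have "(m - k) ^ k = (\<Prod>i<k. m - k)" by simp
  also have "\<dots> \<le> falling m k" unfolding falling_def by (intro prod_mono) auto
  finally show ?thesis .
qed

lemma falling_pos: "k \<le> m \<Longrightarrow> 0 < falling m k"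
  unfolding falling_def by (intro prod_pos) auto

lemma falling_less:
  assumes "k \<le> m" "m' < m" "0 < k"
  shows "falling m' k < falling m k"
proof -
  have "falling m' k = m' * (\<Prod>i\<in>{..<k}-{0}. m' - i)"
    "falling m k = m * (\<Prod>i\<in>{..<k}-{0}. m - i)"
    unfolding falling_def using assms by (subst prod.remove[of _ 0], auto)+
  moreover have "(\<Prod>i\<in>{..<k}-{0}. m' - i) \<le> (\<Prod>i\<in>{..<k}-{0}. m - i)"
    using assms by (intro prod_mono) auto
  moreover have "0 < (\<Prod>i\<in>{..<k}-{0}. m - i)"
    using assms by (intro prod_pos) auto
  ultimately show ?thesis using assms
    by (metis le_less_trans mult_le_mono2 mult_less_cancel2)
qed

text \<open>
  Both sides are the product of \<open>m + 1\<close> and the falling factorial of \<open>m\<close>; this compares the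
  numbers of hub choices for \<open>m\<close> and for \<open>m + 1\<close> hubs.
\<close>

lemma falling_Suc_base: "falling (Suc m) k * (Suc m - k) = falling m k * Suc m"
proof (induction k)
  case (Suc k)
  have "falling (Suc m) (Suc k) * (Suc m - Suc k) = (falling (Suc m) k * (Suc m - k)) * (m - k)"
    by (simp add: falling_Suc)
  also have "\<dots> = falling m (Suc k) * Suc m"
    by (subst Suc) (simp add: falling_Suc mult_ac distrib_left)
  finally show ?case .
qed simp

text \<open>
  With \<open>Y = m + 1 - r\<close> and \<open>X = (a - r) + 2 (a - m - 1)\<close> the claim reduces to
  \<open>Y (X + 2) < (Y + r) X\<close>, that is \<open>2 Y < r X\<close>; it follows from \<open>1 \<le> Y \<le> X\<close> and \<open>r \<ge> 3\<close>.
\<close>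

lemma falling_trade_off_step:
  assumes "r < a" "3 \<le> r" "m < a"
  shows "falling m r * ((a - r) + 2 * (a - m)) < falling (Suc m) r * ((a - r) + 2 * (a - Suc m))
    \<or> m < r"
proof (cases "m < r")
  case False
  define X where "X = (a - r) + 2 * (a - Suc m)"
  define Y where "Y = Suc m - r"
  have Y: "1 \<le> Y" "Y \<le> X" "Suc m = Y + r" using False assms by (auto simp: X_def Y_def)
  have X2: "(a - r) + 2 * (a - m) = X + 2" using assms by (auto simp: X_def)
  have f: "0 < falling m r" using False by (intro falling_pos) auto
  have "Y * (X + 2) < (Y + r) * X"
  proof -
    have "2 * Y < 3 * X" using Y by linarith
    also have "3 * X \<le> r * X" using assms by simp
    finally have "2 * Y < r * X" .
    then show ?thesis by (simp add: algebra_simps)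
  qed
  then have "falling m r * (Y * (X + 2)) < falling m r * Suc m * X"
    using f Y(3) by (simp add: mult.assoc)
  also have "\<dots> = falling (Suc m) r * Y * X"
    by (simp add: Y_def falling_Suc_base)
  finally have "Y * (falling m r * (X + 2)) < Y * (falling (Suc m) r * X)"
    by (simp add: algebra_simps)
  then show ?thesis using X2 by (simp add: X_def)
qed simp

text \<open>
  This is the inequality behind the case of odd cycles: with \<open>m < a\<close> hubs there are at most
  \<open>2 (a - m) n\<close> additional completions through an edge between low vertices, and this gain does
  not make up for the smaller number of choices of \<open>r\<close> hubs. It holds because the left-hand side
  increases with \<open>m\<close> up to \<open>m = a\<close>.
\<close>

lemma falling_trade_off:
  assumes "r < a" "3 \<le> r" "m < a"
  shows "falling m r * ((a - r) + 2 * (a - m)) < falling a r * (a - r)"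
  using assms(3)
proof (induction "a - m" arbitrary: m)
  case (Suc d)
  show ?case
  proof (cases "m < r")
    case True
    then have "falling m r = 0" by (auto simp: falling_def intro!: bexI[of _ m])
    then show ?thesis using assms falling_pos[of r a] by simp
  next
    case False
    then have st: "falling m r * ((a - r) + 2 * (a - m)) < falling (Suc m) r * ((a - r) + 2 * (a - Suc m))"
      using falling_trade_off_step[OF assms(1,2) Suc.prems] by simp
    show ?thesis
    proof (cases "Suc m = a")
      case True
      have "falling (Suc m) r * ((a - r) + 2 * (a - Suc m)) = falling a r * (a - r)"
        unfolding True by simp
      then show ?thesis using st by (simp only:)
    next
      case False
      then have "Suc m < a" using Suc by auto
      moreover have "d = a - Suc m" using Suc by auto
      ultimately show ?thesis using Suc.hyps(1)[of "Suc m"] st by linarith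
    qed
  qed
qed simp

section \<open>Lists whose entries are chosen one after the other\<close>

text \<open>
  The basic counting device. If the candidates for the entry at \<open>i\<close> depend only on entries of
  smaller measure and there are at most \<open>c i\<close> of them, then removing an index of largest measure
  affects no other entry, and by induction there are at most the product of the \<open>c i\<close> families.
\<close>

lemma card_dependent_choices:
  fixes ch :: "'i \<Rightarrow> ('i \<Rightarrow> 'a) \<Rightarrow> 'a set" and c :: "'i \<Rightarrow> real" and \<mu> :: "'i \<Rightarrow> nat"
  assumes "finite I"
    and "\<And>i f g. i \<in> I \<Longrightarrow> (\<forall>j\<in>I. \<mu> j < \<mu> i \<longrightarrow> f j = g j) \<Longrightarrow> ch i f = ch i g"
    and "\<And>i f. i \<in> I \<Longrightarrow> finite (ch i f)"
    and "\<And>i f. i \<in> I \<Longrightarrow> real (card (ch i f)) \<le> c i"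
  shows "finite {f \<in> extensional I. \<forall>i\<in>I. f i \<in> ch i f} \<and>
    real (card {f \<in> extensional I. \<forall>i\<in>I. f i \<in> ch i f}) \<le> prod c I"
  using assms
proof (induction I rule: finite_ranking_induct[where f = \<mu>])
  case empty
  have "{f \<in> extensional {}. \<forall>i\<in>{}. f i \<in> ch i f} = {\<lambda>_::'i. undefined::'a}"
    by (auto simp: extensional_def)
  then show ?case by simp
next
  case (insert x S)
  show ?case
  proof (cases "x \<in> S")
    case True
    then have eq: "insert x S = S" by auto
    show ?thesis unfolding eq
      by (rule insert.IH[OF insert.prems[unfolded eq]])
  next
    case False
    have dep: "ch i f = ch i g" if "i \<in> insert x S" "\<forall>j\<in>S. f j = g j" for i f g
    proof (rule insert.prems(1)[OF that(1)])
      have "\<not> \<mu> x < \<mu> i" using that(1) insert.hyps(2) by (auto simp: not_less)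
      then show "\<forall>j\<in>insert x S. \<mu> j < \<mu> i \<longrightarrow> f j = g j" using that by auto
    qed
    let ?F = "{f \<in> extensional S. \<forall>i\<in>S. f i \<in> ch i f}"
    let ?G = "{f \<in> extensional (insert x S). \<forall>i\<in>insert x S. f i \<in> ch i f}"
    have IH: "finite ?F \<and> real (card ?F) \<le> prod c S"
    proof (rule insert.IH)
      fix i and f g :: "'i \<Rightarrow> 'a"
      assume i: "i \<in> S" "\<forall>j\<in>S. \<mu> j < \<mu> i \<longrightarrow> f j = g j"
      show "ch i f = ch i g"
      proof (rule insert.prems(1))
        show "\<forall>j\<in>insert x S. \<mu> j < \<mu> i \<longrightarrow> f j = g j"
          using i insert.hyps(2)[OF i(1)] by auto
      qed (use i in simp)
    qed (use insert.prems(2,3) in auto)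
    have map: "(\<lambda>f. (restrict f S, f x)) ` ?G \<subseteq> Sigma ?F (ch x)"
    proof safe
      fix f assume f: "f \<in> extensional (insert x S)" "\<forall>i\<in>insert x S. f i \<in> ch i f"
      show "restrict f S \<in> extensional S" by simp
      fix i assume "i \<in> S"
      then show "restrict f S i \<in> ch i (restrict f S)"
        using f dep[of i "restrict f S" f] by auto
    next
      fix f assume f: "f \<in> extensional (insert x S)" "\<forall>i\<in>insert x S. f i \<in> ch i f"
      then show "f x \<in> ch x (restrict f S)"
        using dep[of x "restrict f S" f] by auto
    qed
    have inj: "inj_on (\<lambda>f. (restrict f S, f x)) ?G"
    proof (rule inj_onI)
      fix f g assume fg: "f \<in> ?G" "g \<in> ?G" "(restrict f S, f x) = (restrict g S, g x)"
      show "f = g"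
      proof (rule extensionalityI[of _ "insert x S"])
        fix i assume "i \<in> insert x S"
        moreover have "restrict f S i = restrict g S i" "f x = g x" using fg by auto
        ultimately show "f i = g i" by (cases "i \<in> S") auto
      qed (use fg in auto)
    qed
    have fin: "finite (Sigma ?F (ch x))"
      using IH insert.prems(2) by (intro finite_SigmaI) auto
    have "real (card ?G) \<le> real (card (Sigma ?F (ch x)))"
      using card_inj_on_le[OF inj map fin] by simp
    also have "\<dots> = (\<Sum>f\<in>?F. real (card (ch x f)))"
      using IH insert.prems(2) by (subst card_SigmaI) auto
    also have "\<dots> \<le> (\<Sum>f\<in>?F. c x)"
      using insert.prems(3) by (intro sum_mono) auto
    also have "\<dots> = real (card ?F) * c x" by simp
    also have "\<dots> \<le> prod c S * c x"
      using IH insert.prems(3)[of x undefined] by (intro mult_right_mono) auto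
    also have "\<dots> = prod c (insert x S)" using False insert.hyps by (simp add: mult.commute)
    finally show ?thesis
      using finite_imageD[OF finite_subset[OF map fin] inj] by blast
  qed
qed

text \<open>
  The special case in which the candidates at position \<open>i\<close> are determined by the entry at
  one parent position, or are the same for all lists.
\<close>

lemma card_dependent_lists:
  fixes R :: "nat \<Rightarrow> 'a \<Rightarrow> 'a set" and c :: "nat \<Rightarrow> real" and \<mu> :: "nat \<Rightarrow> nat"
  assumes par: "\<And>i. i < q \<Longrightarrow> (par i < q \<and> \<mu> (par i) < \<mu> i) \<or> (\<forall>u v. R i u = R i v)"
    and fin: "\<And>i u. i < q \<Longrightarrow> finite (R i u)"
    and c: "\<And>i u. i < q \<Longrightarrow> real (card (R i u)) \<le> c i"
  shows "finite {xs. length xs = q \<and> (\<forall>i<q. xs ! i \<in> R i (xs ! par i))}" 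
    and "real (card {xs. length xs = q \<and> (\<forall>i<q. xs ! i \<in> R i (xs ! par i))}) \<le> (\<Prod>i<q. c i)"
proof -
  let ?L = "{xs. length xs = q \<and> (\<forall>i<q. xs ! i \<in> R i (xs ! par i))}"
  let ?F = "{f \<in> extensional {..<q}. \<forall>i\<in>{..<q}. f i \<in> R i (f (par i))}"
  have F: "finite ?F \<and> real (card ?F) \<le> prod c {..<q}"
  proof (rule card_dependent_choices[where \<mu> = \<mu>])
    fix i and f g :: "nat \<Rightarrow> 'a"
    assume "i \<in> {..<q}" "\<forall>j\<in>{..<q}. \<mu> j < \<mu> i \<longrightarrow> f j = g j"
    then show "R i (f (par i)) = R i (g (par i))" using par[of i] by auto
  qed (use fin c in auto)
  let ?h = "\<lambda>xs. restrict ((!) xs) {..<q}"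
  have inj: "inj_on ?h ?L"
  proof (rule inj_onI)
    fix xs ys assume *: "xs \<in> ?L" "ys \<in> ?L" "?h xs = ?h ys"
    have "xs ! i = ys ! i" if "i < q" for i
      using fun_cong[OF *(3), of i] that by simp
    then show "xs = ys" using * by (auto intro!: nth_equalityI)
  qed
  have im: "?h ` ?L \<subseteq> ?F"
  proof safe
    fix xs i assume xs: "\<forall>i<length xs. xs ! i \<in> R i (xs ! par i)" "q = length xs" "i < length xs"
    show "restrict ((!) xs) {..<length xs} i \<in> R i (restrict ((!) xs) {..<length xs} (par i))"
    proof (cases "par i < length xs")
      case True then show ?thesis using xs by simp
    next
      case False
      then have "\<forall>u v. R i u = R i v" using par[of i] xs by auto
      then show ?thesis using xs by (metis lessThan_iff restrict_apply')
    qed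
  qed auto
  show "finite ?L" using finite_imageD[OF finite_subset[OF im] inj] F by blast
  show "real (card ?L) \<le> (\<Prod>i<q. c i)"
    using card_inj_on_le[OF inj im] F by linarith
qed

section \<open>Paths and cycles as lists\<close>

definition is_path :: "'a set \<Rightarrow> ('a \<Rightarrow> 'a \<Rightarrow> bool) \<Rightarrow> 'a list \<Rightarrow> bool" where
  "is_path V E xs \<longleftrightarrow> distinct xs \<and> set xs \<subseteq> V \<and> successively E xs"

text \<open>
  Rotations and reversals of a list count separately, so every copy of \<open>C\<^sub>q\<close> gives \<open>2 q\<close> lists.
\<close>

definition cycs :: "'a set \<Rightarrow> ('a \<Rightarrow> 'a \<Rightarrow> bool) \<Rightarrow> nat \<Rightarrow> 'a list set" where
  "cycs V E q = {xs. length xs = q \<and> distinct xs \<and> set xs \<subseteq> V \<and>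
     (\<forall>i<q. E (xs ! i) (xs ! (Suc i mod q)))}"

lemma is_path_take: "is_path V E xs \<Longrightarrow> is_path V E (take k xs)"
  unfolding is_path_def
  using set_take_subset[of k xs] successively_append_iff[of E "take k xs" "drop k xs"]
  by auto

lemma is_path_rev:
  "(\<And>x y. E x y \<Longrightarrow> E y x) \<Longrightarrow> is_path V E xs \<Longrightarrow> is_path V E (rev xs)"
  unfolding is_path_def by (auto elim: successively_mono)

lemma is_path_append:
  "is_path V E (xs @ ys) \<longleftrightarrow> is_path V E xs \<and> is_path V E ys \<and> set xs \<inter> set ys = {} \<and>
    (xs \<noteq> [] \<longrightarrow> ys \<noteq> [] \<longrightarrow> E (last xs) (hd ys))"
  unfolding is_path_def by (auto simp: successively_append_iff)

lemma is_path_mono: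
  "is_path V E xs \<Longrightarrow> V \<subseteq> V' \<Longrightarrow> (\<And>x y. E x y \<Longrightarrow> E' x y) \<Longrightarrow> is_path V' E' xs"
  unfolding is_path_def by (auto elim: successively_mono)

lemma finite_cycs: "finite V \<Longrightarrow> finite (cycs V E q)"
  unfolding cycs_def by (rule finite_subset[OF _ finite_lists_length_eq[of V q]]) auto

lemma cycs_rotate:
  assumes "xs \<in> cycs V E q"
  shows "rotate j xs \<in> cycs V E q"
proof (cases "q = 0")
  case True then show ?thesis using assms by (auto simp: cycs_def)
next
  case False
  have "E (rotate j xs ! i) (rotate j xs ! (Suc i mod q))" if "i < q" for i
  proof -
    have len: "length xs = q" using assms by (simp add: cycs_def)
    have "rotate j xs ! i = xs ! ((j + i) mod q)"
      using that len by (simp add: nth_rotate)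
    moreover have "rotate j xs ! (Suc i mod q) = xs ! (Suc ((j + i) mod q) mod q)"
      using False len by (simp add: nth_rotate mod_simps)
    ultimately show ?thesis using assms False by (simp add: cycs_def)
  qed
  then show ?thesis using assms by (simp add: cycs_def)
qed

lemma cycs_successively:
  assumes "xs \<in> cycs V E q"
  shows "successively E xs"
  unfolding successively_conv_nth
proof (intro allI impI)
  fix i assume i: "Suc i < length xs"
  have "\<forall>j<q. E (xs ! j) (xs ! (Suc j mod q))" "length xs = q" using assms by (auto simp: cycs_def)
  then show "E (xs ! i) (xs ! Suc i)" using i by (metis Suc_lessD mod_less)
qed

lemma inj_rotate: "inj (rotate j)"
  by (induction j) (simp_all add: rotate_def inj_def inj_eq[OF inj_rotate1])

text \<open>
  Greedy extension: the current end of a path on at most \<open>k\<close> vertices has a neighbour off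
  the path.
\<close>

lemma min_degree_path:
  assumes "finite S" "s \<in> S"
    and "\<And>v. v \<in> S \<Longrightarrow> k \<le> card {w \<in> S. F v w}"
    and "\<And>v. \<not> F v v" and sym: "\<And>x y. F x y \<Longrightarrow> F y x"
  shows "\<exists>xs. is_path S F xs \<and> length xs = Suc k \<and> hd xs = s"
proof -
  have "\<exists>xs. is_path S F xs \<and> length xs = Suc j \<and> last xs = s" if "j \<le> k" for j
    using that
  proof (induction j)
    case 0
    then show ?case using assms by (intro exI[of _ "[s]"]) (auto simp: is_path_def)
  next
    case (Suc j)
    then obtain xs where xs: "is_path S F xs" "length xs = Suc j" "last xs = s" by auto
    then obtain x ys where x: "xs = x # ys" by (cases xs) auto
    have xS: "x \<in> S" using xs x by (auto simp: is_path_def)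
    have "card {w \<in> S. F x w} > card (set ys)"
      using assms(3)[OF xS] Suc.prems xs x card_length[of ys] by simp
    then have "\<not> {w \<in> S. F x w} \<subseteq> set ys"
      by (meson List.finite_set card_mono leD)
    then obtain w where w: "w \<in> S" "F x w" "w \<notin> set ys" by auto
    then have "is_path S F (w # xs)" using xs x assms(4) sym
      by (auto simp: is_path_def)
    then show ?case using xs x by (intro exI[of _ "w # xs"]) auto
  qed
  from this[of k] obtain xs where "is_path S F xs" "length xs = Suc k" "last xs = s" by auto
  then show ?thesis using is_path_rev[of F S xs, OF sym]
    by (intro exI[of _ "rev xs"]) (auto simp: hd_rev)
qed

text \<open>
  Deleting a vertex of degree at most \<open>k\<close> destroys at most \<open>2 k\<close> ordered pairs, so the
  density survives until the minimum degree exceeds \<open>k\<close>.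
\<close>

lemma dense_has_core:
  assumes "finite S" "\<And>x y. F x y \<Longrightarrow> F y x" "\<And>v. \<not> F v v"
    and "2 * k * card S < card {(x, y). x \<in> S \<and> y \<in> S \<and> F x y}"
  shows "\<exists>S'\<subseteq>S. S' \<noteq> {} \<and> (\<forall>v\<in>S'. Suc k \<le> card {w \<in> S'. F v w})"
  using assms(1,4)
proof (induction "card S" arbitrary: S)
  case 0
  then show ?case by auto
next
  case (Suc n)
  show ?case
  proof (cases "\<forall>v\<in>S. Suc k \<le> card {w \<in> S. F v w}")
    case True
    then show ?thesis using Suc by (intro exI[of _ S]) auto
  next
    case False
    then obtain v where v: "v \<in> S" "card {w \<in> S. F v w} \<le> k" by auto
    let ?P = "\<lambda>S. {(x, y). x \<in> S \<and> y \<in> S \<and> F x y}" and ?N = "{w \<in> S. F v w}"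
    have "?P S \<subseteq> ?P (S - {v}) \<union> Pair v ` ?N \<union> (\<lambda>w. (w, v)) ` ?N"
      using assms(2,3) by auto
    then have "card (?P S) \<le> card (?P (S - {v}) \<union> Pair v ` ?N \<union> (\<lambda>w. (w, v)) ` ?N)"
      using Suc.prems by (intro card_mono) (auto intro: finite_subset[of _ "S \<times> S"])
    also have "\<dots> \<le> card (?P (S - {v})) + card ?N + card ?N"
      using Suc.prems by (intro order_trans[OF card_Un_le] add_mono card_image_le) auto
    finally have le: "card (?P S) \<le> card (?P (S - {v})) + 2 * k" using v by linarith
    have c: "card (S - {v}) = n" using v Suc by simp
    have "2 * k * card S = 2 * k * card (S - {v}) + 2 * k" using c Suc(2) by (simp add: algebra_simps flip: Suc(2))
    then have "2 * k * card (S - {v}) < card (?P (S - {v}))"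
      using le Suc.prems(2) by linarith
    then show ?thesis using Suc.hyps(1)[of "S - {v}"] c Suc.prems(1) by blast
  qed
qed

section \<open>Graphs without long paths\<close>

locale rel_graph =
  fixes V :: "'a set" and E :: "'a \<Rightarrow> 'a \<Rightarrow> bool"
  assumes fin: "finite V"
    and sym: "E x y \<Longrightarrow> E y x"
    and irr: "\<not> E x x"
    and sub: "E x y \<Longrightarrow> x \<in> V"
begin

lemma sub2: "E x y \<Longrightarrow> y \<in> V"
  using sym sub by blast

text \<open>
  If linked members of \<open>H\<close> always have a common neighbour outside \<open>H\<close> that avoids any given small
  set, then a list of successively linked members of \<open>H\<close> is threaded into a path by inserting
  fresh common neighbours. The set \<open>F\<close> is kept free so that further pieces can be attached.
\<close>

lemma weave_path:
  assumes link: "\<And>h h' F. link h h' \<Longrightarrow> finite F \<Longrightarrow> card F < D \<Longrightarrow> \<exists>l\<in>V - H. l \<notin> F \<and> E h l \<and> E l h'"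
    and H: "H \<subseteq> V"
    and hs: "successively link hs" "distinct hs" "set hs \<subseteq> H" "hs \<noteq> []"
    and F: "finite F" "card F + 2 * length hs \<le> D"
  shows "\<exists>P. is_path V E P \<and> hd P = hd hs \<and> last P = last hs \<and> length P = 2 * length hs - 1 \<and>
    set P \<inter> H = set hs \<and> (set P - H) \<inter> F = {}"
  using hs F
proof (induction hs rule: induct_list012)
  case (2 h)
  then show ?case using H by (intro exI[of _ "[h]"]) (auto simp: is_path_def)
next
  case (3 h h' hs)
  have "card F + 2 * length (h' # hs) \<le> D" using 3 by simp
  then obtain P where P: "is_path V E P" "hd P = h'" "last P = last (h' # hs)"
    "length P = 2 * length (h' # hs) - 1" "set P \<inter> H = set (h' # hs)"
    "(set P - H) \<inter> F = {}"
    using 3(2)[OF _ _ _ _ 3(7)] 3(3-5) by auto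
  have Pne: "P \<noteq> []" using P(4) by auto
  have lk: "link h h'" using 3(3) by simp
  have "card (F \<union> set P) < D"
  proof -
    have "card (F \<union> set P) \<le> card F + length P"
      using card_Un_le card_length by (metis add_left_mono le_trans)
    also have "\<dots> < D" using P(4) 3(8) by simp
    finally show ?thesis .
  qed
  from link[OF lk _ this] obtain l where l: "l \<in> V - H" "l \<notin> F" "l \<notin> set P" "E h l" "E l h'"
    using 3(7) by auto
  have "is_path V E (h # l # P)"
    using P Pne l 3(4,5) H by (auto simp: is_path_def successively_Cons)
  then show ?case using P Pne l 3(4,5) by (intro exI[of _ "h # l # P"]) auto
qed auto

end

text \<open>
  The graph has no path on \<open>p + 1\<close> vertices. It is convenient to bound all paths at once, which is
  equivalent because initial segments of paths are paths.
\<close>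

locale path_free = rel_graph +
  fixes p :: nat
  assumes path_le: "is_path V E xs \<Longrightarrow> length xs \<le> p"
begin

lemma card_arcs_le: "card {(x, y). x \<in> V \<and> y \<in> V \<and> E x y} \<le> 2 * p * card V"
proof (rule ccontr)
  assume "\<not> ?thesis"
  then have "2 * p * card V < card {(x, y). x \<in> V \<and> y \<in> V \<and> E x y}" by simp
  from dense_has_core[OF fin sym irr this]
  obtain S where S: "S \<subseteq> V" "S \<noteq> {}" "\<And>v. v \<in> S \<Longrightarrow> Suc p \<le> card {w \<in> S. E v w}"
    by auto
  then obtain s where "s \<in> S" by auto
  from min_degree_path[OF finite_subset[OF S(1) fin] this S(3) irr sym]
  obtain xs where "is_path S E xs" "length xs = Suc (Suc p)" by auto
  then show False using path_le[OF is_path_mono[of S E xs V E]] S by auto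
qed

text \<open>
  Every vertex set contains a vertex with at most \<open>p\<close> neighbours in it, because otherwise a
  greedy path would be too long. Such a vertex is ranked below all others.
\<close>

lemma ex_ranking:
  "\<exists>rk :: 'a \<Rightarrow> nat. inj_on rk V \<and> (\<forall>v\<in>V. card {w \<in> V. E v w \<and> rk v < rk w} \<le> p)"
proof -
  have "\<exists>rk :: 'a \<Rightarrow> nat. inj_on rk S \<and> (\<forall>v\<in>S. card {w \<in> S. E v w \<and> rk v < rk w} \<le> p)"
    if "S \<subseteq> V" for S
    using that
  proof (induction "card S" arbitrary: S)
    case 0
    then show ?case using fin finite_subset by fastforce
  next
    case (Suc n)
    have finS: "finite S" using Suc fin finite_subset by blast
    have "\<exists>v\<in>S. card {w \<in> S. E v w} \<le> p"
    proof (rule ccontr)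
      assume "\<not> ?thesis"
      then have a: "\<And>v. v \<in> S \<Longrightarrow> Suc p \<le> card {w \<in> S. E v w}" by (simp add: not_le Suc_le_eq)
      obtain s where "s \<in> S" using Suc.hyps(2) by fastforce
      from min_degree_path[OF finS this a irr sym]
      obtain xs where "is_path S E xs" "length xs = Suc (Suc p)" by auto
      then show False using path_le[OF is_path_mono[of S E xs V E]] Suc.prems by auto
    qed
    then obtain v where v: "v \<in> S" "card {w \<in> S. E v w} \<le> p" by auto
    have "n = card (S - {v})" using Suc.hyps(2) v by simp
    from Suc.hyps(1)[OF this] Suc.prems obtain rk :: "'a \<Rightarrow> nat"
      where rk: "inj_on rk (S - {v})"
        "\<And>u. u \<in> S - {v} \<Longrightarrow> card {w \<in> S - {v}. E u w \<and> rk u < rk w} \<le> p" by auto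
    define rk' where "rk' = (\<lambda>u. if u = v then 0 else Suc (rk u))"
    have "inj_on rk' S" using rk(1) by (auto simp: inj_on_def rk'_def)
    moreover have "card {w \<in> S. E u w \<and> rk' u < rk' w} \<le> p" if u: "u \<in> S" for u
    proof (cases "u = v")
      case True
      then show ?thesis using v finS
        by (intro order_trans[OF card_mono v(2)]) auto
    next
      case False
      then have "{w \<in> S. E u w \<and> rk' u < rk' w} = {w \<in> S - {v}. E u w \<and> rk u < rk w}"
        by (auto simp: rk'_def)
      then show ?thesis using rk(2)[of u] u False by simp
    qed
    ultimately show ?case by blast
  qed
  then show ?thesis by blast
qed

end

section \<open>Local minima of a ranking along a cycle\<close>

text \<open>
  The set \<open>M\<close> will consist of the positions of local minima on a cycle. As \<open>M\<close> and its cyclic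
  shift are disjoint, \<open>2 |M| \<le> q\<close>. If \<open>|M| = \<lfloor>q/2\<rfloor>\<close>, the two sets leave at most one position
  uncovered; starting there (or at one of the positions \<open>0\<close>, \<open>1\<close> if none is left) membership
  in \<open>M\<close> alternates all the way around. Therefore \<open>2\<close> rotations suffice for even \<open>q\<close> and \<open>q\<close> for
  odd \<open>q\<close> to bring \<open>M\<close> to the odd positions.
\<close>

lemma sparse_cyclic_set:
  fixes M :: "nat set"
  assumes "2 \<le> q" and M: "M \<subseteq> {..<q}" and nc: "\<And>i. i \<in> M \<Longrightarrow> Suc i mod q \<notin> M"
  shows "card M \<le> q div 2"
    and "q div 2 \<le> card M \<Longrightarrow>
      \<exists>t < (if even q then 2 else q). \<forall>i<q. odd i \<longrightarrow> (t + i) mod q \<in> M"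
proof -
  let ?s = "\<lambda>i. Suc i mod q"
  have inj: "inj_on ?s {..<q}"
  proof (rule inj_onI)
    fix x y assume "x \<in> {..<q}" "y \<in> {..<q}" "Suc x mod q = Suc y mod q"
    then show "x = y" by (auto simp: mod_Suc split: if_splits)
  qed
  have finM: "finite M" using M finite_subset by blast
  have disj: "M \<inter> ?s ` M = {}" using nc by auto
  have sM: "?s ` M \<subseteq> {..<q}" using assms by auto
  have cs: "card (?s ` M) = card M" using inj M by (meson card_image inj_on_subset)
  have cU: "card (M \<union> ?s ` M) = 2 * card M"
    using card_Un_disjoint[OF finM finite_imageI[OF finM] disj] cs by simp
  have "card (M \<union> ?s ` M) \<le> card {..<q}" using M sM by (intro card_mono) auto
  then have le: "2 * card M \<le> q" using cU by simp
  then show "card M \<le> q div 2" by linarith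
  assume ge: "q div 2 \<le> card M"
  have "\<exists>t < (if even q then 2 else q). t \<notin> M \<and> (\<forall>u<q. u \<noteq> t \<longrightarrow> u \<in> M \<union> ?s ` M)"
  proof (cases "even q")
    case True
    then have "card (M \<union> ?s ` M) = card {..<q}" using le ge cU by (auto elim!: evenE)
    then have "M \<union> ?s ` M = {..<q}"
      using M sM by (intro card_subset_eq) auto
    moreover have "0 \<notin> M \<or> 1 \<notin> M" using nc[of 0] assms(1) by (cases "q = 2") auto
    moreover have "0 < (2::nat)" "1 < (2::nat)" by auto
    ultimately show ?thesis using True by (metis lessThan_iff)
  next
    case False
    then have "card (M \<union> ?s ` M) = q - 1" using le ge cU by (auto elim!: oddE)
    then have "card ({..<q} - (M \<union> ?s ` M)) = 1"
      using M sM finM assms(1) by (subst card_Diff_subset) auto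
    then obtain t where t: "{..<q} - (M \<union> ?s ` M) = {t}" by (auto simp: card_1_singleton_iff)
    then have "t < q" "t \<notin> M" by auto
    moreover have "\<forall>u<q. u \<noteq> t \<longrightarrow> u \<in> M \<union> ?s ` M" using t by blast
    ultimately show ?thesis using False by auto
  qed
  then obtain t where t: "t < (if even q then 2 else q)" "t \<notin> M"
    "\<And>u. u < q \<Longrightarrow> u \<noteq> t \<Longrightarrow> u \<in> M \<union> ?s ` M" by auto
  have tq: "t < q" using t(1) assms(1) by (auto split: if_splits)
  have step: "(t + Suc k) mod q \<in> M" if "(t + k) mod q \<notin> M" "Suc k < q" for k
  proof -
    have ne: "(t + Suc k) mod q \<noteq> t"
    proof
      assume "(t + Suc k) mod q = t"
      then have "(t + Suc k) mod q = t mod q" using tq by simp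
      then have "q dvd Suc k" by (metis add_diff_cancel_left' mod_eq_dvd_iff_nat le_add1)
      then show False using that(2) by (simp add: nat_dvd_not_less)
    qed
    have "(t + Suc k) mod q \<notin> ?s ` M"
    proof
      assume "(t + Suc k) mod q \<in> ?s ` M"
      then obtain m where m: "m \<in> M" "(t + Suc k) mod q = Suc m mod q" by auto
      have "Suc ((t + k) mod q) mod q = Suc m mod q" using m(2) by (simp add: mod_Suc_eq)
      then have "(t + k) mod q = m" using inj m(1) M assms(1)
        by (auto dest!: inj_onD[of _ _ "(t + k) mod q" m])
      then show False using that(1) m by simp
    qed
    then show ?thesis using t(3)[OF _ ne] assms(1) by auto
  qed
  have "(t + 2 * k) mod q \<notin> M \<and> (t + Suc (2 * k)) mod q \<in> M" if "Suc (2 * k) < q" for k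
    using that
  proof (induction k)
    case 0
    then show ?case using t(2) tq step[of 0] by auto
  next
    case (Suc k)
    then have "(t + Suc (2 * k)) mod q \<in> M" by simp
    then have "(t + 2 * Suc k) mod q \<notin> M"
      using nc[of "(t + Suc (2 * k)) mod q"] by (simp add: mod_Suc_eq)
    then show ?case using step[of "2 * Suc k"] Suc.prems by auto
  qed
  then have "\<forall>i<q. odd i \<longrightarrow> (t + i) mod q \<in> M" by (auto elim!: oddE)
  then show "\<exists>t < (if even q then 2 else q). \<forall>i<q. odd i \<longrightarrow> (t + i) mod q \<in> M"
    using t(1) by blast
qed

locale ranked_path_free = path_free +
  fixes rk :: "'a \<Rightarrow> nat"
  assumes inj_rk: "inj_on rk V"
    and card_up: "v \<in> V \<Longrightarrow> card {w \<in> V. E v w \<and> rk v < rk w} \<le> p"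
    and p_pos: "0 < p"
begin

definition up :: "'a \<Rightarrow> 'a set" where
  "up v = {w \<in> V. E v w \<and> rk v < rk w}"

lemma finite_up: "finite (up v)"
  unfolding up_def using fin by simp

lemma card_up_le: "card (up v) \<le> p"
proof (cases "v \<in> V")
  case False
  then have "up v = {}" using sub by (auto simp: up_def)
  then show ?thesis by simp
qed (use card_up in \<open>simp add: up_def\<close>)

definition local_minima :: "'a list \<Rightarrow> nat set" where
  "local_minima xs = {i. i < length xs \<and>
     rk (xs ! i) < rk (xs ! ((i + length xs - 1) mod length xs)) \<and>
     rk (xs ! i) < rk (xs ! (Suc i mod length xs))}"

text \<open>
  The normal form of a cycle with the largest possible number of local minima. For odd \<open>q\<close> the
  positions \<open>q - 1\<close> and \<open>0\<close> are the only adjacent ones without a local minimum.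
\<close>

definition alternating :: "nat \<Rightarrow> 'a list set" where
  "alternating q = {xs \<in> cycs V E q. \<forall>i<q. odd i \<longrightarrow> i \<in> local_minima xs}"

lemma pred_succ_mod:
  assumes "i < q"
  shows "(Suc i mod q + q - 1) mod q = i" "Suc ((i + q - 1) mod q) mod q = i"
proof -
  show "Suc ((i + q - 1) mod q) mod q = i"
    using assms by (simp add: mod_Suc_eq)
  show "(Suc i mod q + q - 1) mod q = i"
  proof (cases "Suc i = q")
    case False
    then have "Suc i mod q + q - 1 = i + q" using assms by simp
    then show ?thesis using assms by simp
  qed (use assms in auto)
qed

lemma local_minima_sparse:
  assumes "xs \<in> cycs V E q" "i \<in> local_minima xs"
  shows "Suc i mod q \<notin> local_minima xs"
  using assms pred_succ_mod(1)[of i q] by (auto simp: local_minima_def cycs_def)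

lemma cycs_up_neighbour:
  assumes xs: "xs \<in> cycs V E q" and i: "i < q" "i \<notin> local_minima xs" and q: "2 \<le> q"
  shows "xs ! i \<in> up (xs ! ((i + q - 1) mod q)) \<or> xs ! i \<in> up (xs ! (Suc i mod q))"
proof -
  have len: "length xs = q" "distinct xs" and V: "\<And>j. j < q \<Longrightarrow> xs ! j \<in> V"
    using xs nth_mem[of _ xs] by (auto simp: cycs_def)
  let ?a = "(i + q - 1) mod q" and ?b = "Suc i mod q"
  have ab: "?a < q" "?b < q" using i by auto
  have E1: "E (xs ! i) (xs ! ?b)" using xs i by (simp add: cycs_def)
  have "E (xs ! ?a) (xs ! (Suc ?a mod q))" using xs ab by (simp add: cycs_def)
  then have E2: "E (xs ! ?a) (xs ! i)" using pred_succ_mod(2)[OF i(1)] by simp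
  have "rk (xs ! i) \<noteq> rk (xs ! ?a)" "rk (xs ! i) \<noteq> rk (xs ! ?b)"
    using E1 E2 irr V[OF ab(1)] V[OF ab(2)] V[OF i(1)] inj_onD[OF inj_rk] by metis+
  then have "rk (xs ! ?a) < rk (xs ! i) \<or> rk (xs ! ?b) < rk (xs ! i)"
    using i len by (auto simp: local_minima_def)
  then show ?thesis using E1 E2 sym V[OF i(1)] by (auto simp: up_def)
qed

text \<open>
  Label each position by whether it is a local minimum and, if not, by which of its two
  neighbours has lower rank. Given the labels, a local minimum is chosen freely and any other
  entry is one of at most \<open>p\<close> upper neighbours of its parent. The ranks along one cycle with
  these labels show that the dependencies are acyclic.
\<close>

lemma card_cycs_few_minima:
  assumes q: "2 \<le> q" and V: "V \<noteq> {}"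
  shows "real (card {xs \<in> cycs V E q. card (local_minima xs) \<le> s})
    \<le> 3 ^ q * (real (card V) ^ s * real p ^ q)"
proof -
  let ?n = "card V"
  let ?S = "{xs \<in> cycs V E q. card (local_minima xs) \<le> s}"
  define lab where "lab xs = (\<lambda>i\<in>{..<q}. if i \<in> local_minima xs then 0
    else if xs ! i \<in> up (xs ! ((i + q - 1) mod q)) then 1 else (2::nat))" for xs
  define par where "par l i = (if l i = (1::nat) then (i + q - 1) mod q else Suc i mod q)" for l i
  define R where "R l i v = (if l i = (0::nat) then V else up v)" for l and i :: nat and v :: 'a
  define B where "B l = {xs. length xs = q \<and> (\<forall>i<q. xs ! i \<in> R l i (xs ! par l i))}" for l
  have n1: "1 \<le> ?n" using V fin by (simp add: Suc_le_eq card_gt_0_iff)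
  have labS: "lab ` ?S \<subseteq> {..<q} \<rightarrow>\<^sub>E {0,1,2}" 
    unfolding lab_def image_subset_iff restrict_PiE_iff by simp
  have cardL: "card (lab ` ?S) \<le> 3 ^ q"
  proof -
    have "card ({..<q} \<rightarrow>\<^sub>E {0,1,2::nat}) = 3 ^ q" by (simp add: card_PiE numeral_3_eq_3)
    then show ?thesis using card_mono[OF _ labS] by (simp add: finite_PiE)
  qed
  have finL: "finite (lab ` ?S)" using finite_subset[OF labS] by (simp add: finite_PiE)
  have inB: "xs \<in> B (lab xs)" if xs: "xs \<in> cycs V E q" for xs
  proof -
    have "xs ! i \<in> R (lab xs) i (xs ! par (lab xs) i)" if i: "i < q" for i
    proof -
      have "xs ! i \<in> V" using xs i nth_mem[of i xs] by (auto simp: cycs_def)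
      then show ?thesis
        using cycs_up_neighbour[OF xs i _ q] i by (auto simp: R_def par_def lab_def)
    qed
    then show ?thesis using xs by (simp add: B_def cycs_def)
  qed
  have cardB: "finite (B (lab ys)) \<and> real (card (B (lab ys))) \<le> real ?n ^ s * real p ^ q"
    if ys: "ys \<in> ?S" for ys
  proof -
    define l where "l = lab ys"
    define c where "c i = (if l i = 0 then real ?n else real p)" for i
    have lens: "length ys = q" using ys by (simp add: cycs_def)
    have par: "(par l i < q \<and> rk (ys ! par l i) < rk (ys ! i)) \<or> (\<forall>u v. R l i u = R l i v)"
      if i: "i < q" for i
    proof (cases "l i = 0")
      case False
      then have "i \<notin> local_minima ys" using i by (auto simp: l_def lab_def)
      then have "ys ! i \<in> up (ys ! par l i)"
        using cycs_up_neighbour[of ys q i] ys i q by (auto simp: par_def l_def lab_def)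
      then show ?thesis using q by (auto simp: up_def par_def)
    qed (simp add: R_def)
    have fin': "finite (R l i u)" "real (card (R l i u)) \<le> c i" for i u
      using fin finite_up card_up_le by (auto simp: R_def c_def)
    \<comment> \<open>The ranks along the one cycle \<open>ys\<close> with these labels measure the dependencies for all
      lists with these labels.\<close>
    note * = card_dependent_lists[where \<mu> = "\<lambda>i. rk (ys ! i)" and par = "par l" and R = "R l" and c = c and q = q, OF par fin']
    have mins: "{i \<in> {..<q}. l i = 0} = local_minima ys"
      using lens by (auto simp: l_def lab_def local_minima_def)
    have "(\<Prod>i<q. c i) = (\<Prod>i\<in>{i \<in> {..<q}. l i = 0}. c i) * (\<Prod>i\<in>{i \<in> {..<q}. l i \<noteq> 0}. c i)"
      by (subst prod.union_disjoint[symmetric]) (auto intro!: prod.cong)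
    also have "(\<Prod>i\<in>{i \<in> {..<q}. l i = 0}. c i) = real ?n ^ card (local_minima ys)"
      unfolding mins[symmetric] by (simp add: c_def)
    also have "(\<Prod>i\<in>{i \<in> {..<q}. l i \<noteq> 0}. c i) = real p ^ card {i \<in> {..<q}. l i \<noteq> 0}"
      by (simp add: c_def)
    also have "real ?n ^ card (local_minima ys) * real p ^ card {i \<in> {..<q}. l i \<noteq> 0}
      \<le> real ?n ^ s * real p ^ q"
    proof (intro mult_mono power_increasing)
      show "card {i \<in> {..<q}. l i \<noteq> 0} \<le> q"
        by (rule order_trans[OF card_mono[of "{..<q}"]]) auto
    qed (use ys n1 p_pos in auto)
    finally show ?thesis using * by (simp add: B_def l_def)
  qed
  have "?S \<subseteq> (\<Union>l\<in>lab ` ?S. B l)" using inB by auto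
  then have "card ?S \<le> card (\<Union>l\<in>lab ` ?S. B l)"
    by (rule card_mono[OF finite_UN_I[OF finL], rotated]) (use cardB in blast)
  also have "\<dots> \<le> (\<Sum>l\<in>lab ` ?S. card (B l))" by (rule card_UN_le[OF finL])
  finally have "real (card ?S) \<le> (\<Sum>l\<in>lab ` ?S. real (card (B l)))"
    unfolding of_nat_sum[symmetric] by (rule of_nat_mono)
  also have "\<dots> \<le> (\<Sum>l\<in>lab ` ?S. real ?n ^ s * real p ^ q)"
    using cardB by (intro sum_mono) auto
  also have "\<dots> = real (card (lab ` ?S)) * (real ?n ^ s * real p ^ q)" by simp
  also have "\<dots> \<le> 3 ^ q * (real ?n ^ s * real p ^ q)"
    using cardL by (intro mult_right_mono) (auto simp flip: of_nat_power)
  finally show ?thesis .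
qed

lemma card_local_minima_le:
  assumes "2 \<le> q" "xs \<in> cycs V E q"
  shows "card (local_minima xs) \<le> q div 2"
proof (rule sparse_cyclic_set(1)[OF assms(1)])
  show "local_minima xs \<subseteq> {..<q}" using assms by (auto simp: local_minima_def cycs_def)
qed (use local_minima_sparse assms in auto)

lemma card_cycs_le:
  assumes "2 \<le> q" and "V \<noteq> {}"
  shows "real (card (cycs V E q)) \<le> 3 ^ q * (real (card V) ^ (q div 2) * real p ^ q)"
proof -
  have "{xs \<in> cycs V E q. card (local_minima xs) \<le> q div 2} = cycs V E q"
    using card_local_minima_le assms by auto
  then show ?thesis using card_cycs_few_minima[OF assms, of "q div 2"] by simp
qed

lemma local_minima_rotate:
  assumes "length xs = q" "i < q"
  shows "i \<in> local_minima (rotate t xs) \<longleftrightarrow> (t + i) mod q \<in> local_minima xs"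
proof -
  have q: "0 < q" using assms by auto
  have r: "rotate t xs ! j = xs ! ((t + j) mod q)" if "j < q" for j
    using that assms by (simp add: nth_rotate)
  have a: "(t + (i + q - 1) mod q) mod q = ((t + i) mod q + q - 1) mod q"
  proof -
    obtain q' where q': "q = Suc q'" using q by (cases q) auto
    show ?thesis unfolding q' by (simp add: mod_simps add.assoc)
  qed
  have b: "(t + Suc i mod q) mod q = Suc ((t + i) mod q) mod q"
    by (simp add: mod_simps)
  have "(i + q - 1) mod q < q" "Suc i mod q < q" using q by auto
  then show ?thesis
    using assms q by (simp add: local_minima_def r a b del: One_nat_def)
qed

text \<open>
  The cycles with fewer than \<open>\<lfloor>q/2\<rfloor>\<close> local minima give the term of lower order, and every other one
  is in normal form after one of at most \<open>2\<close> or \<open>q\<close> rotations.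
\<close>

lemma card_cycs_le_alternating:
  assumes q: "2 \<le> q" and V: "V \<noteq> {}"
  shows "real (card (cycs V E q)) \<le> 3 ^ q * (real (card V) ^ (q div 2 - 1) * real p ^ q)
    + (if even q then 2 else real q) * real (card (alternating q))"
proof -
  define \<rho> where "\<rho> = (if even q then 2 else q)"
  let ?F = "{xs \<in> cycs V E q. card (local_minima xs) \<le> q div 2 - 1}"
  have fA: "finite (alternating q)" using finite_cycs[OF fin] by (auto simp: alternating_def)
  have cov: "cycs V E q \<subseteq> ?F \<union> (\<Union>t<\<rho>. rotate t -` alternating q)"
  proof
    fix xs assume xs: "xs \<in> cycs V E q"
    show "xs \<in> ?F \<union> (\<Union>t<\<rho>. rotate t -` alternating q)"
    proof (cases "card (local_minima xs) \<le> q div 2 - 1")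
      case False
      have len: "length xs = q" using xs by (simp add: cycs_def)
      have "local_minima xs \<subseteq> {..<q}" using len by (auto simp: local_minima_def)
      then obtain t where t: "t < \<rho>" "\<forall>i<q. odd i \<longrightarrow> (t + i) mod q \<in> local_minima xs"
        using sparse_cyclic_set(2)[OF q, of "local_minima xs"] local_minima_sparse[OF xs] False
        unfolding \<rho>_def by fastforce
      then have "rotate t xs \<in> alternating q"
        using cycs_rotate[OF xs] local_minima_rotate[OF len] by (auto simp: alternating_def)
      then show ?thesis using t by auto
    qed (use xs in auto)
  qed
  have fin_v: "finite (rotate t -` alternating q)" for t
    by (rule finite_vimageI[OF fA inj_rotate])
  have card_v: "card (rotate t -` alternating q) \<le> card (alternating q)" for t
    using card_vimage_inj_on_le[of "rotate t" UNIV "alternating q"] inj_rotate[of t] fA by simp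
  have "card (cycs V E q) \<le> card (?F \<union> (\<Union>t<\<rho>. rotate t -` alternating q))"
    using fin_v finite_cycs[OF fin] by (intro card_mono[OF _ cov]) auto
  also have "\<dots> \<le> card ?F + card (\<Union>t<\<rho>. rotate t -` alternating q)" by (rule card_Un_le)
  also have "card (\<Union>t<\<rho>. rotate t -` alternating q) \<le> (\<Sum>t<\<rho>. card (rotate t -` alternating q))"
    by (rule card_UN_le) simp
  also have "\<dots> \<le> (\<Sum>t<\<rho>. card (alternating q))" using card_v by (intro sum_mono) auto
  finally have "card (cycs V E q) \<le> card ?F + \<rho> * card (alternating q)" by simp
  then have "real (card (cycs V E q)) \<le> real (card ?F) + real \<rho> * real (card (alternating q))"
    by (simp flip: of_nat_mult of_nat_add)
  then show ?thesis
    using card_cycs_few_minima[OF assms, of "q div 2 - 1"] unfolding \<rho>_def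
    by (auto split: if_splits)
qed

end

section \<open>High vertices and popular low vertices\<close>

text \<open>
  The threshold \<open>\<theta>\<close> will be \<open>\<epsilon>n\<close>; the number \<open>D\<close> depends only on \<open>p\<close> and says how many vertices
  with the same hubs are needed to treat them as an inexhaustible supply.
\<close>

locale hub_setting = ranked_path_free +
  fixes \<theta> :: real and D :: nat
  assumes \<theta>_pos: "0 < \<theta>"
begin

definition high :: "'a set" where
  "high = {v \<in> V. \<theta> \<le> real (card {w \<in> V. E v w})}"

definition hubs :: "'a \<Rightarrow> 'a set" where
  "hubs x = {h \<in> high. E x h}"

definition popular :: "'a set" where
  "popular = {x \<in> V - high. D \<le> card {y \<in> V - high. hubs y = hubs x}}"

definition low_nbrs :: "'a \<Rightarrow> 'a set" where
  "low_nbrs v = (if v \<in> high then {} else {w \<in> V. E v w})"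

lemma high_subset: "high \<subseteq> V" and finite_high: "finite high"
  using fin by (auto simp: high_def)

lemma popular_subset: "popular \<subseteq> V - high" and finite_popular: "finite popular"
  using fin by (auto simp: popular_def)

lemma hubs_subset: "hubs x \<subseteq> high" and finite_hubs: "finite (hubs x)"
  using finite_high by (auto simp: hubs_def)

lemma card_low_nbrs: "real (card (low_nbrs v)) \<le> \<theta>" and finite_low_nbrs: "finite (low_nbrs v)"
proof -
  show "finite (low_nbrs v)" using fin by (simp add: low_nbrs_def)
  show "real (card (low_nbrs v)) \<le> \<theta>"
  proof (cases "v \<in> V")
    case True
    then show ?thesis using \<theta>_pos by (auto simp: low_nbrs_def high_def)
  next
    case False
    then have "low_nbrs v = {}" using sub by (auto simp: low_nbrs_def)
    then show ?thesis using \<theta>_pos by simp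
  qed
qed

text \<open>
  The number of ordered adjacent pairs is at most \<open>2 p n\<close>, and every high vertex accounts for
  \<open>\<theta>\<close> of them.
\<close>

lemma card_high_le: "\<theta> * real (card high) \<le> 2 * real p * real (card V)"
proof -
  have "\<theta> * real (card high) = (\<Sum>v\<in>high. \<theta>)" by simp
  also have "\<dots> \<le> (\<Sum>v\<in>high. real (card {w \<in> V. E v w}))"
    by (rule sum_mono) (auto simp: high_def)
  also have "\<dots> \<le> (\<Sum>v\<in>V. real (card {w \<in> V. E v w}))"
    using high_subset fin by (intro sum_mono2) auto
  also have "\<dots> = real (card (Sigma V (\<lambda>v. {w \<in> V. E v w})))"
    using fin by (subst card_SigmaI) auto
  also have "Sigma V (\<lambda>v. {w \<in> V. E v w}) = {(x, y). x \<in> V \<and> y \<in> V \<and> E x y}" by auto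
  also have "real (card \<dots>) \<le> real (2 * p * card V)"
    using card_arcs_le by (rule of_nat_mono)
  finally show ?thesis by simp
qed

text \<open>
  There are boundedly many possible sets of hubs, and each unpopular one is used by fewer than
  \<open>D\<close> vertices. Hence all but boundedly many vertices are low and popular.
\<close>

lemma card_unpopular_le: "card (V - popular) \<le> card high + 2 ^ card high * D"
proof -
  let ?c = "\<lambda>T. {y \<in> V - high. hubs y = T}"
  let ?P = "{T \<in> Pow high. card (?c T) < D}"
  have "V - popular \<subseteq> high \<union> (\<Union>T\<in>?P. ?c T)"
    using hubs_subset by (fastforce simp: popular_def)
  then have "card (V - popular) \<le> card (high \<union> (\<Union>T\<in>?P. ?c T))"
    using fin finite_high by (intro card_mono) auto
  also have "\<dots> \<le> card high + card (\<Union>T\<in>?P. ?c T)" by (rule card_Un_le)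
  also have "card (\<Union>T\<in>?P. ?c T) \<le> (\<Sum>T\<in>?P. card (?c T))"
    using finite_high by (intro card_UN_le) auto
  also have "\<dots> \<le> (\<Sum>T\<in>?P. D)" by (intro sum_mono) auto
  also have "\<dots> = card ?P * D" by simp
  also have "\<dots> \<le> card (Pow high) * D"
    using finite_high by (intro mult_right_mono card_mono) auto
  also have "\<dots> = 2 ^ card high * D" by (simp add: card_Pow finite_high)
  finally show ?thesis by simp
qed

lemma card_odd_below: "card {i \<in> {..<q}. odd i} = q div 2"
proof -
  have "{i \<in> {..<q}. odd i} = (\<lambda>k. 2 * k + 1) ` {..<q div 2}"
    by (auto elim!: oddE simp: image_iff)
  then show ?thesis by (simp add: card_image inj_on_def)
qed

lemma prod_special_odd:
  fixes n \<beta> u :: real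
  assumes "s < q" "odd s" "1 \<le> u" "0 \<le> n" "0 \<le> \<beta>"
  shows "(\<Prod>i<q. if i = s then \<beta> else if odd i then n else u) \<le> n ^ (q div 2 - 1) * \<beta> * u ^ q"
proof -
  let ?c = "\<lambda>i. if i = s then \<beta> else if odd i then n else u"
  let ?O = "{i \<in> {..<q}. odd i}" and ?Ev = "{i \<in> {..<q}. even i}"
  have "(\<Prod>i<q. ?c i) = (\<Prod>i\<in>?O. ?c i) * (\<Prod>i\<in>?Ev. ?c i)"
    by (subst prod.union_disjoint[symmetric]) (auto intro!: prod.cong)
  also have "(\<Prod>i\<in>?O. ?c i) = ?c s * (\<Prod>i\<in>?O - {s}. ?c i)"
    using assms by (intro prod.remove) auto
  also have "(\<Prod>i\<in>?O - {s}. ?c i) = (\<Prod>i\<in>?O - {s}. n)" by (intro prod.cong) auto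
  also have "\<dots> = n ^ (q div 2 - 1)"
    using assms card_odd_below[of q] by simp
  also have "(\<Prod>i\<in>?Ev. ?c i) = (\<Prod>i\<in>?Ev. u)" using assms by (intro prod.cong) auto
  also have "\<dots> = u ^ card ?Ev" by simp
  finally have eq: "(\<Prod>i<q. ?c i) = ?c s * n ^ (q div 2 - 1) * u ^ card ?Ev" .
  have "card ?Ev \<le> card {..<q}" by (intro card_mono) auto
  then have "u ^ card ?Ev \<le> u ^ q" using assms by (intro power_increasing) auto
  then have "(\<beta> * n ^ (q div 2 - 1)) * u ^ card ?Ev \<le> (\<beta> * n ^ (q div 2 - 1)) * u ^ q"
    using assms by (intro mult_left_mono) auto
  then show ?thesis unfolding eq by (simp add: mult_ac)
qed

text \<open>
  In normal form every positive even position has a local minimum just before it, and position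
  \<open>0\<close> has one just after it.
\<close>

definition default_par :: "nat \<Rightarrow> nat" where
  "default_par i = (if i = 0 then 1 else i - 1)"

text \<open>
  These lists include the cycles in normal form whose entry at the odd position \<open>s\<close> is confined to the fewer
  than \<open>\<theta>\<close> neighbours of a low vertex, instead of being free.
\<close>

definition dep_lists :: "nat \<Rightarrow> (nat \<Rightarrow> nat) \<Rightarrow> nat \<Rightarrow> 'a list set" where
  "dep_lists q par s = {xs. length xs = q \<and> (\<forall>i<q. xs ! i \<in>
     (if i = s then low_nbrs (xs ! par i) else if odd i then V else up (xs ! par i)))}"

lemma card_dep_lists:
  fixes \<mu> :: "nat \<Rightarrow> nat"
  assumes s: "s < q" "odd s" and par: "\<And>i. i < q \<Longrightarrow> even i \<or> i = s \<Longrightarrow> par i < q \<and> \<mu> (par i) < \<mu> i"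
  shows "finite (dep_lists q par s) \<and>
    real (card (dep_lists q par s)) \<le> real (card V) ^ (q div 2 - 1) * \<theta> * real p ^ q"
proof -
  let ?R = "\<lambda>i v. if i = s then low_nbrs v else if odd i then V else up v"
  let ?c = "\<lambda>i. if i = s then \<theta> else if odd i then real (card V) else real p"
  have 1: "(par i < q \<and> \<mu> (par i) < \<mu> i) \<or> (\<forall>u v. ?R i u = ?R i v)" if "i < q" for i
    using par[OF that] by auto
  have 2: "finite (?R i u)" "real (card (?R i u)) \<le> ?c i" for i u
    using finite_low_nbrs fin finite_up card_up_le card_low_nbrs by auto
  have eq: "dep_lists q par s = {xs. length xs = q \<and> (\<forall>i<q. xs ! i \<in> ?R i (xs ! par i))}"
    by (simp add: dep_lists_def)
  have "real (card (dep_lists q par s)) \<le> (\<Prod>i<q. ?c i)" "finite (dep_lists q par s)"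
    unfolding eq using card_dependent_lists[where R = ?R and c = ?c and \<mu> = \<mu> and par = par, OF 1 2]
    by blast+
  moreover have "(\<Prod>i<q. ?c i) \<le> real (card V) ^ (q div 2 - 1) * \<theta> * real p ^ q"
    using s p_pos \<theta>_pos by (intro prod_special_odd) auto
  ultimately show ?thesis by linarith
qed

lemma alternating_up:
  assumes xs: "xs \<in> alternating q" and i: "i < q" and q: "2 \<le> q"
  shows "odd i \<Longrightarrow> xs ! (Suc i mod q) \<in> up (xs ! i)"
    and "odd i \<Longrightarrow> xs ! (i - 1) \<in> up (xs ! i)"
    and "even i \<Longrightarrow> xs ! i \<in> up (xs ! default_par i)"
proof -
  have len: "length xs = q" and V: "\<And>j. j < q \<Longrightarrow> xs ! j \<in> V"
    and E: "\<And>j. j < q \<Longrightarrow> E (xs ! j) (xs ! (Suc j mod q))"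
    using xs nth_mem[of _ xs] by (auto simp: cycs_def alternating_def)
  have m: "rk (xs ! j) < rk (xs ! (j - 1)) \<and> rk (xs ! j) < rk (xs ! (Suc j mod q))"
    if "j < q" "odd j" for j
  proof -
    have "(j + q - 1) mod q = j - 1" using that by (auto elim!: oddE)
    then show ?thesis using xs len that by (auto simp: alternating_def local_minima_def)
  qed
  have a: "xs ! (Suc j mod q) \<in> up (xs ! j)" if "j < q" "odd j" for j
    using m[OF that] E[OF that(1)] V[of "Suc j mod q"] q by (auto simp: up_def)
  have b: "xs ! (j - 1) \<in> up (xs ! j)" if "j < q" "odd j" for j
  proof -
    have "Suc (j - 1) mod q = j" using that by (auto elim!: oddE)
    then have "E (xs ! j) (xs ! (j - 1))" using E[of "j - 1"] that sym by auto
    then show ?thesis using m[OF that] V[of "j - 1"] that by (auto simp: up_def)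
  qed
  show "odd i \<Longrightarrow> xs ! (Suc i mod q) \<in> up (xs ! i)" using a i by simp
  show "odd i \<Longrightarrow> xs ! (i - 1) \<in> up (xs ! i)" using b i by simp
  show "xs ! i \<in> up (xs ! default_par i)" if "even i"
  proof (cases "i = 0")
    case True
    then show ?thesis using b[of 1] q by (simp add: default_par_def)
  next
    case False
    then have "odd (i - 1)" using that by simp
    then show ?thesis using a[of "i - 1"] i False by (simp add: default_par_def)
  qed
qed

text \<open>
  A local minimum confined to a bounded set makes one of the factors \<open>n\<close> disappear.
\<close>

lemma card_alternating_hit:
  assumes "s < q" "odd s" "2 \<le> q" "finite Y"
  shows "real (card {xs \<in> alternating q. xs ! s \<in> Y})
    \<le> real (card V) ^ (q div 2 - 1) * real (card Y) * real p ^ q"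
proof -
  let ?R = "\<lambda>i v. if i = s then Y else if odd i then V else up v"
  let ?c = "\<lambda>i. if i = s then real (card Y) else if odd i then real (card V) else real p"
  let ?L = "{xs. length xs = q \<and> (\<forall>i<q. xs ! i \<in> ?R i (xs ! default_par i))}"
  have 1: "(default_par i < q \<and> (if even (default_par i) then 1 else 0) < (if even i then 1 else (0::nat)))
      \<or> (\<forall>u v. ?R i u = ?R i v)" if "i < q" for i
    using that assms by (auto simp: default_par_def)
  have 2: "finite (?R i u)" "real (card (?R i u)) \<le> ?c i" for i u
    using assms(4) fin finite_up card_up_le by auto
  note L = card_dependent_lists[where R = ?R and c = ?c and par = default_par
      and \<mu> = "\<lambda>i. if even i then 1 else 0", OF 1 2]
  have "{xs \<in> alternating q. xs ! s \<in> Y} \<subseteq> ?L"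
  proof safe
    fix xs i assume xs: "xs \<in> alternating q" "xs ! s \<in> Y" and i: "i < q"
    have "xs ! i \<in> V" using xs i nth_mem[of i xs] by (auto simp: cycs_def alternating_def)
    then show "xs ! i \<in> ?R i (xs ! default_par i)"
      using alternating_up(3)[OF xs(1) i assms(3)] xs(2) by auto
  qed (auto simp: alternating_def cycs_def)
  then have "real (card {xs \<in> alternating q. xs ! s \<in> Y}) \<le> real (card ?L)"
    using L(1) by (intro of_nat_mono card_mono) blast+
  also have "\<dots> \<le> (\<Prod>i<q. ?c i)" using L(2) by blast
  also have "\<dots> \<le> real (card V) ^ (q div 2 - 1) * real (card Y) * real p ^ q"
    using assms p_pos by (intro prod_special_odd) auto
  finally show ?thesis .
qed

text \<open>
  Cycles in which hubs and popular vertices alternate. For odd \<open>q\<close> one of the two adjacent even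
  positions \<open>q - 1\<close> and \<open>0\<close> may carry a low vertex.
\<close>

definition clean_cycs :: "nat \<Rightarrow> 'a list set" where
  "clean_cycs q = {xs \<in> alternating q. (\<forall>i<q. odd i \<longrightarrow> xs ! i \<in> popular) \<and>
     (\<forall>i<q. even i \<longrightarrow> odd q \<and> (i = 0 \<or> i = q - 1) \<or> xs ! i \<in> high) \<and>
     (xs ! 0 \<in> high \<or> xs ! (q - 1) \<in> high)}"

text \<open>
  Suppose a cycle in normal form has popular local minima but is not clean. Then some even position
  carries a low vertex with an adjacent local minimum which can be chosen after it: the low vertex
  is reached from its other side, and the local minimum is then one of its few neighbours. Only
  near the positions \<open>q - 1\<close> and \<open>0\<close> of an odd cycle this needs care, since the two vertices there
  are adjacent; the one of higher rank is reached from the one of lower rank.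
\<close>

lemma alternating_cover:
  assumes q: "6 \<le> q"
  shows "alternating q \<subseteq> clean_cycs q \<union> (\<Union>s\<in>{s \<in> {..<q}. odd s}. {xs \<in> alternating q. xs ! s \<in> V - popular})
    \<union> (\<Union>s\<in>{s \<in> {..<q}. odd s \<and> 3 \<le> s}. dep_lists q default_par s)
    \<union> dep_lists q (default_par(0 := q - 1)) 1
    \<union> (if odd q then dep_lists q (default_par(q - 1 := 0, q - 2 := q - 1)) (q - 2) else {})"
    (is "_ \<subseteq> clean_cycs q \<union> ?A \<union> ?B \<union> ?C \<union> ?D")
proof
  fix xs assume xs: "xs \<in> alternating q"
  have q2: "2 \<le> q" using q by simp
  have len: "length xs = q" and V: "\<And>j. j < q \<Longrightarrow> xs ! j \<in> V"
    and E: "\<And>j. j < q \<Longrightarrow> E (xs ! j) (xs ! (Suc j mod q))" and dist: "distinct xs"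
    using xs nth_mem[of _ xs] by (auto simp: cycs_def alternating_def)
  have d: "xs ! i \<in> up (xs ! default_par i)" if "i < q" "even i" for i
    using alternating_up(3)[OF xs that(1) q2 that(2)] .
  have d': "xs ! i \<in> up (xs ! (i - Suc 0))" if "i < q" "even i" "0 < i" for i
    using d[OF that(1,2)] that(3) by (simp add: default_par_def)
  show "xs \<in> clean_cycs q \<union> ?A \<union> ?B \<union> ?C \<union> ?D"
  proof (rule ccontr)
    assume n: "xs \<notin> clean_cycs q \<union> ?A \<union> ?B \<union> ?C \<union> ?D"
    have pop: "xs ! i \<in> popular" if "i < q" "odd i" for i
      using n xs that V by auto
    have low: "xs ! Suc j \<in> low_nbrs (xs ! j)" if "Suc j < q" "xs ! j \<notin> high" for j
      using E[of j] V[of "Suc j"] that by (simp add: low_nbrs_def)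
    \<comment> \<open>Here the default parents work: the low vertex at \<open>j\<close> is reached from
      \<open>j - 1\<close> and confines the entry at \<open>j + 1\<close>.\<close>
    have mid: "xs ! j \<in> high" if j: "even j" "2 \<le> j" "Suc j < q" for j
    proof (rule ccontr)
      assume nh: "xs ! j \<notin> high"
      have "xs \<in> dep_lists q default_par (Suc j)"
        using low[OF j(3) nh] d V len by (auto simp: dep_lists_def default_par_def)
      then have "xs \<in> ?B" using j by (intro UN_I[of "Suc j"]) auto
      then show False using n by blast
    qed
    \<comment> \<open>The low vertex at \<open>0\<close> is reached from \<open>q - 1\<close> and confines the entry at
      \<open>1\<close>.\<close>
    have zero: "xs ! 0 \<in> high" if "xs ! 0 \<in> up (xs ! (q - 1))"
    proof (rule ccontr)
      assume nh: "xs ! 0 \<notin> high"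
      have "xs \<in> dep_lists q (default_par(0 := q - 1)) 1"
        using low[OF _ nh] d' V len that q by (auto simp: dep_lists_def default_par_def)
      then show False using n by simp
    qed
    show False
    proof (cases "even q")
      case True
      then have "odd (q - 1)" "Suc (q - 1) mod q = 0" using q by auto
      then have z: "xs ! 0 \<in> high" using zero alternating_up(1)[OF xs _ q2, of "q - 1"] q by auto
      have "xs ! i \<in> high" if "i < q" "even i" for i
      proof (cases "i = 0")
        case False
        have "Suc i < q" using that True by (metis Suc_lessI even_Suc)
        then show ?thesis using mid[of i] that False by fastforce
      qed (use z in simp)
      then have "xs \<in> clean_cycs q" using xs pop z by (simp add: clean_cycs_def)
      then show False using n by simp
    next
      case False
      have mid': "xs ! i \<in> high" if "i < q" "even i" "i \<noteq> 0" "i \<noteq> q - 1" for i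
        using mid[of i] that by fastforce
      have nz: "xs ! 0 \<notin> high" "xs ! (q - 1) \<notin> high"
      proof -
        have "xs ! 0 \<notin> high \<and> xs ! (q - 1) \<notin> high"
        proof (rule ccontr)
          assume "\<not> ?thesis"
          then have "xs \<in> clean_cycs q" using xs pop mid' False by (auto simp: clean_cycs_def)
          then show False using n by simp
        qed
        then show "xs ! 0 \<notin> high" "xs ! (q - 1) \<notin> high" by auto
      qed
      have Eq: "E (xs ! (q - 1)) (xs ! 0)" using E[of "q - 1"] q by simp
      have "rk (xs ! (q - 1)) \<noteq> rk (xs ! 0)"
        using Eq irr V[of "q - 1"] V[of 0] q inj_onD[OF inj_rk] by (metis less_le_trans zero_less_numeral diff_less zero_less_one)
      then consider "rk (xs ! (q - 1)) < rk (xs ! 0)" | "rk (xs ! 0) < rk (xs ! (q - 1))" by linarith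
      then show False
      proof cases
        case 1
        then have "xs ! 0 \<in> up (xs ! (q - 1))" using Eq V[of 0] q by (auto simp: up_def)
        then show False using zero nz by simp
      next
        case 2
        then have u: "xs ! (q - 1) \<in> up (xs ! 0)" using Eq sym V[of "q - 1"] q by (auto simp: up_def)
        have "E (xs ! (q - 2)) (xs ! (q - 1))"
          using E[of "q - 2"] q by (auto simp: numeral_2_eq_2 Suc_diff_Suc)
        then have l: "xs ! (q - 2) \<in> low_nbrs (xs ! (q - 1))"
          using sym nz V[of "q - 2"] q by (auto simp: low_nbrs_def)
        \<comment> \<open>The low vertex at \<open>q - 1\<close> is reached from \<open>0\<close> and confines the entry at
          \<open>q - 2\<close>.\<close>
        have "xs \<in> dep_lists q (default_par(q - 1 := 0, q - 2 := q - 1)) (q - 2)"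
          unfolding dep_lists_def
        proof (intro CollectI conjI allI impI)
          fix i assume i: "i < q"
          show "xs ! i \<in> (if i = q - 2 then low_nbrs (xs ! (default_par(q - 1 := 0, q - 2 := q - 1)) i)
            else if odd i then V else up (xs ! (default_par(q - 1 := 0, q - 2 := q - 1)) i))"
            using l u V[OF i] d[OF i] by auto
        qed (rule len)
        then show False using n False by simp
      qed
    qed
  qed
qed

lemma card_alternating_le:
  assumes q: "6 \<le> q"
  shows "real (card (alternating q)) \<le> real (card (clean_cycs q))
    + real q * (real (card V) ^ (q div 2 - 1) * real (card (V - popular)) * real p ^ q)
    + (real q + 2) * (real (card V) ^ (q div 2 - 1) * \<theta> * real p ^ q)"
proof -
  let ?a = "\<lambda>s. {xs \<in> alternating q. xs ! s \<in> V - popular}"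
  let ?A = "\<Union>s\<in>{s \<in> {..<q}. odd s}. ?a s"
  let ?B = "\<Union>s\<in>{s \<in> {..<q}. odd s \<and> 3 \<le> s}. dep_lists q default_par s"
  let ?C = "dep_lists q (default_par(0 := q - 1)) 1"
  let ?Dd = "if odd q then dep_lists q (default_par(q - 1 := 0, q - 2 := q - 1)) (q - 2) else {}"
  define \<alpha> where "\<alpha> = real (card V) ^ (q div 2 - 1) * real (card (V - popular)) * real p ^ q"
  define \<beta> where "\<beta> = real (card V) ^ (q div 2 - 1) * \<theta> * real p ^ q"
  have \<beta>0: "0 \<le> \<beta>" and \<alpha>0: "0 \<le> \<alpha>" using \<theta>_pos by (auto simp: \<alpha>_def \<beta>_def)
  have finalt: "finite (alternating q)" using finite_cycs[OF fin] by (auto simp: alternating_def)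
  have a: "real (card (?a s)) \<le> \<alpha>" if "s \<in> {s \<in> {..<q}. odd s}" for s
    using card_alternating_hit[of s q "V - popular"] that q fin by (simp add: \<alpha>_def)
  have b: "finite (dep_lists q default_par s) \<and> real (card (dep_lists q default_par s)) \<le> \<beta>"
    if "s \<in> {s \<in> {..<q}. odd s \<and> 3 \<le> s}" for s
    unfolding \<beta>_def using that q
    by (intro card_dep_lists[where \<mu> = "\<lambda>i. if i = s then 2 else if odd i then 0 else if Suc i = s then 1 else 3"])
       (auto simp: default_par_def)
  have c: "finite ?C \<and> real (card ?C) \<le> \<beta>"
    unfolding \<beta>_def using q
    by (intro card_dep_lists[where \<mu> = "\<lambda>i. if i = 0 then 2 else if i = 1 then 3 else if odd i then 0 else if i = q - 1 then 1 else 4"])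
       (auto simp: default_par_def)
  have d: "finite ?Dd \<and> real (card ?Dd) \<le> \<beta>"
  proof (cases "odd q")
    case True
    have "finite (dep_lists q (default_par(q - 1 := 0, q - 2 := q - 1)) (q - 2)) \<and>
      real (card (dep_lists q (default_par(q - 1 := 0, q - 2 := q - 1)) (q - 2))) \<le> \<beta>"
      unfolding \<beta>_def
    proof (rule card_dep_lists)
      let ?par = "default_par(q - 1 := 0, q - 2 := q - 1)"
      let ?\<mu> = "\<lambda>i. if i = 0 then 1 else if i = q - 1 then 2 else if i = q - 2 then 3
        else if odd i then 0 else 4 :: nat"
      have ne: "q - 1 \<noteq> q - 2" "q - 1 \<noteq> 0" "q - 2 \<noteq> 0" "1 \<noteq> q - 1" "1 \<noteq> q - 2"
        using q by auto
      fix i assume i: "i < q" "even i \<or> i = q - 2"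
      consider "i = 0" | "i = q - 1" | "i = q - 2" | "i \<noteq> 0" "i \<noteq> q - 1" "i \<noteq> q - 2" by blast
      then show "?par i < q \<and> ?\<mu> (?par i) < ?\<mu> i"
      proof cases
        case 4
        then have "odd (i - 1)" "i - 1 \<noteq> 0" "i - 1 \<noteq> q - 1" "i - 1 \<noteq> q - 2" "i - 1 < q" "even i"
          using i by auto
        then show ?thesis using 4 by (simp add: default_par_def)
      qed (use q ne in \<open>simp_all add: default_par_def\<close>)
    qed (use q True in auto)
    then show ?thesis using True by simp
  qed (use \<beta>0 in simp)
  have cardO: "card {s \<in> {..<q}. odd s} \<le> q" "card {s \<in> {..<q}. odd s \<and> 3 \<le> s} \<le> q"
    by (rule order_trans[OF card_mono[of "{..<q}"]]; auto)+
  have UN: "real (card (\<Union>s\<in>I. f s)) \<le> real q * g"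
    if "finite I" "card I \<le> q" "\<And>s. s \<in> I \<Longrightarrow> real (card (f s)) \<le> g" "0 \<le> g"
    for I :: "nat set" and f :: "nat \<Rightarrow> 'a list set" and g
  proof -
    have "real (card (\<Union>s\<in>I. f s)) \<le> real (\<Sum>s\<in>I. card (f s))"
      using card_UN_le[OF that(1)] by (rule of_nat_mono)
    also have "\<dots> \<le> (\<Sum>s\<in>I. g)" unfolding of_nat_sum using that(3) by (rule sum_mono)
    also have "\<dots> = real (card I) * g" by simp
    also have "\<dots> \<le> real q * g" using that by (intro mult_right_mono) auto
    finally show ?thesis .
  qed
  have A: "real (card ?A) \<le> real q * \<alpha>" by (rule UN) (use a cardO \<alpha>0 in auto)
  have B: "real (card ?B) \<le> real q * \<beta>" by (rule UN) (use b cardO \<beta>0 in auto)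
  have "finite (clean_cycs q)" using finalt by (auto simp: clean_cycs_def)
  moreover have "finite ?A" using finalt by auto
  moreover have "finite ?B" using b by auto
  ultimately have "card (alternating q) \<le> card (clean_cycs q \<union> ?A \<union> ?B \<union> ?C \<union> ?Dd)"
    using c d by (intro card_mono[OF _ alternating_cover[OF q]] finite_UnI) auto
  also have "\<dots> \<le> card (clean_cycs q) + card ?A + card ?B + card ?C + card ?Dd"
    by (intro order_trans[OF card_Un_le] add_right_mono order.refl)
  finally have "real (card (alternating q)) \<le> real (card (clean_cycs q)) + real (card ?A) + real (card ?B)
     + real (card ?C) + real (card ?Dd)" by (simp flip: of_nat_add)
  then show ?thesis using A B c d unfolding \<alpha>_def[symmetric] \<beta>_def[symmetric]
    by (simp add: algebra_simps)
qed

end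

section \<open>Walks that alternate between hubs and popular vertices\<close>

fun evs :: "'a list \<Rightarrow> 'a list" and ods :: "'a list \<Rightarrow> 'a list" where
  "evs [] = []"
| "evs (x # xs) = x # ods xs"
| "ods [] = []"
| "ods (x # xs) = evs xs"

lemma length_evs_ods: "length (evs w) = (length w + 1) div 2" "length (ods w) = length w div 2"
  by (induction w) auto

lemma set_evs_ods: "set (evs w) \<union> set (ods w) = set w"
  by (induction w) auto

lemma distinct_evs_ods: "distinct w \<Longrightarrow> distinct (evs w) \<and> distinct (ods w)"
proof (induction w)
  case (Cons x w)
  then show ?case using set_evs_ods[of w] by auto
qed simp

lemma evs_ods_inject: "length w = length w' \<Longrightarrow> evs w = evs w' \<Longrightarrow> ods w = ods w' \<Longrightarrow> w = w'"
  by (induction w w' rule: list_induct2) auto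

context hub_setting
begin

fun hub_walk :: "'a list \<Rightarrow> bool" where
  "hub_walk [] = False"
| "hub_walk [z] = (z \<in> high)"
| "hub_walk (z # y # w) = (z \<in> high \<and> y \<in> popular \<and> E z y \<and> hub_walk w \<and> E y (hd w))"

definition spanned :: "'a list \<Rightarrow> 'a set" where
  "spanned w = set (evs w) \<union> (\<Union>y\<in>set (ods w). hubs y)"

text \<open>
  By the choice of popular vertices, linked hubs have at least \<open>D\<close> common low neighbours.
\<close>

definition linked :: "'a \<Rightarrow> 'a \<Rightarrow> bool" where
  "linked h h' \<longleftrightarrow> (\<exists>y\<in>popular. h \<in> hubs y \<and> h' \<in> hubs y)"

lemma hub_walk_odd_length: "hub_walk w \<Longrightarrow> odd (length w)"
  by (induction w rule: hub_walk.induct) auto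

lemma hub_walk_evs_high: "hub_walk w \<Longrightarrow> set (evs w) \<subseteq> high"
  by (induction w rule: hub_walk.induct) auto

lemma hub_walk_ods_popular: "hub_walk w \<Longrightarrow> set (ods w) \<subseteq> popular"
  by (induction w rule: hub_walk.induct) auto

lemma hub_walk_hd_high: "hub_walk w \<Longrightarrow> hd w \<in> high"
  by (cases w rule: hub_walk.cases) auto

lemma spanned_subset_high: "hub_walk w \<Longrightarrow> spanned w \<subseteq> high"
  using hub_walk_evs_high hubs_subset by (auto simp: spanned_def)

lemma finite_spanned: "finite (spanned w)"
  by (auto simp: spanned_def finite_hubs)

lemma hub_walkI:
  assumes "odd (length w)" "successively E w"
    "\<And>i. i < length w \<Longrightarrow> even i \<Longrightarrow> w ! i \<in> high"
    "\<And>i. i < length w \<Longrightarrow> odd i \<Longrightarrow> w ! i \<in> popular"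
  shows "hub_walk w"
  using assms
proof (induction w rule: hub_walk.induct)
  case (3 z y w)
  have "w \<noteq> []" using 3(2) by auto
  have "hub_walk w"
  proof (rule 3(1))
    show "successively E w" using 3(3) by (auto simp: successively_Cons)
    show "w ! i \<in> high" if "i < length w" "even i" for i using 3(4)[of "i + 2"] that by simp
    show "w ! i \<in> popular" if "i < length w" "odd i" for i using 3(5)[of "i + 2"] that by simp
  qed (use 3 in auto)
  then show ?case using 3(3) 3(4)[of 0] 3(5)[of 1] \<open>w \<noteq> []\<close> by (auto simp: successively_Cons)
qed auto

text \<open>
  On a walk with at least two hubs, every hub is next to a popular vertex.
\<close>

lemma evs_in_spanned_hubs:
  assumes "hub_walk w" "3 \<le> length w"
  shows "spanned w = (\<Union>y\<in>set (ods w). hubs y)"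
proof -
  have "set (evs w) \<subseteq> (\<Union>y\<in>set (ods w). hubs y)" if "hub_walk w" "3 \<le> length w" for w
    using that
  proof (induction w rule: hub_walk.induct)
    case (3 z y w)
    have z: "z \<in> hubs y" using 3 sym by (auto simp: hubs_def)
    show ?case
    proof (cases "3 \<le> length w")
      case True
      then show ?thesis using 3 z by auto
    next
      case False
      then have "length w = 1" using hub_walk_odd_length[of w] 3(2) by (auto elim: oddE)
      then obtain x where "w = [x]" by (auto simp: length_Suc_conv)
      then show ?thesis using 3 z by (auto simp: hubs_def)
    qed
  qed auto
  then show ?thesis using assms by (auto simp: spanned_def)
qed

text \<open>
  The hubs of one popular vertex are pairwise linked, and consecutive popular vertices of the walk
  share the hub between them. So one can run through all hubs of the first popular vertex, pass to
  the next hub of the walk, run through the new hubs of the second one, and so on. The set \<open>Z\<close> of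
  hubs to be avoided makes the induction work, as hubs met earlier may reappear later.
\<close>

lemma spanned_hub_path:
  assumes "hub_walk w" "distinct (evs w)" "Z \<inter> set (evs w) = {}"
  shows "\<exists>hs. distinct hs \<and> hs \<noteq> [] \<and> hd hs = hd w \<and> last hs = last w \<and>
    set hs = spanned w - Z \<and> successively linked hs"
  using assms
proof (induction w arbitrary: Z rule: hub_walk.induct)
  case (2 z)
  then show ?case by (intro exI[of _ "[z]"]) (auto simp: spanned_def)
next
  case (3 z y w)
  have w: "hub_walk w" "w \<noteq> []" using 3 by auto
  have zn: "z \<notin> set (evs w)" using 3 by simp
  from 3(1)[OF w(1), of "insert z Z"] 3(3,4) zn
  obtain hs where hs: "distinct hs" "hs \<noteq> []" "hd hs = hd w" "last hs = last w"
    "set hs = spanned w - insert z Z" "successively linked hs" by auto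
  define F where "F = hubs y - Z - {z} - set hs"
  have "finite F" using finite_hubs by (simp add: F_def)
  then obtain fs where fs: "set fs = F" "distinct fs" using finite_distinct_list by blast
  have z: "z \<in> hubs y" "z \<in> high" "y \<in> popular" using 3 sym by (auto simp: hubs_def)
  have hw: "hd w \<in> hubs y" using 3 hub_walk_hd_high[OF w(1)] by (simp add: hubs_def)
  have lk: "successively linked us" if "set us \<subseteq> hubs y" for us
    using that z(3) by (induction us rule: induct_list012) (auto simp: linked_def)
  have sub: "set (z # fs) \<subseteq> hubs y" using fs z by (auto simp: F_def)
  have "last (z # fs) \<in> hubs y" using sub last_in_set[of "z # fs"] by blast
  then have "linked (last (z # fs)) (hd hs)" using hw hs(3) z(3) by (auto simp: linked_def)
  then have "successively linked ((z # fs) @ hs)"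
    using lk[OF sub] hs(6) by (subst successively_append_iff) blast
  moreover have "distinct ((z # fs) @ hs)" using fs hs by (auto simp: F_def)
  moreover have "set ((z # fs) @ hs) = spanned (z # y # w) - Z"
    using fs(1) hs(5) 3(4) by (auto simp: F_def spanned_def)
  ultimately show ?case using hs(2,4) w by (intro exI[of _ "(z # fs) @ hs"]) auto
qed auto

lemma linked_leaf:
  assumes "linked h h'" "card F < D" "finite F"
  shows "\<exists>l\<in>V - high. l \<notin> F \<and> E h l \<and> E l h'"
proof -
  obtain y where y: "y \<in> popular" "h \<in> hubs y" "h' \<in> hubs y"
    using assms(1) by (auto simp: linked_def)
  let ?c = "{x \<in> V - high. hubs x = hubs y}"
  have "card F < card ?c" using assms(2) y by (simp add: popular_def)
  then have "\<not> ?c \<subseteq> F" using assms(3) by (meson card_mono leD)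
  then obtain l where l: "l \<in> V - high" "hubs l = hubs y" "l \<notin> F" by blast
  then show ?thesis using y sym by (auto simp: hubs_def)
qed

lemma weave_hub_path:
  assumes "successively linked hs" "distinct hs" "set hs \<subseteq> high" "hs \<noteq> []"
    "finite F" "card F + 2 * length hs \<le> D"
  shows "\<exists>P. is_path V E P \<and> hd P = hd hs \<and> last P = last hs \<and> length P = 2 * length hs - 1 \<and>
    set P \<inter> high = set hs \<and> (set P - high) \<inter> F = {}"
  by (rule weave_path[where link = linked, OF linked_leaf high_subset assms])

end

text \<open>
  The constant in the bound on \<open>D\<close> leaves room for a hub path on at most \<open>2 a + 1\<close> vertices and
  two additional low paths on at most \<open>a + 2\<close> vertices each.
\<close>

locale hub_bounded = hub_setting +
  fixes a :: nat
  assumes p_le: "p \<le> 2 * a + 2" and a_pos: "1 \<le> a" and D_ge: "8 * a + 20 \<le> D"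
begin

text \<open>
  Otherwise \<open>a + 1\<close> hubs can be threaded into a path on \<open>2 a + 1\<close> vertices, and a further low
  vertex at each end gives \<open>2 a + 3 > p\<close> vertices.
\<close>

lemma card_spanned_le:
  assumes "hub_walk w" "distinct (evs w)"
  shows "card (spanned w) \<le> a"
proof (rule ccontr)
  assume "\<not> ?thesis"
  then have gt: "a < card (spanned w)" by simp
  obtain hs where hs: "distinct hs" "set hs = spanned w" "successively linked hs"
    using spanned_hub_path[OF assms, of "{}"] by auto
  have len: "a < length hs" using gt hs distinct_card by metis
  define gs where "gs = take (Suc a) hs"
  have gs: "distinct gs" "set gs \<subseteq> high" "successively linked gs" "length gs = Suc a"
  proof -
    show "distinct gs" "length gs = Suc a" using hs len by (auto simp: gs_def)
    show "set gs \<subseteq> high" using spanned_subset_high[OF assms(1)] hs(2) set_take_subset[of "Suc a" hs]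
      by (auto simp: gs_def)
    show "successively linked gs"
      using hs(3) successively_append_iff[of linked "take (Suc a) hs" "drop (Suc a) hs"]
      by (simp add: gs_def)
  qed
  have gne: "gs \<noteq> []" using gs(4) by auto
  obtain P where P: "is_path V E P" "hd P = hd gs" "last P = last gs"
    "length P = 2 * length gs - 1" "set P \<inter> high = set gs"
    using weave_hub_path[OF gs(3,1,2) gne, of "{}"] D_ge gs(4) by auto
  have Pne: "P \<noteq> []" using P(4) gs(4) by auto
  have cP: "card (set P) \<le> 2 * a + 1" using P(4) gs(4) card_length[of P] by simp
  have lk: "linked (gs ! 0) (gs ! 1)" "linked (gs ! (a - 1)) (gs ! a)"
    using gs(3,4) a_pos successively_nth[of linked gs 0] successively_nth[of linked gs "a - 1"] by auto
  have "hd gs = gs ! 0" "last gs = gs ! a" using gne gs(4) by (auto simp: hd_conv_nth last_conv_nth)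
  obtain l where l: "l \<in> V - high" "l \<notin> set P" "E l (hd gs)"
    using linked_leaf[OF lk(1), of "set P"] cP D_ge sym \<open>hd gs = _\<close> by auto
  obtain l' where l': "l' \<in> V - high" "l' \<notin> insert l (set P)" "E (last gs) l'"
  proof -
    have "card (insert l (set P)) < D" using cP D_ge l(2) by simp
    from linked_leaf[OF lk(2) this] show ?thesis using sym \<open>last gs = _\<close> that by auto
  qed
  have "is_path V E ([l] @ P @ [l'])"
    unfolding is_path_append using P Pne l l' by (auto simp: is_path_def)
  from path_le[OF this] show False using P(4) gs(4) p_le by simp
qed

section \<open>Completing a hub walk to a cycle\<close>

text \<open>
  Ordered edges between low vertices that can close a hub walk from \<open>v\<close> to \<open>u\<close> to an odd cycle.
\<close>

definition low_arcs :: "'a \<Rightarrow> 'a \<Rightarrow> ('a \<times> 'a) set" where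
  "low_arcs u v = {(c, d). c \<in> V - high \<and> d \<in> V - high \<and> E c d \<and> E u c \<and> E d v}"

text \<open>
  Used to delete the vertices of a short path without losing many arcs.
\<close>

lemma card_arcs_touching:
  assumes "finite X" "\<And>x y. F x y \<Longrightarrow> E x y \<and> x \<notin> high \<and> y \<notin> high" "X \<subseteq> V"
  shows "real (card {(x, y). x \<in> V \<and> y \<in> V \<and> F x y \<and> (x \<in> X \<or> y \<in> X)}) \<le> 2 * real (card X) * \<theta>"
proof -
  let ?L = "{(x, y). x \<in> V \<and> y \<in> V \<and> F x y \<and> (x \<in> X \<or> y \<in> X)}"
  let ?S = "Sigma X low_nbrs"
  have S: "real (card ?S) \<le> real (card X) * \<theta>"
  proof -
    have "real (card ?S) = (\<Sum>x\<in>X. real (card (low_nbrs x)))"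
      using assms(1) finite_low_nbrs by (subst card_SigmaI) auto
    also have "\<dots> \<le> (\<Sum>x\<in>X. \<theta>)" using card_low_nbrs by (intro sum_mono)
    finally show ?thesis by simp
  qed
  have finS: "finite ?S" using assms(1) finite_low_nbrs by auto
  have "?L \<subseteq> ?S \<union> prod.swap ` ?S"
    using assms(2) sym by (fastforce simp: low_nbrs_def image_iff)
  then have "card ?L \<le> card (?S \<union> prod.swap ` ?S)"
    using finS by (intro card_mono) auto
  also have "\<dots> \<le> card ?S + card ?S"
    using finS by (intro order_trans[OF card_Un_le] add_left_mono card_image_le)
  finally have "real (card ?L) \<le> real (card ?S) + real (card ?S)" by (simp flip: of_nat_add)
  then show ?thesis using S by simp
qed

text \<open>
  Put \<open>k = a - m\<close>, where \<open>m\<close> is the number of spanned hubs. If there were more arcs, they would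
  contain a subgraph of minimum degree \<open>k + 1\<close> and in it a path on \<open>k + 2\<close> vertices that starts
  next to the first hub. After deleting its vertices, which have low degree, there is still a
  second path of this kind starting next to the last hub. Both together prolong the hub path on
  \<open>2 m - 1\<close> vertices to a path on \<open>2 (k + 2) + 2 m - 1 = 2 a + 3\<close> vertices.
\<close>

lemma card_low_arcs_le:
  assumes w: "hub_walk w" "distinct (evs w)"
  shows "real (card (low_arcs (last w) (hd w)))
    \<le> 2 * real (a - card (spanned w)) * real (card V) + 2 * (real a + 2) * \<theta>"
proof (rule ccontr)
  define k where "k = a - card (spanned w)"
  define A where "A = low_arcs (last w) (hd w)"
  \<comment> \<open>The undirected graph of the arcs. Every edge has one end next to the first hub and one end next to
    the last hub.\<close>
  define F where "F c d \<longleftrightarrow> (c, d) \<in> A \<or> (d, c) \<in> A" for c d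
  let ?L = "V - high"
  let ?arcs = "\<lambda>S. {(x, y). x \<in> S \<and> y \<in> S \<and> F x y}"
  have m: "card (spanned w) \<le> a" by (rule card_spanned_le[OF w])
  have km: "k + card (spanned w) = a" using m by (simp add: k_def)
  assume "\<not> ?thesis"
  then have big: "real (card A) > 2 * real k * real (card V) + 2 * (real a + 2) * \<theta>"
    by (simp add: A_def k_def)
  have Fsym: "F x y \<Longrightarrow> F y x" for x y by (auto simp: F_def)
  have FE: "F x y \<Longrightarrow> E x y \<and> x \<in> V - high \<and> y \<in> V - high" for x y
    using sym by (auto simp: F_def A_def low_arcs_def)
  have Firr: "\<not> F x x" for x using FE irr by blast
  have finarcs: "finite (?arcs S)" for S
  proof (rule finite_subset)
    show "?arcs S \<subseteq> V \<times> V" using FE by auto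
  qed (use fin in auto)
  have bigL: "2 * real k * real (card V) + 2 * (real a + 2) * \<theta> < real (card (?arcs ?L))"
  proof -
    have "A \<subseteq> ?arcs ?L" using FE by (auto simp: F_def)
    then have "card A \<le> card (?arcs ?L)" using finarcs by (intro card_mono)
    then show ?thesis using big by linarith
  qed
  \<comment> \<open>Each edge has an end satisfying \<open>Q\<close>, so a path with this kind of first vertex can be
    found.\<close>
  have core: "\<exists>xs. is_path S F xs \<and> length xs = k + 2 \<and> Q (hd xs)"
    if S: "S \<subseteq> ?L" "2 * real k * real (card V) < real (card (?arcs S))"
      and Q: "\<And>c d. (c, d) \<in> A \<Longrightarrow> Q c \<or> Q d" for S Q
  proof -
    have finS: "finite S" using S fin finite_subset by blast
    have "real (2 * k * card S) \<le> 2 * real k * real (card V)"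
    proof -
      have "card S \<le> card V" using card_mono[OF fin] S(1) by blast
      then show ?thesis by (simp add: mult_left_mono)
    qed
    then have "real (2 * k * card S) < real (card (?arcs S))" using S(2) by linarith
    then have "2 * k * card S < card (?arcs S)" by (simp only: of_nat_less_iff)
    from dense_has_core[OF finS Fsym Firr this]
    obtain S' where S': "S' \<subseteq> S" "S' \<noteq> {}" "\<And>v. v \<in> S' \<Longrightarrow> Suc k \<le> card {w \<in> S'. F v w}" by blast
    then obtain v where v: "v \<in> S'" by auto
    then have "{w \<in> S'. F v w} \<noteq> {}" using S'(3)[OF v] by (metis card.empty not_less_eq_eq zero_le)
    then obtain v' where v': "v' \<in> S'" "F v v'" by auto
    then obtain s where s: "s \<in> S'" "Q s" using Q v by (auto simp: F_def)
    from min_degree_path[OF finite_subset[OF S'(1) finS] s(1) S'(3) Firr Fsym]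
    obtain xs where "is_path S' F xs" "length xs = Suc (Suc k)" "hd xs = s" by auto
    then show ?thesis using is_path_mono[OF _ S'(1)] s by (intro exI[of _ xs]) auto
  qed
  have Q1: "E d (hd w)" and Q2: "E (last w) c" if "(c, d) \<in> A" for c d
    using that by (auto simp: A_def low_arcs_def)
  have b1: "2 * real k * real (card V) < real (card (?arcs ?L))"
  proof -
    have "0 \<le> 2 * (real a + 2) * \<theta>" using \<theta>_pos by simp
    then show ?thesis using bigL by linarith
  qed
  from core[OF order.refl b1, of "\<lambda>s. E s (hd w)"] Q1
  obtain xs where xs: "is_path ?L F xs" "length xs = k + 2" "E (hd xs) (hd w)" by blast
  have cx: "card (set xs) = k + 2" using xs by (metis distinct_card is_path_def)
  have "2 * real k * real (card V) < real (card (?arcs (?L - set xs)))"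
  proof -
    let ?T = "{(x, y). x \<in> V \<and> y \<in> V \<and> F x y \<and> (x \<in> set xs \<or> y \<in> set xs)}"
    have T: "real (card ?T) \<le> 2 * real (card (set xs)) * \<theta>"
      using FE xs by (intro card_arcs_touching) (auto simp: is_path_def)
    have "?arcs ?L \<subseteq> ?arcs (?L - set xs) \<union> ?T" by auto
    moreover have "finite ?T" using fin by (intro finite_subset[of ?T "V \<times> V"]) auto
    ultimately have "card (?arcs ?L) \<le> card (?arcs (?L - set xs) \<union> ?T)"
      by (intro card_mono finite_UnI finarcs)
    also have "\<dots> \<le> card (?arcs (?L - set xs)) + card ?T" by (rule card_Un_le)
    finally have "real (card (?arcs ?L)) \<le> real (card (?arcs (?L - set xs))) + real (card ?T)"
      by (simp flip: of_nat_add)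
    moreover have "2 * real (card (set xs)) * \<theta> \<le> 2 * (real a + 2) * \<theta>"
      using cx km \<theta>_pos by (intro mult_right_mono) auto
    ultimately show ?thesis using bigL T by linarith
  qed
  from core[OF _ this, of "\<lambda>s. E (last w) s"] Q2
  obtain ys where ys: "is_path (?L - set xs) F ys" "length ys = k + 2" "E (last w) (hd ys)" by blast
  have cy: "card (set ys) = k + 2" using ys by (metis distinct_card is_path_def)
  obtain hs where hs: "distinct hs" "hs \<noteq> []" "hd hs = hd w" "last hs = last w"
    "set hs = spanned w" "successively linked hs"
    using spanned_hub_path[OF w, of "{}"] by auto
  have lh: "length hs = card (spanned w)" using hs by (metis distinct_card)
  have "card (set xs \<union> set ys) + 2 * length hs \<le> D"
    using card_Un_le[of "set xs" "set ys"] cx cy km lh D_ge by linarith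
  from weave_hub_path[OF hs(6,1) _ hs(2) _ this] hs(5) spanned_subset_high[OF w(1)]
  obtain P where P: "is_path V E P" "hd P = hd hs" "last P = last hs" "length P = 2 * length hs - 1"
    "set P \<inter> high = set hs" "(set P - high) \<inter> (set xs \<union> set ys) = {}" by auto
  have ne: "xs \<noteq> []" "ys \<noteq> []" using xs(2) ys(2) by auto
  have "P \<noteq> []" using P(4) hs(2) by (cases hs) auto
  note ne = ne this
  have xsL: "set xs \<subseteq> ?L" and ysL: "set ys \<subseteq> ?L - set xs" using xs ys by (auto simp: is_path_def)
  have 1: "is_path V E xs" "is_path V E ys"
    using is_path_mono[OF xs(1), of V E] is_path_mono[OF ys(1), of V E] FE by auto
  have "is_path V E (rev xs @ P @ ys)"
    unfolding is_path_append
    using is_path_rev[OF sym 1(1)] 1(2) P ne xs(3) ys(3) hs(3,4) xsL ysL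
    by (auto simp: last_rev)
  from path_le[OF this] show False
    using xs(2) ys(2) P(4) lh km p_le hs(2) by (cases hs) auto
qed

text \<open>
  These include all pairs of a hub \<open>c\<close> and a popular vertex \<open>d\<close> that close the walk \<open>w\<close> to an odd
  cycle.
\<close>

definition hub_arcs :: "'a list \<Rightarrow> ('a \<times> 'a) set" where
  "hub_arcs w = {(c, d). c \<notin> set (evs w) \<and> hub_walk (c # d # w)}"

lemma finite_hub_arcs: "finite (hub_arcs w)"
proof (rule finite_subset)
  show "hub_arcs w \<subseteq> high \<times> popular" by (auto simp: hub_arcs_def)
qed (use finite_high finite_popular in auto)

lemma finite_low_arcs: "finite (low_arcs u v)"
  by (rule finite_subset[of _ "V \<times> V"]) (use fin in \<open>auto simp: low_arcs_def\<close>)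

text \<open>
  For fixed \<open>d\<close> all candidates for \<open>c\<close> and all hubs on the walk are spanned by the prolonged walk.
  So together they are at most \<open>a\<close>.
\<close>

lemma card_hub_arcs_le:
  assumes w: "distinct (evs w)"
  shows "card (hub_arcs w) \<le> (a - length (evs w)) * card V"
proof -
  have *: "card {c. (c, d) \<in> hub_arcs w} \<le> a - length (evs w)" for d
  proof (cases "{c. (c, d) \<in> hub_arcs w} = {}")
    case False
    then obtain c0 where c0: "(c0, d) \<in> hub_arcs w" by auto
    let ?w = "c0 # d # w"
    have "card (spanned ?w) \<le> a" using c0 w by (intro card_spanned_le) (auto simp: hub_arcs_def)
    have "{c. (c, d) \<in> hub_arcs w} \<union> set (evs w) \<subseteq> spanned ?w"
      using sym by (auto simp: hub_arcs_def spanned_def hubs_def)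
    then have "card ({c. (c, d) \<in> hub_arcs w} \<union> set (evs w)) \<le> card (spanned ?w)"
      by (intro card_mono finite_spanned)
    also have "\<dots> \<le> a" by fact
    also have "card ({c. (c, d) \<in> hub_arcs w} \<union> set (evs w))
      = card {c. (c, d) \<in> hub_arcs w} + card (set (evs w))"
      by (rule card_Un_disjoint)
        (auto simp: hub_arcs_def intro: finite_subset[OF _ finite_high])
    finally show ?thesis using distinct_card[OF w] by simp
  qed (simp only: card.empty le0)
  have "hub_arcs w \<subseteq> (\<lambda>(d, c). (c, d)) ` Sigma V (\<lambda>d. {c. (c, d) \<in> hub_arcs w})"
    using popular_subset by (fastforce simp: hub_arcs_def)
  moreover have finS: "finite {c. (c, d) \<in> hub_arcs w}" for d
    by (rule finite_subset[OF _ finite_high]) (auto simp: hub_arcs_def)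
  ultimately have "card (hub_arcs w) \<le> card (Sigma V (\<lambda>d. {c. (c, d) \<in> hub_arcs w}))"
    using fin by (meson card_mono card_image_le finite_SigmaI finite_imageI le_trans)
  also have "\<dots> = (\<Sum>d\<in>V. card {c. (c, d) \<in> hub_arcs w})" using fin finS by simp
  also have "\<dots> \<le> (\<Sum>d\<in>V. a - length (evs w))" using * by (intro sum_mono)
  finally show ?thesis by (simp add: mult.commute)
qed

definition hub_walks :: "nat \<Rightarrow> 'a list set" where
  "hub_walks r = {w. length w = 2 * r - 1 \<and> distinct w \<and> set w \<subseteq> V \<and> hub_walk w}"

lemma finite_hub_walks: "finite (hub_walks r)"
  by (rule finite_subset[OF _ finite_lists_length_eq[OF fin]]) (auto simp: hub_walks_def)

text \<open>
  An upper bound on the number of clean cycles that arise from the walk \<open>w\<close>.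
\<close>

definition weight :: "nat \<Rightarrow> 'a list \<Rightarrow> real" where
  "weight q w = (if even q then real (card V) else
     real (a - q div 2) * real (card V) + 2 * real (a - card (spanned w)) * real (card V)
     + 2 * (real a + 2) * \<theta>)"

lemma cycs_segment:
  "xs \<in> cycs V E q \<Longrightarrow> successively E (take k (drop i xs))"
  by (metis append_take_drop_id cycs_successively successively_append_iff)

lemma hub_walk_segment:
  assumes "xs \<in> clean_cycs q" "even i" "i + (2 * r - 1) \<le> q" "1 \<le> r"
    and high: "\<And>j. even j \<Longrightarrow> i \<le> j \<Longrightarrow> j < i + (2 * r - 1) \<Longrightarrow> xs ! j \<in> high"
  shows "take (2 * r - 1) (drop i xs) \<in> hub_walks r"
proof -
  have xs: "xs \<in> cycs V E q" using assms by (simp add: clean_cycs_def alternating_def)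
  then have len: "length xs = q" "distinct xs" "set xs \<subseteq> V" by (auto simp: cycs_def)
  let ?w = "take (2 * r - 1) (drop i xs)"
  have lw: "length ?w = 2 * r - 1" using len assms by simp
  have "hub_walk ?w"
  proof (rule hub_walkI)
    show "odd (length ?w)" unfolding lw using assms by simp
    show "successively E ?w" by (rule cycs_segment[OF xs])
    show "?w ! j \<in> high" if "j < length ?w" "even j" for j
      using that assms(2,3) high[of "i + j"] len lw by simp
    show "?w ! j \<in> popular" if "j < length ?w" "odd j" for j
      using that assms(1,2,3) len lw by (simp add: clean_cycs_def)
  qed
  moreover have "distinct ?w" "set ?w \<subseteq> V"
    using len by (auto dest!: in_set_takeD in_set_dropD)
  ultimately show ?thesis using lw by (simp add: hub_walks_def)
qed

text \<open>
  A clean even cycle is a hub walk followed by one more low vertex.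
\<close>

lemma card_clean_cycs_even_le:
  assumes q: "even q" "6 \<le> q"
  shows "real (card (clean_cycs q)) \<le> (\<Sum>w\<in>hub_walks (q div 2). weight q w)"
proof -
  let ?W = "hub_walks (q div 2)"
  let ?f = "\<lambda>xs. (take (q - 1) xs, xs ! (q - 1))"
  have im: "?f ` clean_cycs q \<subseteq> ?W \<times> V"
  proof safe
    fix xs assume xs: "xs \<in> clean_cycs q"
    then have len: "length xs = q" "set xs \<subseteq> V" by (auto simp: clean_cycs_def alternating_def cycs_def)
    have "2 * (q div 2) - 1 = q - 1" using q by auto
    moreover have "take (2 * (q div 2) - 1) (drop 0 xs) \<in> ?W"
      using xs q by (intro hub_walk_segment[of _ q]) (auto simp: clean_cycs_def)
    ultimately show "take (q - 1) xs \<in> ?W" by simp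
    show "xs ! (q - 1) \<in> V" using len q by auto
  qed
  have inj: "inj_on ?f (clean_cycs q)"
  proof (rule inj_onI)
    fix xs ys assume *: "xs \<in> clean_cycs q" "ys \<in> clean_cycs q" "?f xs = ?f ys"
    have "zs = take (q - 1) zs @ [zs ! (q - 1)]" if "zs \<in> clean_cycs q" for zs
    proof -
      have "length zs = Suc (q - 1)" using that q by (auto simp: clean_cycs_def alternating_def cycs_def)
      then show ?thesis by (metis lessI take_Suc_conv_app_nth take_all_iff order.refl)
    qed
    then show "xs = ys" using * by (metis Pair_inject)
  qed
  have "card (clean_cycs q) \<le> card (?W \<times> V)"
    using finite_hub_walks fin by (intro card_inj_on_le[OF inj im]) auto
  then have "real (card (clean_cycs q)) \<le> real (card (?W \<times> V))" by (rule of_nat_mono)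
  then show ?thesis using q by (simp add: card_cartesian_product weight_def)
qed

text \<open>
  A clean odd cycle consists of a hub walk \<open>w\<close> and two further adjacent vertices \<open>c\<close> and \<open>d\<close>. If
  position \<open>q - 1\<close> is a hub, these are the entries at \<open>0\<close> and \<open>1\<close>, otherwise those at \<open>q - 2\<close> and
  \<open>q - 1\<close>. The two cases produce different triples, since \<open>d\<close> has lower rank than \<open>c\<close> in the first
  case and higher rank than \<open>c\<close> in the second.
\<close>

lemma card_clean_cycs_odd_le:
  assumes q: "odd q" "6 \<le> q"
  shows "real (card (clean_cycs q)) \<le> (\<Sum>w\<in>hub_walks (q div 2). weight q w)"
proof -
  let ?W = "hub_walks (q div 2)"
  let ?A = "\<lambda>w. hub_arcs w \<union> low_arcs (last w) (hd w)"
  let ?f = "\<lambda>xs. if xs ! (q - 1) \<in> high then (drop 2 xs, xs ! 0, xs ! 1)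
    else (take (q - 2) xs, xs ! (q - 2), xs ! (q - 1))"
  have q2: "2 * (q div 2) - 1 = q - 2" using q by (auto elim!: oddE)
  have q2': "2 \<le> q" "odd (q - 2)" "even (q - 1)" using q by auto
  have Sq: "Suc (q - 2) = q - 1" "Suc (q - 3) = q - 2" "Suc (q - 1) = q" using q by auto
  have im: "?f ` clean_cycs q \<subseteq> Sigma ?W ?A"
  proof
    fix t assume "t \<in> ?f ` clean_cycs q"
    then obtain xs where xs: "xs \<in> clean_cycs q" and t: "t = ?f xs" by auto
    have cyc: "xs \<in> cycs V E q"
      using xs by (auto simp: clean_cycs_def alternating_def)
    have len: "length xs = q" "set xs \<subseteq> V" "distinct xs" using cyc by (auto simp: cycs_def)
    have V: "xs ! j \<in> V" if "j < q" for j using that len by auto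
    have E: "E (xs ! j) (xs ! (Suc j mod q))" if "j < q" for j using cyc that by (simp add: cycs_def)
    have ends: "E (xs ! (q - 1)) (xs ! 0)" "E (xs ! 0) (xs ! 1)" "E (xs ! 1) (xs ! 2)"
      "E (xs ! (q - 3)) (xs ! (q - 2))" "E (xs ! (q - 2)) (xs ! (q - 1))"
      using E[of "q - 1"] E[of 0] E[of 1] E[of "q - 3"] E[of "q - 2"] q Sq
      by (auto simp: numeral_2_eq_2)
    have pop: "xs ! 1 \<in> popular" "xs ! (q - 2) \<in> popular"
      using xs q q2' by (auto simp: clean_cycs_def)
    have mid: "xs ! j \<in> high" if "even j" "j < q" "j \<noteq> 0" "j \<noteq> q - 1" for j
      using xs that by (auto simp: clean_cycs_def)
    show "t \<in> Sigma ?W ?A"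
    proof (cases "xs ! (q - 1) \<in> high")
      case True
      let ?w = "drop 2 xs"
      have "take (2 * (q div 2) - 1) (drop 2 xs) \<in> ?W"
      proof (rule hub_walk_segment[OF xs])
        fix j assume "even j" "2 \<le> j" "j < 2 + (2 * (q div 2) - 1)"
        then show "xs ! j \<in> high" using mid[of j] True q unfolding q2 by (cases "j = q - 1") auto
      qed (use q q2 in auto)
      then have W: "?w \<in> ?W" unfolding q2 using len by simp
      have hw: "hd ?w = xs ! 2" "last ?w = xs ! (q - 1)" "?w \<noteq> []"
        using len q Sq by (auto simp: hd_drop_conv_nth last_drop last_conv_nth)
      have "(xs ! 0, xs ! 1) \<in> ?A ?w"
      proof (cases "xs ! 0 \<in> high")
        case True
        have "xs ! 0 \<notin> set (drop 1 xs)" using len q by (cases xs) auto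
        moreover have "set (evs ?w) \<subseteq> set (drop 1 xs)"
          using set_evs_ods[of ?w] set_drop_subset_set_drop[of 1 2 xs] by auto
        ultimately show ?thesis using True W pop ends hw
          by (auto simp: hub_arcs_def hub_walks_def)
      next
        case False
        then show ?thesis using pop popular_subset V[of 0] q ends hw
          by (auto simp: low_arcs_def)
      qed
      then show ?thesis using W t True by simp
    next
      case False
      then have z: "xs ! 0 \<in> high" using xs by (simp add: clean_cycs_def)
      let ?w = "take (q - 2) xs"
      have "take (2 * (q div 2) - 1) (drop 0 xs) \<in> ?W"
      proof (rule hub_walk_segment[OF xs])
        fix j assume "even j" "0 \<le> j" "j < 0 + (2 * (q div 2) - 1)"
        then show "xs ! j \<in> high" using mid[of j] z unfolding q2 by (cases "j = 0") auto
      qed (use q in auto)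
      then have W: "?w \<in> ?W" unfolding q2 by simp
      have ne: "xs \<noteq> []" "?w \<noteq> []" and l: "length ?w - 1 = q - 3" "q - 3 < q - 2"
        using len q by auto
      have hw: "hd ?w = xs ! 0" "last ?w = xs ! (q - 3)" "?w \<noteq> []"
        using ne l by (simp_all add: hd_conv_nth last_conv_nth del: length_take)
      have "(xs ! (q - 2), xs ! (q - 1)) \<in> low_arcs (last ?w) (hd ?w)"
        using pop popular_subset V[of "q - 1"] q ends hw False by (auto simp: low_arcs_def)
      then show ?thesis using W t False by simp
    qed
  qed
  \<comment> \<open>A list is recovered from its image once the case is known, and the ranks of \<open>c\<close> and
    \<open>d\<close> tell the cases apart.\<close>
  have inj: "inj_on ?f (clean_cycs q)"
  proof (rule inj_onI)
    have len: "length xs = q" if "xs \<in> clean_cycs q" for xs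
      using that by (simp add: clean_cycs_def alternating_def cycs_def)
    have d1: "xs = xs ! 0 # xs ! 1 # drop 2 xs" if "xs \<in> clean_cycs q" for xs
    proof -
      have "6 \<le> length xs" using len[OF that] q by simp
      then obtain x y zs where "xs = x # y # zs" by (cases xs; cases "tl xs") auto
      then show ?thesis by simp
    qed
    have d2: "xs = take (q - 2) xs @ [xs ! (q - 2), xs ! (q - 1)]" if "xs \<in> clean_cycs q" for xs
    proof -
      have "drop (q - 2) xs = xs ! (q - 2) # xs ! (q - 1) # drop q xs"
        using len[OF that] q Cons_nth_drop_Suc[of "q - 2" xs] Cons_nth_drop_Suc[of "q - 1" xs] Sq
        by simp
      then show ?thesis using len[OF that] by (metis append_take_drop_id drop_all order.refl)
    qed
    have mixed: False if "xs \<in> clean_cycs q" "ys \<in> clean_cycs q" "xs ! 0 = ys ! (q - 2)" "xs ! 1 = ys ! (q - 1)" for xs ys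
    proof -
      have "xs ! (1 - 1) \<in> up (xs ! 1)"
        using that q by (intro alternating_up(2)[of _ q]) (auto simp: clean_cycs_def)
      then have "rk (xs ! 1) < rk (xs ! 0)" by (simp add: up_def)
      moreover have "ys ! (Suc (q - 2) mod q) \<in> up (ys ! (q - 2))"
        using that q q2' by (intro alternating_up(1)[of _ q]) (auto simp: clean_cycs_def)
      then have "rk (ys ! (q - 2)) < rk (ys ! (q - 1))" using Sq q by (simp add: up_def)
      ultimately show False using that by simp
    qed
    fix xs ys assume *: "xs \<in> clean_cycs q" "ys \<in> clean_cycs q" "?f xs = ?f ys"
    show "xs = ys"
    proof (cases "xs ! (q - 1) \<in> high"; cases "ys ! (q - 1) \<in> high")
      assume "xs ! (q - 1) \<in> high" "ys ! (q - 1) \<in> high"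
      then show ?thesis using * d1[OF *(1)] d1[OF *(2)] by simp
    next
      assume "xs ! (q - 1) \<notin> high" "ys ! (q - 1) \<notin> high"
      then show ?thesis using * d2[OF *(1)] d2[OF *(2)] by simp
    qed (use * mixed[OF *(1,2)] mixed[OF *(2,1)] in auto)
  qed
  have finA: "finite (?A w)" for w using finite_hub_arcs finite_low_arcs by simp
  have "card (clean_cycs q) \<le> card (Sigma ?W ?A)"
    using finite_hub_walks finA by (intro card_inj_on_le[OF inj im]) auto
  also have "\<dots> = (\<Sum>w\<in>?W. card (?A w))" using finite_hub_walks finA by simp
  finally have "real (card (clean_cycs q)) \<le> (\<Sum>w\<in>?W. real (card (?A w)))"
    unfolding of_nat_sum[symmetric] by (rule of_nat_mono)
  also have "\<dots> \<le> (\<Sum>w\<in>?W. weight q w)"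
  proof (rule sum_mono)
    fix w assume w: "w \<in> ?W"
    then have w': "hub_walk w" "distinct (evs w)" "length w = q - 2"
      using distinct_evs_ods q2 by (auto simp: hub_walks_def)
    have "length (evs w) = q div 2" using w'(3) q by (auto simp: length_evs_ods elim!: oddE)
    then have "real (card (hub_arcs w)) \<le> real ((a - q div 2) * card V)"
      using card_hub_arcs_le[OF w'(2)] by (metis of_nat_mono)
    moreover have "real (card (?A w)) \<le> real (card (hub_arcs w)) + real (card (low_arcs (last w) (hd w)))"
      using card_Un_le[of "hub_arcs w"] by (metis of_nat_add of_nat_mono)
    ultimately show "real (card (?A w)) \<le> weight q w"
      using card_low_arcs_le[OF w'(1,2)] q by (simp add: weight_def)
  qed
  finally show ?thesis .
qed

section \<open>Summing over all hub walks\<close>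

lemma hub_walk_evs_ods_adjacent: "hub_walk w \<Longrightarrow> i < length (ods w) \<Longrightarrow> E (evs w ! i) (ods w ! i)"
proof (induction w arbitrary: i rule: hub_walk.induct)
  case (3 z y w)
  then show ?case by (cases i) auto
qed auto

text \<open>
  The choices of popular vertices that reach the maximum: all have the same \<open>a\<close> hubs.
\<close>

definition uniform_lists :: "nat \<Rightarrow> 'a list set" where
  "uniform_lists k = {ys. length ys = k \<and> set ys \<subseteq> popular \<and>
     (\<exists>T. card T = a \<and> (\<forall>y\<in>set ys. hubs y = T))}"

lemma distinct_list_with_nth:
  assumes "finite U" "z \<in> U" "i < r" "r \<le> card U"
  shows "\<exists>zs. length zs = r \<and> distinct zs \<and> set zs \<subseteq> U \<and> zs ! i = z"
proof -
  have "r - 1 \<le> card (U - {z})" using assms by simp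
  then obtain X where X: "X \<subseteq> U - {z}" "card X = r - 1" "finite X"
    by (metis obtain_subset_with_card_n)
  then obtain xs where xs: "set xs = X" "distinct xs" using finite_distinct_list by blast
  have len: "length xs = r - 1" using X xs distinct_card by metis
  let ?zs = "take i xs @ z # drop i xs"
  have "distinct ?zs"
    using xs X by (auto simp: set_take_disj_set_drop_if_distinct dest: in_set_takeD in_set_dropD)
  moreover have "set ?zs \<subseteq> U"
    using xs X assms(2) by (auto dest: in_set_takeD in_set_dropD)
  moreover have "?zs ! i = z" "length ?zs = r" using len assms(3) by (auto simp: nth_append)
  ultimately show ?thesis by blast
qed

text \<open>
  The hubs of the walk form an injective list of spanned hubs. If some \<open>y\<close> misses a spanned hub,
  then this hub cannot occur next to \<open>y\<close>, so not all injective lists occur.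
\<close>

lemma card_hub_walks_over:
  assumes r: "2 \<le> r"
  shows "card {w \<in> hub_walks r. ods w = ys} \<le> falling (card (\<Union>y\<in>set ys. hubs y)) r"
    and "y \<in> set ys \<Longrightarrow> hubs y \<noteq> (\<Union>y\<in>set ys. hubs y) \<Longrightarrow> r \<le> card (\<Union>y\<in>set ys. hubs y) \<Longrightarrow>
      card {w \<in> hub_walks r. ods w = ys} < falling (card (\<Union>y\<in>set ys. hubs y)) r"
proof -
  let ?S = "{w \<in> hub_walks r. ods w = ys}"
  let ?U = "\<Union>y\<in>set ys. hubs y"
  let ?Z = "{zs. length zs = r \<and> distinct zs \<and> set zs \<subseteq> ?U}"
  have finU: "finite ?U" using finite_hubs by auto
  have finZ: "finite ?Z" by (rule finite_distinct_lists[OF finU])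
  have S: "length (evs w) = r" "length (ods w) = r - 1" "hub_walk w" "distinct (evs w)" "set (evs w) \<subseteq> ?U" if "w \<in> ?S" for w
  proof -
    have w: "hub_walk w" "length w = 2 * r - 1" "distinct w" using that by (auto simp: hub_walks_def)
    show "length (evs w) = r" "length (ods w) = r - 1" using w r by (auto simp: length_evs_ods)
    show "hub_walk w" "distinct (evs w)" using w distinct_evs_ods by auto
    show "set (evs w) \<subseteq> ?U"
    proof -
      have "spanned w = ?U" using evs_in_spanned_hubs[OF w(1)] w r that by auto
      then show ?thesis by (auto simp: spanned_def)
    qed
  qed
  have inj: "inj_on evs ?S"
  proof (rule inj_onI)
    fix w w' assume "w \<in> ?S" "w' \<in> ?S" "evs w = evs w'"
    moreover from this have "length w = length w'" "ods w = ods w'" by (simp_all add: hub_walks_def)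
    ultimately show "w = w'" by (blast intro: evs_ods_inject)
  qed
  have im: "evs ` ?S \<subseteq> ?Z"
  proof (rule image_subsetI)
    fix w assume "w \<in> ?S"
    from S[OF this] show "evs w \<in> ?Z" by simp
  qed
  have "card ?S = card (evs ` ?S)" using card_image[OF inj] by simp
  moreover have "card (evs ` ?S) \<le> card ?Z" by (rule card_mono[OF finZ im])
  ultimately show "card ?S \<le> falling (card ?U) r" using card_distinct_lists[OF finU] by simp
  assume y: "y \<in> set ys" "hubs y \<noteq> ?U" "r \<le> card ?U"
  show "card ?S < falling (card ?U) r"
  proof (cases "?S = {}")
    case True
    show ?thesis unfolding True using falling_pos[OF y(3)] by simp
  next
    case False
    then obtain w0 where w0: "w0 \<in> ?S" by auto
    have lys: "length ys = r - 1" using S(2)[OF w0] w0 by simp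
    obtain i where i: "i < length ys" "ys ! i = y" using y(1) by (auto simp: in_set_conv_nth)
    obtain z where z: "z \<in> ?U" "z \<notin> hubs y" using y by blast
    obtain zs where zs: "zs \<in> ?Z" "zs ! i = z"
    proof -
      have "i < r" using i lys by simp
      from distinct_list_with_nth[OF finU z(1) this y(3)] show ?thesis using that by blast
    qed
    have "zs \<notin> evs ` ?S"
    proof
      assume "zs \<in> evs ` ?S"
      then obtain w where w: "w \<in> ?S" "zs = evs w" by auto
      have "E z y" using hub_walk_evs_ods_adjacent[OF S(3)[OF w(1)], of i] w zs i by simp
      moreover have "z \<in> high" using z(1) hubs_subset by auto
      ultimately show False using z(2) sym by (simp add: hubs_def)
    qed
    then have "evs ` ?S \<subset> ?Z" using im zs by blast
    then have "card (evs ` ?S) < card ?Z" by (rule psubset_card_mono[OF finZ])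
    then show ?thesis using card_image[OF inj] card_distinct_lists[OF finU] by simp
  qed
qed

text \<open>
  Group the walks by their popular vertices \<open>ys\<close>, and let \<open>m\<close> be the number of hubs of these.
  Apart from the term with \<open>\<theta>\<close>, lists that are not uniform miss the maximal value by at least
  \<open>n\<close>: if \<open>m < a\<close>, there are fewer
  choices for the hubs even after counting the additional completions; if \<open>m = a\<close>, at least one
  injective list of hubs does not occur. So only uniform lists contribute the last \<open>n\<close>.
\<close>

lemma sum_weight_le:
  assumes q: "6 \<le> q" and a: "q - q div 2 \<le> a"
  defines "r \<equiv> q div 2" and "N \<equiv> falling a (q - q div 2)"
  shows "(\<Sum>w\<in>hub_walks r. weight q w) \<le>
    real (card V) ^ (r - 1) * ((real N - 1) * real (card V) + real N * (2 * (real a + 2) * \<theta>))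
    + real (card (uniform_lists (r - 1))) * real (card V)"
proof -
  define n where "n = real (card V)"
  define \<delta> where "\<delta> = 2 * (real a + 2) * \<theta>"
  define B where "B = (real N - 1) * n + real N * \<delta>"
  let ?f = "\<lambda>ys. if ys \<in> uniform_lists (r - 1) then n else 0"
  have n0: "0 \<le> n" and \<delta>0: "0 \<le> \<delta>" using \<theta>_pos by (auto simp: n_def \<delta>_def)
  have r: "3 \<le> r" "r \<le> a" using q a by (auto simp: r_def)
  have N: "N = falling a r * (if even q then 1 else a - r)"
  proof (cases "even q")
    case True
    then have "q - q div 2 = r" by (auto simp: r_def)
    then show ?thesis using True by (simp add: N_def)
  next
    case False
    then have "q - q div 2 = Suc r" unfolding r_def by (elim oddE) auto
    then show ?thesis using False by (simp add: N_def falling_Suc)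
  qed
  have ra: "r < a" if "odd q" using that a unfolding r_def by (elim oddE) auto
  have N1: "1 \<le> N" using N falling_pos[OF r(2)] ra by (auto simp: Suc_le_eq)
  have FN: "falling a r \<le> N" using N ra by (auto simp: Suc_le_eq)
  have B0: "0 \<le> B" unfolding B_def using N1 n0 \<delta>0 by simp
  have fibre: "(\<Sum>w\<in>{w \<in> hub_walks r. ods w = ys}. weight q w) \<le> B + ?f ys" for ys
  proof (cases "{w \<in> hub_walks r. ods w = ys} = {}")
    case True
    show ?thesis unfolding True using B0 n0 by simp
  next
    case False
    let ?S = "{w \<in> hub_walks r. ods w = ys}"
    let ?U = "\<Union>y\<in>set ys. hubs y"
    define m where "m = card ?U"
    have sp: "spanned w = ?U" if "w \<in> ?S" for w
      using that evs_in_spanned_hubs[of w] r by (auto simp: hub_walks_def)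
    obtain w0 where w0: "w0 \<in> ?S" using False by auto
    have ma: "m \<le> a"
      using card_spanned_le[of w0] sp[OF w0] w0 distinct_evs_ods
      by (auto simp: m_def hub_walks_def)
    define W where "W = (if even q then n else real (a - r) * n + 2 * real (a - m) * n + \<delta>)"
    have "(\<Sum>w\<in>?S. weight q w) = (\<Sum>w\<in>?S. W)"
      by (rule sum.cong) (use sp in \<open>auto simp: weight_def W_def m_def n_def \<delta>_def r_def\<close>)
    then have sumW: "(\<Sum>w\<in>?S. weight q w) = real (card ?S) * W" by simp
    have cS: "card ?S \<le> falling m r" using card_hub_walks_over(1)[of r ys] r by (simp add: m_def)
    have W0: "0 \<le> W" unfolding W_def using n0 \<delta>0 by auto
    define K where "K = (if even q then 1 else a - r) + (if even q then 0 else 2 * (a - m))"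
    have Wle: "W \<le> real K * n + \<delta>"
      using \<delta>0 ma by (auto simp: W_def K_def algebra_simps of_nat_diff)
    show ?thesis
    proof (cases "m < a")
      case True
      have lt: "falling m r * K < N"
        using falling_less[OF r(2) True] falling_trade_off[OF _ r(1) True] ra r N by (auto simp: K_def)
      have "real (card ?S) * W \<le> real (falling m r) * W"
        using cS W0 by (intro mult_right_mono) auto
      also have "\<dots> \<le> real (falling m r) *
        (real K * n + \<delta>)"
        using Wle by (intro mult_left_mono) auto
      also have "\<dots> = real (falling m r * K) * n
        + real (falling m r) * \<delta>" by (simp add: distrib_left)
      also have "\<dots> \<le> (real N - 1) * n + real N * \<delta>"
      proof (intro add_mono mult_right_mono n0 \<delta>0)
        show "real (falling m r * K)
          \<le> real N - 1" using lt by linarith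
        show "real (falling m r) \<le> real N" using falling_mono[OF ma, of r] FN by simp
      qed
      also have "\<dots> \<le> B + ?f ys" using n0 by (simp add: B_def)
      finally show ?thesis unfolding sumW .
    next
      case False
      then have m: "m = a" using ma by simp
      define \<kappa> where "\<kappa> = (if even q then 1 else a - r)"
      have \<kappa>1: "1 \<le> \<kappa>" using ra by (auto simp: \<kappa>_def Suc_le_eq)
      have W': "W \<le> real \<kappa> * n + \<delta>" using Wle m by (simp add: \<kappa>_def K_def split: if_splits)
      have Nk: "N = falling a r * \<kappa>" using N by (simp add: \<kappa>_def)
      show ?thesis
      proof (cases "ys \<in> uniform_lists (r - 1)")
        case True
        have "real (card ?S) * W \<le> real (falling a r) * (real \<kappa> * n + \<delta>)"
          using cS W0 W' m by (intro mult_mono) auto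
        also have "\<dots> = real N * n + real (falling a r) * \<delta>" by (simp add: Nk algebra_simps)
        also have "\<dots> \<le> real N * n + real N * \<delta>" using FN \<delta>0 by (intro add_left_mono mult_right_mono) auto
        also have "\<dots> = B + ?f ys" using True by (simp add: B_def algebra_simps)
        finally show ?thesis unfolding sumW .
      next
        case nu: False
        have "length ys = r - 1" "set ys \<subseteq> popular"
          using w0 r hub_walk_ods_popular[of w0] by (auto simp: hub_walks_def length_evs_ods)
        then have "\<exists>y\<in>set ys. hubs y \<noteq> ?U" using nu m unfolding uniform_lists_def m_def by blast
        then have "card ?S < falling a r"
          using card_hub_walks_over(2)[of r _ ys] r m unfolding m_def by auto
        then have "real (card ?S) \<le> real (falling a r) - 1" by linarith
        moreover have "1 \<le> real (falling a r)" using falling_pos[OF r(2)] by simp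
        ultimately have "real (card ?S) * W \<le> (real (falling a r) - 1) * (real \<kappa> * n + \<delta>)"
          using W0 W' by (intro mult_mono) auto
        also have "\<dots> = (real N - real \<kappa>) * n + (real (falling a r) - 1) * \<delta>"
          by (simp add: Nk algebra_simps)
        also have "\<dots> \<le> (real N - 1) * n + real N * \<delta>"
          using \<kappa>1 FN n0 \<delta>0 by (intro add_mono mult_right_mono) auto
        also have "\<dots> = B + ?f ys" using nu by (simp add: B_def)
        finally show ?thesis unfolding sumW .
      qed
    qed
  qed
  let ?Y = "{ys. length ys = r - 1 \<and> set ys \<subseteq> V}"
  have Ysub: "{ys. set ys \<subseteq> V \<and> length ys = r - 1} = ?Y" by auto
  have finY: "finite ?Y" using finite_lists_length_eq[OF fin, of "r - 1"] Ysub by simp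
  have cY: "real (card ?Y) = n ^ (r - 1)"
    using card_lists_length_eq[OF fin, of "r - 1"] Ysub by (simp add: n_def)
  have oY: "ods ` hub_walks r \<subseteq> ?Y"
    using r set_evs_ods by (fastforce simp: hub_walks_def length_evs_ods)
  have "(\<Sum>w\<in>hub_walks r. weight q w) = (\<Sum>ys\<in>ods ` hub_walks r. \<Sum>w\<in>{w \<in> hub_walks r. ods w = ys}. weight q w)"
    by (rule sum.image_gen[OF finite_hub_walks])
  also have "\<dots> \<le> (\<Sum>ys\<in>ods ` hub_walks r. B + ?f ys)" by (rule sum_mono) (rule fibre)
  also have "\<dots> \<le> (\<Sum>ys\<in>?Y. B + ?f ys)" using oY finY B0 n0 by (intro sum_mono2) auto
  also have "\<dots> = n ^ (r - 1) * B + (\<Sum>ys\<in>?Y. ?f ys)" using cY by (simp add: sum.distrib)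
  also have "(\<Sum>ys\<in>?Y. ?f ys) = (\<Sum>ys\<in>?Y \<inter> uniform_lists (r - 1). n)"
    by (rule sum.inter_restrict[OF finY, symmetric])
  also have "\<dots> \<le> real (card (uniform_lists (r - 1))) * n"
  proof -
    have "uniform_lists (r - 1) \<subseteq> ?Y" using popular_subset by (auto simp: uniform_lists_def)
    then have "?Y \<inter> uniform_lists (r - 1) = uniform_lists (r - 1)" by auto
    then show ?thesis by simp
  qed
  finally show ?thesis by (simp add: B_def \<delta>_def n_def)
qed

text \<open>
  The second entry of a uniform list must have the same hubs as the first.
\<close>

lemma card_uniform_lists_le:
  assumes k: "2 \<le> k" and M: "0 \<le> M"
    "\<And>u. u \<in> popular \<Longrightarrow> card (hubs u) = a \<Longrightarrow> real (card {x \<in> V - high. hubs x = hubs u}) \<le> M"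
  shows "real (card (uniform_lists k)) \<le> real (card V) ^ (k - 1) * M"
proof -
  let ?R = "\<lambda>i u. if i = 1 then (if u \<in> popular \<and> card (hubs u) = a then {x \<in> V - high. hubs x = hubs u} else {}) else V"
  let ?c = "\<lambda>i. if i = (1::nat) then M else real (card V)"
  have 1: "(i - 1 < k \<and> i - 1 < i) \<or> (\<forall>u v. ?R i u = ?R i v)" if "i < k" for i
    using that by auto
  have 2: "finite (?R i u)" "real (card (?R i u)) \<le> ?c i" for i u using fin M by auto
  note L = card_dependent_lists[where R = ?R and c = ?c and par = "\<lambda>i. i - 1" and \<mu> = id and q = k, OF _ 2]
  have "uniform_lists k \<subseteq> {xs. length xs = k \<and> (\<forall>i<k. xs ! i \<in> ?R i (xs ! (i - 1)))}"
  proof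
    fix ys assume ys: "ys \<in> uniform_lists k"
    then have len: "length ys = k" and pop: "\<And>i. i < k \<Longrightarrow> ys ! i \<in> popular"
      by (auto simp: uniform_lists_def)
    obtain T where T: "card T = a" "\<And>i. i < k \<Longrightarrow> hubs (ys ! i) = T"
      using ys by (auto simp: uniform_lists_def)
    then have T01: "hubs (ys ! 0) = T" "hubs (ys ! 1) = T" using k by auto
    have "ys ! i \<in> ?R i (ys ! (i - 1))" if i: "i < k" for i
    proof (cases "i = 1")
      case True
      then show ?thesis using T01 T(1) pop[of 0] pop[of 1] popular_subset k by auto
    qed (use pop[OF i] popular_subset in auto)
    then show "ys \<in> {xs. length xs = k \<and> (\<forall>i<k. xs ! i \<in> ?R i (xs ! (i - 1)))}" using len by blast
  qed
  then have "real (card (uniform_lists k)) \<le> real (card {xs. length xs = k \<and> (\<forall>i<k. xs ! i \<in> ?R i (xs ! (i - 1)))})"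
    using L(1) 1 by (intro of_nat_mono card_mono) auto
  also have "\<dots> \<le> (\<Prod>i<k. ?c i)" by (rule L(2)) (use 1 in auto)
  also have "\<dots> = ?c 1 * (\<Prod>i\<in>{..<k} - {1}. ?c i)" using k by (intro prod.remove) auto
  also have "(\<Prod>i\<in>{..<k} - {1}. ?c i) = (\<Prod>i\<in>{..<k} - {1}. real (card V))" by (intro prod.cong) auto
  also have "\<dots> = real (card V) ^ (k - 1)" using k by simp
  finally show ?thesis by (simp add: mult.commute)
qed

end

section \<open>Stability: many cycles force a common hub set\<close>

lemma falling_ge_power_minus:
  assumes "a + r \<le> n" "0 < n" "1 \<le> r"
  shows "real n ^ r - real r * real (a + r) * real n ^ (r - 1) \<le> real (falling (n - a) r)"
proof -
  have 1: "real ((n - a - r) ^ r) \<le> real (falling (n - a) r)"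
    using power_le_falling by (rule of_nat_mono)
  define t where "t = real (a + r) / real n"
  have t: "0 \<le> t" "t \<le> 1" using assms by (auto simp: t_def)
  have "1 - real r * t \<le> (1 - t) ^ r" using Bernoulli_inequality[of "-t" r] t by simp
  then have "real n ^ r * (1 - real r * t) \<le> real n ^ r * (1 - t) ^ r"
    by (rule mult_left_mono) simp
  also have "\<dots> = (real n * (1 - t)) ^ r" by (simp add: power_mult_distrib)
  also have "real n * (1 - t) = real (n - a - r)" using assms by (simp add: t_def field_simps of_nat_diff)
  finally have 2: "real n ^ r * (1 - real r * t) \<le> real ((n - a - r) ^ r)" by simp
  have "real n ^ r = real n * real n ^ (r - 1)" using assms by (cases r) auto
  then have "real n ^ r * (real r * t) = real r * real (a + r) * real n ^ (r - 1)"
    using assms by (simp add: t_def)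
  then have "real n ^ r * (1 - real r * t) = real n ^ r - real r * real (a + r) * real n ^ (r - 1)"
    by (simp add: right_diff_distrib)
  then show ?thesis using 1 2 by linarith
qed

text \<open>
  By the preceding bounds, a graph with as many cycles as the extremal graph has almost
  \<open>n^(r-1)\<close> uniform lists, and these need a class of almost \<open>n\<close> vertices with the same \<open>a\<close> hubs.
  The threshold \<open>\<epsilon>n\<close> is chosen such that all errors proportional to \<open>\<epsilon>\<close> add up to \<open>\<eta>n/2\<close>; the
  other errors are of lower order in \<open>n\<close>.
\<close>

lemma many_cycles_imp_hub_set:
  fixes p q a :: nat and \<eta> :: real
  assumes q: "6 \<le> q" and a: "q - q div 2 \<le> a" and p: "0 < p" "p \<le> 2 * a + 2" and \<eta>: "0 < \<eta>" "\<eta> < 1"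
  shows "\<exists>n0. \<forall>(V :: 'a set) E. path_free V E p \<longrightarrow> n0 \<le> card V \<longrightarrow>
    (if even q then 2 else q) * falling a (q - q div 2) * falling (card V - a) (q div 2) \<le> card (cycs V E q) \<longrightarrow>
    (\<exists>T\<subseteq>V. card T = a \<and> (1 - \<eta>) * real (card V) \<le> real (card {x \<in> V - T. \<forall>t\<in>T. E x t}))"
proof -
  define r where "r = q div 2"
  define N where "N = falling a (q - q div 2)"
  define D where "D = 8 * a + 20"
  \<comment> \<open>After division by \<open>n^(r-1)\<close> the errors proportional to \<open>\<epsilon>\<close> add up
    to \<open>c \<epsilon> n = \<eta> n / 2\<close>, and those of lower order add up to at most
    \<open>C\<close>.\<close>
  define c where "c = 2 * real N * (real a + 2) + (real q + 2) * real p ^ q"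
  define \<epsilon> where "\<epsilon> = \<eta> / (2 * c)"
  define k0 where "k0 = nat \<lceil>2 * real p / \<epsilon>\<rceil>"
  define U0 where "U0 = k0 + 2 ^ k0 * D"
  define C where "C = real N * (real r * real (a + r)) + 3 ^ q * real p ^ q + real q * real U0 * real p ^ q"
  define n0 where "n0 = nat \<lceil>2 * C / \<eta>\<rceil> + 1 + a + r"
  have r3: "3 \<le> r" using q by (simp add: r_def)
  have N1: "1 \<le> N" using falling_pos[OF a] by (simp add: N_def)
  have c0: "0 < c" using p by (simp add: c_def add_nonneg_pos)
  have \<epsilon>0: "0 < \<epsilon>" and c\<epsilon>: "c * \<epsilon> = \<eta> / 2" using \<eta> c0 by (auto simp: \<epsilon>_def)
  have C0: "0 \<le> C" by (simp add: C_def)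
  show ?thesis
  proof (intro exI[of _ n0] allI impI)
    fix V :: "'a set" and E
    assume pf: "path_free V E p" and n: "n0 \<le> card V"
      and many: "(if even q then 2 else q) * falling a (q - q div 2) * falling (card V - a) (q div 2)
        \<le> card (cycs V E q)"
    define nn where "nn = card V"
    define x where "x = real nn ^ (r - 1)"
    have nn: "0 < nn" "a + r \<le> nn" using n by (auto simp: nn_def n0_def)
    have "2 * C / \<eta> < real nn"
    proof -
      have "2 * C / \<eta> \<le> real (nat \<lceil>2 * C / \<eta>\<rceil>)" by linarith
      also have "\<dots> < real nn" using n unfolding nn_def n0_def by linarith
      finally show ?thesis .
    qed
    then have nC: "C < \<eta> / 2 * real nn" using \<eta> by (simp add: field_simps)
    have x0: "0 < x" using nn by (simp add: x_def)
    interpret path_free V E p by fact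
    obtain rk :: "'a \<Rightarrow> nat" where rk: "inj_on rk V" "\<forall>v\<in>V. card {w \<in> V. E v w \<and> rk v < rk w} \<le> p"
      using ex_ranking by blast
    interpret hub_bounded V E p rk "\<epsilon> * real nn" D a
      using rk p \<epsilon>0 nn q a by unfold_locales (auto simp: D_def)
    have Vne: "V \<noteq> {}" using nn by (auto simp: nn_def)
    show "\<exists>T\<subseteq>V. card T = a \<and> (1 - \<eta>) * real (card V) \<le> real (card {x \<in> V - T. \<forall>t\<in>T. E x t})"
    proof (rule ccontr)
      assume neg: "\<not> ?thesis"
      \<comment> \<open>If no hub set has as many common neighbours as claimed, all classes of vertices with the same
        \<open>a\<close> hubs have at most \<open>M\<close> members, which makes uniform lists rare.\<close>
      define M where "M = (1 - \<eta>) * real nn"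
      have M: "real (card {y \<in> V - high. hubs y = hubs u}) \<le> M" if "card (hubs u) = a" for u
      proof -
        have "{y \<in> V - high. hubs y = hubs u} \<subseteq> {x \<in> V - hubs u. \<forall>t\<in>hubs u. E x t}"
          using hubs_subset by (auto simp: hubs_def)
        then have "card {y \<in> V - high. hubs y = hubs u} \<le> card {x \<in> V - hubs u. \<forall>t\<in>hubs u. E x t}"
          using fin by (intro card_mono) auto
        moreover have "hubs u \<subseteq> V" using hubs_subset high_subset by blast
        then have "\<not> M \<le> real (card {x \<in> V - hubs u. \<forall>t\<in>hubs u. E x t})"
          using neg that unfolding M_def nn_def by blast
        ultimately show ?thesis by linarith
      qed
      have u: "real (card (uniform_lists (r - 1))) \<le> real nn ^ (r - 2) * M"
        using card_uniform_lists_le[of "r - 1" M] M r3 \<eta> unfolding nn_def M_def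
        by (simp add: numeral_2_eq_2)
      have "real nn ^ (r - 2) * real nn = x"
      proof -
        have "r - 1 = Suc (r - 2)" using r3 by simp
        then show ?thesis unfolding x_def by simp
      qed
      then have un: "real (card (uniform_lists (r - 1))) * real nn \<le> x * M"
        using mult_right_mono[OF u, of "real nn"] by (simp add: mult.commute mult.left_commute)
      have clean_le: "real (card (clean_cycs q)) \<le> x * ((real N - 1) * real nn + real N * (2 * (real a + 2) * (\<epsilon> * real nn))) + x * M"
      proof -
        have "real (card (clean_cycs q)) \<le> (\<Sum>w\<in>hub_walks (q div 2). weight q w)"
          using card_clean_cycs_even_le card_clean_cycs_odd_le q by (cases "even q") auto
        then show ?thesis using sum_weight_le[OF q a] un unfolding x_def N_def r_def nn_def by linarith
      qed
      have Ub: "real (card (V - popular)) \<le> real U0"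
      proof -
        have "\<epsilon> * real nn * real (card high) \<le> 2 * real p * real nn"
          using card_high_le by (simp add: nn_def)
        then have "real (card high) \<le> 2 * real p / \<epsilon>"
          using \<epsilon>0 nn by (simp add: field_simps)
        then have "card high \<le> k0" unfolding k0_def by linarith
        then have "card high + 2 ^ card high * D \<le> U0"
          unfolding U0_def by (intro add_mono mult_right_mono power_increasing) auto
        then show ?thesis using card_unpopular_le by linarith
      qed
      have alternating_le: "real (card (alternating q)) \<le> real (card (clean_cycs q))
          + real q * (x * real U0 * real p ^ q) + (real q + 2) * (x * (\<epsilon> * real nn) * real p ^ q)"
      proof -
        have "real q * (x * real (card (V - popular)) * real p ^ q) \<le> real q * (x * real U0 * real p ^ q)"
          using Ub x0 by (intro mult_left_mono mult_right_mono) auto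
        then show ?thesis using card_alternating_le[OF q] unfolding x_def r_def nn_def by linarith
      qed
      define \<rho> where "\<rho> = (if even q then 2 else real q)"
      have \<rho>1: "1 \<le> \<rho>" using q by (simp add: \<rho>_def)
      have "real ((if even q then 2 else q) * falling a (q - q div 2) * falling (card V - a) (q div 2))
        \<le> real (card (cycs V E q))" using many by (rule of_nat_mono)
      then have "\<rho> * (real N * real (falling (nn - a) r)) \<le> real (card (cycs V E q))"
        by (auto simp: \<rho>_def N_def nn_def r_def mult.assoc split: if_splits)
      also have "\<dots> \<le> 3 ^ q * (x * real p ^ q) + \<rho> * real (card (alternating q))"
        using card_cycs_le_alternating[of q] q Vne by (simp add: x_def r_def nn_def \<rho>_def)
      also have "\<dots> \<le> \<rho> * (3 ^ q * (x * real p ^ q)) + \<rho> * real (card (alternating q))"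
      proof -
        have "0 \<le> 3 ^ q * (x * real p ^ q)" using x0 by simp
        then show ?thesis using mult_right_mono[OF \<rho>1] by simp
      qed
      finally have "\<rho> * (real N * real (falling (nn - a) r))
        \<le> \<rho> * (3 ^ q * (x * real p ^ q) + real (card (alternating q)))" by (simp add: distrib_left)
      then have up: "real N * real (falling (nn - a) r) \<le> 3 ^ q * (x * real p ^ q) + real (card (alternating q))"
        using \<rho>1 by simp
      have "x * real nn - real r * real (a + r) * x \<le> real (falling (nn - a) r)"
      proof -
        have "real nn ^ r = x * real nn" using r3 by (cases r) (auto simp: x_def)
        then show ?thesis using falling_ge_power_minus[OF nn(2,1), of] r3 by (simp add: x_def)
      qed
      then have "real N * (x * real nn - real r * real (a + r) * x)
        \<le> real N * real (falling (nn - a) r)" by (rule mult_left_mono) simp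
      then have "real N * (x * real nn - real r * real (a + r) * x) \<le> 3 ^ q * (x * real p ^ q)
        + (x * ((real N - 1) * real nn + real N * (2 * (real a + 2) * (\<epsilon> * real nn))) + x * M)
        + real q * (x * real U0 * real p ^ q) + (real q + 2) * (x * (\<epsilon> * real nn) * real p ^ q)"
        using up alternating_le clean_le by linarith
      then have "x * real nn \<le> x * (C + c * \<epsilon> * real nn + M)"
        by (simp add: C_def c_def algebra_simps)
      then have "real nn \<le> C + \<eta> / 2 * real nn + M" using x0 c\<epsilon> by simp
      then show False using nC by (simp add: M_def algebra_simps)
    qed
  qed
qed

section \<open>Cycles in the join of a clique with an almost edgeless graph\<close>

text \<open>
  The edges of the extremal graph with clique \<open>T\<close>; the set \<open>e\<close> is empty or the additional edge.
\<close>

definition hub_rel :: "'a set \<Rightarrow> 'a set \<Rightarrow> 'a set \<Rightarrow> 'a \<Rightarrow> 'a \<Rightarrow> bool" where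
  "hub_rel V T e x y \<longleftrightarrow> x \<in> V \<and> y \<in> V \<and> x \<noteq> y \<and> (x \<in> T \<or> y \<in> T \<or> {x, y} = e)"

text \<open>
  For odd \<open>q\<close> both ends are taken from \<open>hs\<close>, so \<open>hs\<close> has \<open>q - q div 2\<close> entries.
\<close>

definition interleave :: "nat \<Rightarrow> 'a list \<Rightarrow> 'a list \<Rightarrow> 'a list" where
  "interleave q hs ls = map (\<lambda>i. if odd i then ls ! (i div 2) else hs ! (i div 2)) [0..<q]"

lemma interleave_nth: "i < q \<Longrightarrow> interleave q hs ls ! i = (if odd i then ls ! (i div 2) else hs ! (i div 2))"
  and length_interleave [simp]: "length (interleave q hs ls) = q"
  by (simp_all add: interleave_def)

lemma half_less: "odd i \<Longrightarrow> i < q \<Longrightarrow> i div 2 < q div 2" "even i \<Longrightarrow> i < q \<Longrightarrow> i div 2 < q - q div 2"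
  for i q :: nat
  by (auto elim!: oddE evenE)

lemma interleave_inject:
  assumes "length hs = q - q div 2" "length hs' = q - q div 2" "length ls = q div 2" "length ls' = q div 2"
    and eq: "interleave q hs ls = interleave q hs' ls'"
  shows "hs = hs' \<and> ls = ls'"
proof
  show "hs = hs'"
  proof (rule nth_equalityI)
    fix i assume "i < length hs"
    then have "2 * i < q" using assms(1) by linarith
    then show "hs ! i = hs' ! i" using arg_cong[OF eq, of "\<lambda>xs. xs ! (2 * i)"] by (simp add: interleave_nth)
  qed (use assms in simp)
  show "ls = ls'"
  proof (rule nth_equalityI)
    fix i assume "i < length ls"
    then have "Suc (2 * i) < q" using assms(3) by linarith
    then show "ls ! i = ls' ! i" using arg_cong[OF eq, of "\<lambda>xs. xs ! (Suc (2 * i))"] by (simp add: interleave_nth)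
  qed (use assms in simp)
qed

lemma interleave_in_cycs:
  assumes q: "2 \<le> q" and T: "T \<subseteq> V"
    and hs: "length hs = q - q div 2" "distinct hs" "set hs \<subseteq> T"
    and ls: "length ls = q div 2" "distinct ls" "set ls \<subseteq> V - T"
  shows "interleave q hs ls \<in> cycs V (hub_rel V T e) q"
    and "i < q \<Longrightarrow> interleave q hs ls ! i \<in> T \<longleftrightarrow> even i"
proof -
  let ?xs = "interleave q hs ls"
  have o: "?xs ! i \<in> V - T" if "i < q" "odd i" for i
  proof -
    have "ls ! (i div 2) \<in> set ls" using half_less(1)[OF that(2,1)] ls(1) by simp
    then show ?thesis using that ls(3) by (auto simp: interleave_nth)
  qed
  have v: "?xs ! i \<in> T" if "i < q" "even i" for i
  proof -
    have "hs ! (i div 2) \<in> set hs" using half_less(2)[OF that(2,1)] hs(1) by simp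
    then show ?thesis using that hs(3) by (auto simp: interleave_nth)
  qed
  show *: "?xs ! i \<in> T \<longleftrightarrow> even i" if "i < q" for i using o v that by blast
  have V: "?xs ! i \<in> V" if "i < q" for i using o v that T by blast
  have inj: "i = j" if ij: "i < q" "j < q" "?xs ! i = ?xs ! j" for i j
  proof -
    have par: "odd i \<longleftrightarrow> odd j" using *[OF ij(1)] *[OF ij(2)] ij(3) by simp
    have "i div 2 = j div 2"
    proof (cases "odd i")
      case True
      then show ?thesis using par ij half_less(1) ls nth_eq_iff_index_eq[OF ls(2)]
        by (simp add: interleave_nth)
    next
      case False
      then show ?thesis using par ij half_less(2) hs nth_eq_iff_index_eq[OF hs(2)]
        by (simp add: interleave_nth)
    qed
    then show "i = j" using par by (metis odd_two_times_div_two_succ even_two_times_div_two)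
  qed
  have dist: "distinct ?xs" unfolding distinct_conv_nth using inj by auto
  have "hub_rel V T e (?xs ! i) (?xs ! (Suc i mod q))" if i: "i < q" for i
  proof -
    have s: "Suc i mod q < q" "Suc i mod q \<noteq> i" using q i by (auto simp: mod_Suc)
    have "?xs ! i \<in> T \<or> ?xs ! (Suc i mod q) \<in> T"
      using *[OF i] *[OF s(1)] by (cases "Suc i = q") (use i in auto)
    then show ?thesis using V[OF i] V[OF s(1)] inj[OF i s(1)] s by (auto simp: hub_rel_def)
  qed
  then show "?xs \<in> cycs V (hub_rel V T e) q"
    using dist V by (auto simp: cycs_def set_conv_nth)
qed

text \<open>
  For odd \<open>q\<close> the positions \<open>q - 1\<close> and \<open>0\<close> are the only cyclically adjacent even ones, and they
  reveal the rotation.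
\<close>

lemma rotated_parity_unique:
  fixes j j' q :: nat
  assumes "j < (if even q then 2 else q)" "j' < (if even q then 2 else q)" "2 \<le> q"
    and par: "\<And>i. i < q \<Longrightarrow> even ((j + i) mod q) \<longleftrightarrow> even ((j' + i) mod q)"
  shows "j = j'"
proof (cases "even q")
  case True
  then have j: "j < 2" "j' < 2" "j < q" "j' < q" using assms(1,2,3) by auto
  then have "even j \<longleftrightarrow> even j'" using par[of 0] assms(3) by simp
  then show ?thesis using j(1,2) by (auto simp: less_2_cases_iff)
next
  case False
  then have jq: "j < q" "j' < q" using assms(1,2) by auto
  \<comment> \<open>The index that the second rotation sends to the last position.\<close>
  define i where "i = (q - 1 + q - j') mod q"
  define u where "u = (j + i) mod q"
  have i: "i < q" using assms(3) by (simp add: i_def)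
  have ji: "(j' + i) mod q = q - 1"
  proof -
    have "(j' + i) mod q = (j' + (q - 1 + q - j')) mod q" by (simp add: i_def mod_simps)
    also have "j' + (q - 1 + q - j') = (q - 1) + q" using jq by simp
    also have "((q - 1) + q) mod q = q - 1" unfolding mod_add_self2 using assms(3) by simp
    finally show ?thesis .
  qed
  have "even u" using par[OF i] ji False assms(3) by (simp add: u_def)
  have "(j + Suc i mod q) mod q = Suc u mod q" "(j' + Suc i mod q) mod q = Suc ((j' + i) mod q) mod q"
    by (simp_all add: u_def mod_simps)
  then have "even (Suc u mod q)" using par[of "Suc i mod q"] ji assms(3) by simp
  moreover have uq: "u < q" using assms(3) by (simp add: u_def)
  ultimately have "u = q - 1" using \<open>even u\<close> by (cases "Suc u = q") auto
  then have "(j + i) mod q = (j' + i) mod q" using ji by (simp add: u_def)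
  moreover have "x mod q = (if x < q then x else x - q)" if "x < 2 * q" for x
    using that by (auto simp: le_mod_geq)
  then have "(j + i) mod q = (if j + i < q then j + i else j + i - q)"
    "(j' + i) mod q = (if j' + i < q then j' + i else j' + i - q)" using jq i by auto
  ultimately show ?thesis using jq i by (auto split: if_splits)
qed

text \<open>
  Interleaving an injective list from \<open>T\<close> with one from the complement gives a cycle, and the
  positions of the members of \<open>T\<close> show by how much it has been rotated.
\<close>

lemma card_cycs_hub_rel_ge:
  assumes V: "finite V" "T \<subseteq> V" and q: "2 \<le> q"
  shows "(if even q then 2 else q) * falling (card T) (q - q div 2) * falling (card V - card T) (q div 2)
    \<le> card (cycs V (hub_rel V T e) q)"
proof -
  let ?\<rho> = "if even q then 2 else q"
  let ?H = "{hs. length hs = q - q div 2 \<and> distinct hs \<and> set hs \<subseteq> T}"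
  let ?L = "{ls. length ls = q div 2 \<and> distinct ls \<and> set ls \<subseteq> V - T}"
  let ?f = "\<lambda>(j, hs, ls). rotate j (interleave q hs ls)"
  have finT: "finite T" using V finite_subset by blast
  have im: "?f ` ({..<?\<rho>} \<times> ?H \<times> ?L) \<subseteq> cycs V (hub_rel V T e) q"
    using interleave_in_cycs(1)[OF q V(2)] by (auto intro!: cycs_rotate)
  have inj: "inj_on ?f ({..<?\<rho>} \<times> ?H \<times> ?L)"
  proof (rule inj_onI, clarsimp simp del: if_split)
    fix j hs ls j' hs' ls'
    assume j: "j < ?\<rho>" "j' < ?\<rho>"
      and hs: "length hs = q - q div 2" "distinct hs" "set hs \<subseteq> T"
      and ls: "length ls = q div 2" "distinct ls" "set ls \<subseteq> V - T"
      and hs': "length hs' = q - q div 2" "distinct hs'" "set hs' \<subseteq> T"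
      and ls': "length ls' = q div 2" "distinct ls'" "set ls' \<subseteq> V - T"
      and eq: "rotate j (interleave q hs ls) = rotate j' (interleave q hs' ls')"
    have "even ((j + i) mod q) \<longleftrightarrow> even ((j' + i) mod q)" if i: "i < q" for i
    proof -
      have m: "(k + i) mod q < q" for k using q by simp
      have "rotate j (interleave q hs ls) ! i \<in> T \<longleftrightarrow> even ((j + i) mod q)"
        using interleave_in_cycs(2)[OF q V(2) hs ls m] i by (simp add: nth_rotate)
      moreover have "rotate j' (interleave q hs' ls') ! i \<in> T \<longleftrightarrow> even ((j' + i) mod q)"
        using interleave_in_cycs(2)[OF q V(2) hs' ls' m] i by (simp add: nth_rotate)
      ultimately show ?thesis using eq by simp
    qed
    then have "j = j'" by (rule rotated_parity_unique[OF j q])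
    then show "j = j' \<and> hs = hs' \<and> ls = ls'"
      using eq inj_rotate[of j] interleave_inject[OF hs(1) hs'(1) ls(1) ls'(1)] by (auto dest: injD)
  qed
  have "card ({..<?\<rho>} \<times> ?H \<times> ?L) \<le> card (cycs V (hub_rel V T e) q)"
    by (rule card_inj_on_le[OF inj im finite_cycs[OF V(1)]])
  moreover have "card (V - T) = card V - card T" using V finT by (simp add: card_Diff_subset)
  ultimately show ?thesis
    using card_distinct_lists[OF finT, of "q - q div 2"] card_distinct_lists[of "V - T" "q div 2"] V(1)
    by (simp add: card_cartesian_product mult.assoc)
qed

text \<open>
  Fix the list of hubs and put a member of \<open>W\<close> at position \<open>1\<close>; the other odd positions are free.
\<close>

lemma card_cycs_hub_rel_meeting_ge:
  assumes V: "finite V" "T \<subseteq> V" and q: "2 \<le> q" "q - q div 2 \<le> card T" and W: "W \<subseteq> V - T"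
  shows "card W * falling (card V - card T - card W) (q div 2 - 1)
    \<le> card {xs \<in> cycs V (hub_rel V T e) q. set xs \<inter> W \<noteq> {}}"
proof -
  let ?L = "{ls. length ls = q div 2 - 1 \<and> distinct ls \<and> set ls \<subseteq> V - T - W}"
  have fin: "finite T" "finite W" using V W finite_subset by blast+
  obtain X where X: "X \<subseteq> T" "card X = q - q div 2" using q(2) by (metis obtain_subset_with_card_n)
  then obtain hs where "set hs = X" "distinct hs" using fin finite_subset finite_distinct_list by metis
  then have hs: "length hs = q - q div 2" "distinct hs" "set hs \<subseteq> T" using X by (auto simp: distinct_card[symmetric])
  let ?f = "\<lambda>(v, ls). interleave q hs (v # ls)"
  have ls: "length (v # ls) = q div 2" "distinct (v # ls)" "set (v # ls) \<subseteq> V - T" if "v \<in> W" "ls \<in> ?L" for v ls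
    using that W q by auto
  have im: "?f ` (W \<times> ?L) \<subseteq> {xs \<in> cycs V (hub_rel V T e) q. set xs \<inter> W \<noteq> {}}"
  proof safe
    fix v ls assume *: "v \<in> W" "length ls = q div 2 - 1" "distinct ls" "set ls \<subseteq> V - T - W"
    then show "interleave q hs (v # ls) \<in> cycs V (hub_rel V T e) q"
      using ls by (intro interleave_in_cycs(1)[OF q(1) V(2) hs]) auto
    have "interleave q hs (v # ls) ! 1 = v" using q by (simp add: interleave_nth)
    then have "v \<in> set (interleave q hs (v # ls))" using q nth_mem[of 1 "interleave q hs (v # ls)"] by simp
    then show False if "set (interleave q hs (v # ls)) \<inter> W = {}" using that * by blast
  qed
  have inj: "inj_on ?f (W \<times> ?L)"
  proof (rule inj_onI)
    fix x y assume xy: "x \<in> W \<times> ?L" "y \<in> W \<times> ?L" "?f x = ?f y"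
    obtain v l v' l' where [simp]: "x = (v, l)" "y = (v', l')" by (cases x, cases y) auto
    have "hs = hs \<and> v # l = v' # l'"
      using xy ls(1)[of v l] ls(1)[of v' l'] hs(1) by (intro interleave_inject[of hs q]) auto
    then show "x = y" by simp
  qed
  have "card (W \<times> ?L) \<le> card {xs \<in> cycs V (hub_rel V T e) q. set xs \<inter> W \<noteq> {}}"
    using finite_cycs[OF V(1)] by (intro card_inj_on_le[OF inj im]) auto
  moreover have "card (V - T - W) = card V - card T - card W"
    using V W fin by (simp add: card_Diff_subset)
  ultimately show ?thesis
    using card_distinct_lists[of "V - T - W" "q div 2 - 1"] V(1) by (simp add: card_cartesian_product)
qed

lemma card_cycs_bij:
  assumes f: "bij_betw f V V'" and E: "\<And>x y. x \<in> V \<Longrightarrow> y \<in> V \<Longrightarrow> E x y \<longleftrightarrow> E' (f x) (f y)"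
  shows "card (cycs V E q) = card (cycs V' E' q)"
proof (rule bij_betw_same_card)
  have inj: "inj_on f V" and im: "f ` V = V'" using f by (auto simp: bij_betw_def)
  show "bij_betw (map f) (cycs V E q) (cycs V' E' q)"
    unfolding bij_betw_def
  proof
    show "inj_on (map f) (cycs V E q)"
    proof (rule inj_onI)
      fix xs ys assume *: "xs \<in> cycs V E q" "ys \<in> cycs V E q" "map f xs = map f ys"
      then have "set xs \<union> set ys \<subseteq> V" by (simp add: cycs_def)
      then show "xs = ys" using map_inj_on[OF *(3)] inj inj_on_subset by blast
    qed
    show "map f ` cycs V E q = cycs V' E' q"
    proof safe
      fix xs assume xs: "xs \<in> cycs V E q"
      then have len: "length xs = q" "set xs \<subseteq> V" by (auto simp: cycs_def)
      have "E' (map f xs ! i) (map f xs ! (Suc i mod q))" if i: "i < q" for i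
      proof -
        have s: "Suc i mod q < q" using i by auto
        then have "xs ! i \<in> V" "xs ! (Suc i mod q) \<in> V" using len i nth_mem by blast+
        moreover have "E (xs ! i) (xs ! (Suc i mod q))" using xs i by (simp add: cycs_def)
        ultimately show ?thesis using E i s len by simp
      qed
      then show "map f xs \<in> cycs V' E' q"
        using xs im inj by (auto simp: cycs_def distinct_map intro: inj_on_subset)
    next
      fix ys assume ys: "ys \<in> cycs V' E' q"
      then have len: "length ys = q" "set ys \<subseteq> V'" by (auto simp: cycs_def)
      define xs where "xs = map (inv_into V f) ys"
      have inv: "inv_into V f y \<in> V \<and> f (inv_into V f y) = y" if "y \<in> set ys" for y
        using that len(2) im inv_into_into[of y f V] f_inv_into_f[of y f V] by blast
      have xV: "set xs \<subseteq> V" unfolding xs_def set_map using inv by blast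
      have fx: "map f xs = ys" unfolding xs_def map_map by (rule map_idI) (simp add: inv)
      have lx: "length xs = q" using len by (simp add: xs_def)
      have "E (xs ! i) (xs ! (Suc i mod q))" if i: "i < q" for i
      proof -
        have s: "Suc i mod q < q" using i by auto
        have "E' (map f xs ! i) (map f xs ! (Suc i mod q))" using ys i unfolding fx by (simp add: cycs_def)
        moreover have "xs ! i \<in> V" "xs ! (Suc i mod q) \<in> V" using lx xV i s nth_mem by blast+
        ultimately show ?thesis using E i s lx by simp
      qed
      moreover have "distinct xs" using ys unfolding fx[symmetric] by (simp add: cycs_def distinct_map)
      ultimately show "ys \<in> map f ` cycs V E q"
        using fx xV lx by (intro image_eqI[of _ _ xs]) (auto simp: cycs_def)
    qed
  qed
qed

lemma card_cycs_hub_rel_eq: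
  assumes fin: "finite V" "finite V'" and c: "card V = card V'" "T \<subseteq> V" "T' \<subseteq> V'" "card T = card T'"
    "e \<subseteq> V - T" "e' \<subseteq> V' - T'" "card e = card e'"
  shows "card (cycs V (hub_rel V T e) q) = card (cycs V' (hub_rel V' T' e') q)"
proof -
  have fins: "finite T" "finite T'" "finite e" "finite e'"
    using fin c finite_subset by (blast, blast, (meson Diff_subset finite_subset)+)
  obtain f g h where f: "bij_betw f T T'" and g: "bij_betw g e e'"
    and h: "bij_betw h (V - T - e) (V' - T' - e')"
  proof -
    have "card (V - T - e) = card (V' - T' - e')"
      using c fin fins by (simp add: card_Diff_subset)
    then show ?thesis using that finite_same_card_bij fins fin c
      by (metis finite_Diff)
  qed
  define k where "k = (\<lambda>x. if x \<in> T then f x else if x \<in> e then g x else h x)"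
  have kT: "bij_betw k T T'" using f by (rule bij_betw_cong[THEN iffD1, rotated]) (simp add: k_def)
  have ke: "bij_betw k e e'" using g c(5) by (subst bij_betw_cong[of _ _ g]) (auto simp: k_def)
  have kr: "bij_betw k (V - T - e) (V' - T' - e')"
    using h by (rule bij_betw_cong[THEN iffD1, rotated]) (simp add: k_def)
  have "bij_betw k (T \<union> e \<union> (V - T - e)) (T' \<union> e' \<union> (V' - T' - e'))"
    by (intro bij_betw_combine kT ke kr) (use c in auto)
  moreover have "T \<union> e \<union> (V - T - e) = V" "T' \<union> e' \<union> (V' - T' - e') = V'" using c by auto
  ultimately have k: "bij_betw k V V'" by simp
  have inj: "inj_on k V" using k by (simp add: bij_betw_def)
  have T: "k x \<in> T' \<longleftrightarrow> x \<in> T" if "x \<in> V" for x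
    using inj_on_image_mem_iff[OF inj that c(2)] kT by (simp add: bij_betw_def)
  have e: "{k x, k y} = e' \<longleftrightarrow> {x, y} = e" if "x \<in> V" "y \<in> V" for x y
  proof -
    have "e \<subseteq> V" using c by auto
    then have "k ` {x, y} = k ` e \<longleftrightarrow> {x, y} = e"
      using inj_on_image_eq_iff[OF inj, of "{x, y}" e] that by simp
    then show ?thesis using ke by (simp add: bij_betw_def)
  qed
  show ?thesis
  proof (rule card_cycs_bij[OF k])
    fix x y assume xy: "x \<in> V" "y \<in> V"
    have "k x \<in> V'" "k y \<in> V'" using k xy by (auto simp: bij_betw_def)
    moreover have "k x = k y \<longleftrightarrow> x = y" using inj xy by (auto dest: inj_onD)
    ultimately show "hub_rel V T e x y \<longleftrightarrow> hub_rel V' T' e' (k x) (k y)"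
      using xy T e by (auto simp: hub_rel_def)
  qed
qed

section \<open>Cycles in the presence of a complete hub set\<close>

text \<open>
  The conclusion of the stability argument, in a form with constants only.
\<close>

locale hub_set = path_free +
  fixes T :: "'a set" and a :: nat
  assumes T: "T \<subseteq> V" "card T = a" and a2: "2 \<le> a"
    and many: "2 * a + 10 \<le> card {x \<in> V - T. \<forall>t\<in>T. E x t}"
begin

lemma finite_T: "finite T"
  using T(1) fin finite_subset by blast

lemma common_leaf:
  assumes "finite F" "card F < 2 * a + 10"
  shows "\<exists>x\<in>V - T. x \<notin> F \<and> (\<forall>t\<in>T. E x t)"
proof -
  have "\<not> {x \<in> V - T. \<forall>t\<in>T. E x t} \<subseteq> F"
    using assms many by (meson card_mono leD le_trans)
  then show ?thesis by blast
qed

text \<open>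
  Any two members of \<open>T\<close> have many common neighbours, so \<open>T\<close> can be traversed in any order.
\<close>

lemma hub_path_between:
  assumes t: "t \<in> T" "t' \<in> T" "t \<noteq> t'" and F: "finite F" "card F \<le> 8" "F \<inter> T = {}"
  shows "\<exists>P. is_path V E P \<and> P \<noteq> [] \<and> hd P = t \<and> last P = t' \<and> length P = 2 * a - 1 \<and> set P \<inter> F = {}"
proof -
  obtain us where us: "set us = T - {t, t'}" "distinct us"
    using finite_distinct_list[of "T - {t, t'}"] finite_T by auto
  let ?hs = "t # us @ [t']"
  have hs: "distinct ?hs" "set ?hs = T" using us t by auto
  have len: "length ?hs = a" using distinct_card[OF hs(1)] hs(2) T(2) by simp
  define link where "link = (\<lambda>h h'. h \<in> T \<and> h' \<in> T)"
  have lk: "successively link ?hs"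
  proof -
    have "successively link xs" if "set xs \<subseteq> T" for xs
      using that by (induction xs rule: induct_list012) (auto simp: link_def)
    then show ?thesis using hs(2) by blast
  qed
  have "\<exists>P. is_path V E P \<and> hd P = hd ?hs \<and> last P = last ?hs \<and> length P = 2 * length ?hs - 1 \<and>
    set P \<inter> T = set ?hs \<and> (set P - T) \<inter> F = {}"
  proof (rule weave_path[where link = link and D = "2 * a + 10"])
    fix h h' and G :: "'a set"
    assume "link h h'" "finite G" "card G < 2 * a + 10"
    then show "\<exists>l\<in>V - T. l \<notin> G \<and> E h l \<and> E l h'"
      using common_leaf[of G] sym unfolding link_def by blast
  qed (use T lk hs len F in auto)
  then obtain P where P: "is_path V E P" "hd P = t" "last P = t'" "length P = 2 * a - 1" "(set P - T) \<inter> F = {}"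
    unfolding len by auto
  have "P \<noteq> []" using P(4) a2 by auto
  moreover have "set P \<inter> F = {}" using P(5) F(3) by blast
  ultimately show ?thesis using P by blast
qed

text \<open>
  A path outside \<open>T\<close> can be prolonged by a path through all of \<open>T\<close> and fresh common neighbours, and
  then by a second path outside \<open>T\<close>. The bound \<open>8\<close> only ensures that enough common neighbours
  are left.
\<close>

lemma two_tails_short:
  assumes Q: "is_path (V - T) E Q" "Q \<noteq> []" "E (last Q) t" "t \<in> T"
    and Q': "is_path (V - T) E Q'" "Q' \<noteq> []" "E (hd Q') t'" "t' \<in> T"
    and d: "t \<noteq> t'" "set Q \<inter> set Q' = {}" "length Q + length Q' \<le> 8"
  shows "length Q + length Q' + 2 * a - 1 \<le> p"
proof -
  have F: "finite (set Q \<union> set Q')" "card (set Q \<union> set Q') \<le> 8" "(set Q \<union> set Q') \<inter> T = {}"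
  proof -
    show "card (set Q \<union> set Q') \<le> 8"
      using card_Un_le[of "set Q" "set Q'"] card_length[of Q] card_length[of Q'] d(3) by linarith
  qed (use Q Q' in \<open>auto simp: is_path_def\<close>)
  obtain P where P: "is_path V E P" "P \<noteq> []" "hd P = t" "last P = t'" "length P = 2 * a - 1"
    "set P \<inter> (set Q \<union> set Q') = {}"
    using hub_path_between[OF Q(4) Q'(4) d(1) F] by blast
  have "is_path V E Q" "is_path V E Q'" using Q Q' by (auto simp: is_path_def)
  then have "is_path V E (Q @ P @ Q')"
    unfolding is_path_append using P Q(2,3) Q'(2,3) d sym by auto
  from path_le[OF this] show ?thesis using P(5) a2 by simp
qed

text \<open>
  Here the second path is a single common neighbour of \<open>T\<close>. Only the last seven vertices of
  \<open>Q\<close> are used, so that the previous bound applies to paths of any length.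
\<close>

lemma tail_short:
  assumes Q: "is_path (V - T) E Q" "Q \<noteq> []" "E (last Q) t" "t \<in> T"
  shows "length Q + 2 * a \<le> p \<or> p - 2 * a \<ge> 7"
proof -
  define R where "R = drop (length Q - 7) Q"
  have R: "is_path (V - T) E R" "R \<noteq> []" "last R = last Q" "length R = min 7 (length Q)"
  proof -
    show "is_path (V - T) E R"
      using Q(1) is_path_append[of "V - T" E "take (length Q - 7) Q" R] by (simp add: R_def)
    have "length Q - 7 < length Q" using Q(2) by simp
    then show "R \<noteq> []" "last R = last Q" "length R = min 7 (length Q)"
      unfolding R_def by (simp_all add: last_drop)
  qed
  have "T \<noteq> {t}" using T(2) a2 by auto
  then obtain t' where t': "t' \<in> T" "t' \<noteq> t" using Q(4) by blast
  have "card (set R) < 2 * a + 10" using card_length[of R] R(4) by simp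
  from common_leaf[OF _ this] obtain b where b: "b \<in> V - T" "b \<notin> set R" "\<forall>t\<in>T. E b t" by auto
  have "length R + length [b] + 2 * a - 1 \<le> p"
    by (rule two_tails_short[of R t "[b]" t']) (use R Q b t' in \<open>auto simp: is_path_def\<close>)
  then show ?thesis using R(4) by (auto simp: min_def split: if_splits)
qed

end

text \<open>
  The parity of \<open>p\<close> decides between a single vertex (\<open>p = 2 a + 1\<close>) and an edge (\<open>p = 2 a + 2\<close>)
  as the longest path outside \<open>T\<close> ending next to \<open>T\<close>.
\<close>

locale tight_hub_set = hub_set +
  assumes p_bounds: "2 * a + 1 \<le> p" "p \<le> 2 * a + 2"
begin

lemma tail_le:
  assumes "is_path (V - T) E Q" "Q \<noteq> []" "E (last Q) t" "t \<in> T"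
  shows "length Q \<le> p - 2 * a"
  using tail_short[OF assms] p_bounds by linarith

text \<open>
  Edges outside \<open>T\<close> that can occur on a cycle through \<open>T\<close>.
\<close>

definition rung :: "'a \<Rightarrow> 'a \<Rightarrow> bool" where
  "rung x y \<longleftrightarrow> x \<in> V - T \<and> y \<in> V - T \<and> E x y \<and> (\<exists>t\<in>T. \<exists>t'\<in>T. t \<noteq> t' \<and> E x t \<and> E y t')"

lemma rung_sym: "rung x y \<Longrightarrow> rung y x"
proof -
  assume "rung x y"
  then obtain t t' where *: "x \<in> V - T" "y \<in> V - T" "E x y" "t \<in> T" "t' \<in> T" "t' \<noteq> t" "E x t" "E y t'"
    unfolding rung_def by metis
  have "\<exists>t\<in>T. \<exists>t'\<in>T. t \<noteq> t' \<and> E y t \<and> E x t'"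
    using *(4-8) by (intro bexI[of _ t'] bexI[of _ t]) auto
  then show ?thesis using *(1,2) sym[OF *(3)] by (simp add: rung_def)
qed

lemma rung_path_length: "rung x y \<Longrightarrow> p = 2 * a + 2"
proof -
  assume "rung x y"
  then obtain t' where *: "x \<in> V - T" "y \<in> V - T" "E x y" "t' \<in> T" "E y t'" by (auto simp: rung_def)
  then have "length [x, y] \<le> p - 2 * a"
    using irr by (intro tail_le[of "[x, y]" t']) (auto simp: is_path_def)
  then show ?thesis using p_bounds by simp
qed

text \<open>
  Two disjoint rungs could be used as the two ends of a path through all of \<open>T\<close> on \<open>2 a + 3\<close> vertices.
  Two rungs sharing one vertex would form a path on three vertices outside \<open>T\<close> that ends next to
  \<open>T\<close>.
\<close>

lemma rung_unique:
  assumes "rung x y" "rung x' y'"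
  shows "{x, y} = {x', y'}"
proof -
  \<comment> \<open>A path on three vertices outside \<open>T\<close> that ends next to \<open>T\<close> is too long.\<close>
  have nocherry: False if "rung u z" "rung z w" "u \<noteq> w" for u z w
  proof -
    have "\<exists>t\<in>T. E u t" using that by (auto simp: rung_def)
    then obtain t where t: "t \<in> T" "E u t" by auto
    have "is_path (V - T) E [w, z, u]" using that irr sym by (auto simp: is_path_def rung_def)
    from tail_le[OF this _ _ t(1)] t show False using p_bounds by simp
  qed
  have nodisj: "x = x' \<or> x = y' \<or> y = x' \<or> y = y'"
  proof (rule ccontr)
    assume n: "\<not> ?thesis"
    have xy: "x \<in> V - T" "y \<in> V - T" "E x y" "x' \<in> V - T" "y' \<in> V - T" "E x' y'"
      using assms by (auto simp: rung_def)
    obtain t t' where t: "t \<in> T" "t' \<in> T" "t \<noteq> t'" "E x t" "E y t'" using assms by (auto simp: rung_def)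
    obtain t'' where t'': "t'' \<in> T" "E x' t''" using assms by (auto simp: rung_def)
    have "length [x, y] + length [x', y'] + 2 * a - 1 \<le> p"
    proof (cases "t'' = t'")
      case False
      show ?thesis
        by (rule two_tails_short[of "[x, y]" t' "[x', y']" t'']) (use xy t t'' n irr sym False in \<open>auto simp: is_path_def\<close>)
    next
      case True
      have "length [y, x] + length [x', y'] + 2 * a - 1 \<le> p"
        by (rule two_tails_short[of "[y, x]" t "[x', y']" t'']) (use xy t t'' n irr sym True in \<open>auto simp: is_path_def\<close>)
      then show ?thesis by simp
    qed
    then show False using p_bounds by simp
  qed
  note r = assms assms[THEN rung_sym]
  consider "x = x'" | "x = y'" | "y = x'" | "y = y'" using nodisj by blast
  then show ?thesis
  proof cases
    case 1
    then show ?thesis using nocherry[OF r(3), of y'] r(2) by auto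
  next
    case 2
    then show ?thesis using nocherry[OF r(3), of x'] r(4) by auto
  next
    case 3
    then show ?thesis using nocherry[OF r(1), of y'] r(2) by auto
  next
    case 4
    then show ?thesis using nocherry[OF r(1), of x'] r(4) by auto
  qed
qed

definition detached :: "'a set" where
  "detached = {v \<in> V - T. \<forall>t\<in>T. \<not> E v t}"

text \<open>
  The vertices before the first member of \<open>T\<close> form a path outside \<open>T\<close> that ends next to \<open>T\<close>.
\<close>

lemma initial_run_short:
  assumes ys: "ys \<in> cycs V E q" and ne: "set ys \<inter> T \<noteq> {}"
  shows "length (takeWhile (\<lambda>x. x \<notin> T) ys) \<le> p - 2 * a"
proof (cases "takeWhile (\<lambda>x. x \<notin> T) ys = []")
  case False
  let ?Q = "takeWhile (\<lambda>x. x \<notin> T) ys"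
  define k where "k = length ?Q"
  have len: "length ys = q" "distinct ys" "set ys \<subseteq> V" using ys by (auto simp: cycs_def)
  have Q: "?Q = take k ys" unfolding k_def by (rule takeWhile_eq_take)
  have "?Q \<noteq> ys" using ne by (auto simp: takeWhile_eq_all_conv)
  then have kq: "k < q"
    using length_takeWhile_le[of "\<lambda>x. x \<notin> T" ys] len Q by (metis k_def le_neq_implies_less take_all_iff order.refl)
  have hT: "ys ! k \<in> T" using nth_length_takeWhile[of "\<lambda>x. x \<notin> T" ys] kq len by (simp add: k_def)
  have k0: "0 < k" using False by (simp add: k_def)
  have adj: "E (ys ! j) (ys ! (Suc j mod q))" if "j < q" for j using ys that by (simp add: cycs_def)
  have "successively E ?Q"
    using cycs_successively[OF ys] successively_append_iff[of E "take k ys" "drop k ys"] unfolding Q by simp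
  then have "is_path (V - T) E ?Q"
    using len set_takeWhileD[of _ "\<lambda>x. x \<notin> T" ys] by (auto simp: is_path_def Q[symmetric])
  moreover have "E (last ?Q) (ys ! k)"
  proof -
    have "last ?Q = ys ! (k - 1)" using False k0 kq len unfolding Q by (simp add: last_conv_nth)
    moreover have "E (ys ! (k - 1)) (ys ! (Suc (k - 1) mod q))" using adj[of "k - 1"] kq k0 by simp
    ultimately show ?thesis using k0 kq by simp
  qed
  ultimately show ?thesis using tail_le False hT by blast
qed simp

lemma cycs_nth_rotate:
  "ys \<in> cycs V E q \<Longrightarrow> i < q \<Longrightarrow> rotate j ys ! i = ys ! ((j + i) mod q)"
  by (simp add: cycs_def nth_rotate)

text \<open>
  Apply the bound on initial runs to the rotated cycle.
\<close>

lemma run_short: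
  assumes ys: "ys \<in> cycs V E q" and ne: "set ys \<inter> T \<noteq> {}" and q: "3 \<le> q"
  shows "ys ! (i mod q) \<in> T \<or> ys ! ((i + 1) mod q) \<in> T \<or> (p = 2 * a + 2 \<and> ys ! ((i + 2) mod q) \<in> T)"
proof (rule ccontr)
  assume n: "\<not> ?thesis"
  let ?zs = "rotate i ys"
  have z: "?zs \<in> cycs V E q" by (rule cycs_rotate[OF ys])
  have nth: "?zs ! 0 = ys ! (i mod q)" "?zs ! 1 = ys ! ((i + 1) mod q)" "?zs ! 2 = ys ! ((i + 2) mod q)"
    using cycs_nth_rotate[OF ys, of _ i] q by auto
  have lz: "length ?zs = q" using z by (simp add: cycs_def)
  then obtain u v w zs where e: "?zs = u # v # w # zs"
    using q by (cases ?zs; cases "tl ?zs"; cases "tl (tl ?zs)") auto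
  have "u \<notin> T" "v \<notin> T" "p = 2 * a + 2 \<longrightarrow> w \<notin> T" using n nth e by (auto simp: numeral_2_eq_2)
  then have "p - 2 * a < length (takeWhile (\<lambda>x. x \<notin> T) ?zs)"
    using p_bounds unfolding e by auto
  then show False using initial_run_short[OF z] ne by simp
qed

text \<open>
  A cycle that avoids \<open>T\<close> is a long path ending at any of its vertices, so none of these is
  adjacent to \<open>T\<close>. On a cycle that meets \<open>T\<close>, at most two consecutive vertices lie outside \<open>T\<close>;
  each of these has a neighbour in \<open>T\<close>, and two consecutive ones form a rung.
\<close>

lemma cycs_structure:
  assumes q: "6 \<le> q"
  shows "\<exists>e. (p = 2 * a + 1 \<longrightarrow> e = {}) \<and> (p = 2 * a + 2 \<longrightarrow> e \<subseteq> V - T \<and> card e = 2) \<and>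
    cycs V E q \<subseteq> {xs \<in> cycs V (hub_rel V T e) q. set xs \<inter> detached = {}} \<union> cycs detached E q"
proof -
  obtain e where e: "p = 2 * a + 1 \<Longrightarrow> e = {}" "p = 2 * a + 2 \<Longrightarrow> e \<subseteq> V - T \<and> card e = 2"
    and er: "\<And>x y. rung x y \<Longrightarrow> {x, y} = e"
  proof (cases "\<exists>x y. rung x y")
    case True
    then obtain x y where xy: "rung x y" by blast
    then have "x \<in> V - T" "y \<in> V - T" "x \<noteq> y" using irr by (auto simp: rung_def)
    then show ?thesis using that[of "{x, y}"] rung_unique[OF _ xy] rung_path_length[OF xy] by auto
  next
    case False
    have "2 \<le> card (V - T)"
    proof -
      have "{x \<in> V - T. \<forall>t\<in>T. E x t} \<subseteq> V - T" by blast
      from card_mono[OF finite_Diff[OF fin] this] show ?thesis using many by linarith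
    qed
    then obtain e where "e \<subseteq> V - T" "card e = 2" by (metis obtain_subset_with_card_n)
    then show ?thesis using that[of "if p = 2 * a + 1 then {} else e"] False by auto
  qed
  have sub: "cycs V E q \<subseteq> {xs \<in> cycs V (hub_rel V T e) q. set xs \<inter> detached = {}} \<union> cycs detached E q"
    (is "_ \<subseteq> ?rhs")
  proof
    fix ys assume ys: "ys \<in> cycs V E q"
    have len: "length ys = q" "distinct ys" "set ys \<subseteq> V" using ys by (auto simp: cycs_def)
    have E: "E (ys ! i) (ys ! (Suc i mod q))" if "i < q" for i using ys that by (simp add: cycs_def)
    have V: "ys ! i \<in> V" if "i < q" for i using that len by auto
    show "ys \<in> ?rhs"
    proof (cases "set ys \<inter> T = {}")
      case True
      have "v \<in> detached" if v: "v \<in> set ys" for v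
      proof (rule ccontr)
        assume "v \<notin> detached"
        then obtain t where t: "t \<in> T" "E v t" using v True len by (auto simp: detached_def)
        obtain i where i: "i < q" "ys ! i = v" using v len by (auto simp: in_set_conv_nth)
        let ?zs = "rotate (Suc i) ys"
        have z: "?zs \<in> cycs V E q" by (rule cycs_rotate[OF ys])
        have zl: "length ?zs = q" "?zs \<noteq> []" using len q by auto
        have "?zs ! (q - 1) = ys ! ((Suc i + (q - 1)) mod q)"
          by (rule cycs_nth_rotate[OF ys]) (use q in simp)
        also have "Suc i + (q - 1) = i + q" using q by simp
        finally have "last ?zs = v" using zl i by (simp add: last_conv_nth)
        moreover have "successively E ?zs" by (rule cycs_successively[OF z])
        then have "is_path (V - T) E ?zs" using len True by (auto simp: is_path_def)
        ultimately have "length ?zs \<le> p - 2 * a" using tail_le t zl by blast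
        then show False using zl p_bounds q by simp
      qed
      then show ?thesis using ys by (auto simp: cycs_def)
    next
      case False
      note run = run_short[OF ys False]
      \<comment> \<open>If the successor lies outside \<open>T\<close>, then the predecessor lies in \<open>T\<close>, as
        runs outside \<open>T\<close> have at most two vertices.\<close>
      have pred: "\<exists>t\<in>T. E (ys ! i) t" if i: "i < q" "ys ! i \<notin> T" for i
      proof (cases "ys ! (Suc i mod q) \<in> T")
        case True
        then show ?thesis using E[OF i(1)] by blast
      next
        case False
        let ?j = "(i + q - 1) mod q"
        have j: "?j < q" using q by simp
        have s: "Suc ?j mod q = i" using i q by (simp add: mod_Suc_eq)
        have "(?j + 1) mod q = i" "(?j + 2) mod q = Suc i mod q"
          using s by (auto simp: mod_simps) (metis mod_Suc_eq s)
        then have "ys ! ?j \<in> T" using run[of ?j] i False q by auto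
        moreover have "E (ys ! ?j) (ys ! i)" using E[OF j] s by simp
        ultimately show ?thesis using sym by blast
      qed
      have "set ys \<inter> detached = {}"
      proof (rule ccontr)
        assume "set ys \<inter> detached \<noteq> {}"
        then obtain i where "i < q" "ys ! i \<in> detached" using len by (auto simp: in_set_conv_nth)
        then show False using pred[of i] by (auto simp: detached_def)
      qed
      moreover have "hub_rel V T e (ys ! i) (ys ! (Suc i mod q))" if i: "i < q" for i
      proof -
        have s: "Suc i mod q < q" using q by simp
        have ne: "ys ! i \<noteq> ys ! (Suc i mod q)" using E[OF i] irr by metis
        have "{ys ! i, ys ! (Suc i mod q)} = e" if nT: "ys ! i \<notin> T" "ys ! (Suc i mod q) \<notin> T"
        proof -
          let ?j = "(i + q - 1) mod q" and ?k = "(i + 2) mod q"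
          have j: "?j < q" "?k < q" using q by auto
          have sj: "Suc ?j mod q = i" using i q by (simp add: mod_Suc_eq)
          have sk: "Suc (Suc i mod q) mod q = ?k" by (simp add: mod_Suc_eq)
          have "ys ! ?k \<in> T" using run[of i] nT i q by simp
          have "(?j + 1) mod q = i" "(?j + 2) mod q = Suc i mod q"
            using sj by (auto simp: mod_simps) (metis mod_Suc_eq sj)
          then have jT: "ys ! ?j \<in> T" using run[of ?j] nT q by auto
          have Ej: "E (ys ! i) (ys ! ?j)" using E[OF j(1)] sj sym by simp
          have Ek: "E (ys ! (Suc i mod q)) (ys ! ?k)" using E[OF s] sk by simp
          have "?k = (if i + 2 < q then i + 2 else i + 2 - q)" using i q by (auto simp: le_mod_geq)
          moreover have "?j = (if i = 0 then q - 1 else i - 1)" using i q by (auto simp: le_mod_geq)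
          ultimately have "?j \<noteq> ?k" using i q by (auto split: if_splits)
          then have "ys ! ?j \<noteq> ys ! ?k" using j len nth_eq_iff_index_eq[OF len(2)] by simp
          then have "rung (ys ! i) (ys ! (Suc i mod q))"
            using jT \<open>ys ! ?k \<in> T\<close> Ej Ek E[OF i] V[OF i] V[OF s] nT by (auto simp: rung_def)
          then show ?thesis by (rule er)
        qed
        then show ?thesis using V[OF i] V[OF s] ne by (auto simp: hub_rel_def)
      qed
      ultimately show ?thesis using len by (auto simp: cycs_def)
    qed
  qed
  show ?thesis by (intro exI[of _ e] conjI impI sub) (use e in auto)
qed

end

section \<open>Comparison with the extremal graph\<close>

lemma (in path_free) path_free_restrict:
  assumes "W \<subseteq> V"
  shows "path_free W (\<lambda>x y. E x y \<and> x \<in> W \<and> y \<in> W) p"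
proof
  show "finite W" using assms fin finite_subset by blast
  show "length xs \<le> p" if "is_path W (\<lambda>x y. E x y \<and> x \<in> W \<and> y \<in> W) xs" for xs
    by (rule path_le[OF is_path_mono[OF that assms]]) simp
qed (auto simp: irr intro: sym)

text \<open>
  The case of no vertices is separate because the bound by local minima needs a vertex.
\<close>

lemma (in path_free) card_cycs_le_power:
  assumes "W \<subseteq> V" "0 < p" "2 \<le> q"
  shows "real (card (cycs W E q)) \<le> 3 ^ q * real p ^ q * real (card W) ^ (q div 2)"
proof (cases "W = {}")
  case True
  then have "cycs W E q = {}" using assms(3) by (auto simp: cycs_def)
  then show ?thesis by simp
next
  case False
  let ?E = "\<lambda>x y. E x y \<and> x \<in> W \<and> y \<in> W"
  have eq: "cycs W E q = cycs W ?E q"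
  proof -
    have "xs ! i \<in> W" "xs ! (Suc i mod q) \<in> W" if "set xs \<subseteq> W" "length xs = q" "i < q" for xs and i
    proof -
      have "Suc i mod q < q" using that by auto
      then show "xs ! i \<in> W" "xs ! (Suc i mod q) \<in> W" using that nth_mem by blast+
    qed
    then show ?thesis unfolding cycs_def by blast
  qed
  interpret W: path_free W ?E p by (rule path_free_restrict[OF assms(1)])
  obtain rk :: "'a \<Rightarrow> nat" where rk: "inj_on rk W" "\<forall>v\<in>W. card {w \<in> W. ?E v w \<and> rk v < rk w} \<le> p"
    using W.ex_ranking by blast
  interpret W: ranked_path_free W ?E p rk
    using rk assms(2) by unfold_locales auto
  show ?thesis using W.card_cycs_le[OF assms(3) False] unfolding eq by (simp add: mult_ac)
qed

text \<open>
  The constant \<open>\<eta>\<close> is so small that the at most \<open>C m^r\<close> cycles on the \<open>m \<le> \<eta>n\<close> detached vertices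
  are outnumbered by the at least \<open>m (n/2)^(r-1)\<close> cycles of the extremal graph that use these
  vertices.
\<close>

lemma card_cycs_le_hub_rel:
  fixes p q a :: nat
  assumes q: "6 \<le> q" and a: "q - q div 2 \<le> a" and p: "2 * a + 1 \<le> p" "p \<le> 2 * a + 2"
  shows "\<exists>n0. \<forall>(V :: 'a set) E (V' :: 'b set) T' e'. path_free V E p \<longrightarrow> n0 \<le> card V \<longrightarrow>
    finite V' \<longrightarrow> card V' = card V \<longrightarrow> T' \<subseteq> V' \<longrightarrow> card T' = a \<longrightarrow>
    (p = 2 * a + 1 \<longrightarrow> e' = {}) \<longrightarrow> (p = 2 * a + 2 \<longrightarrow> e' \<subseteq> V' - T' \<and> card e' = 2) \<longrightarrow>
    card (cycs V E q) \<le> card (cycs V' (hub_rel V' T' e') q)"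
proof -
  define r where "r = q div 2"
  define C where "C = 3 ^ q * real p ^ q"
  define \<eta> where "\<eta> = 1 / (4 * (C + 1))"
  have C0: "0 \<le> C" by (simp add: C_def)
  have \<eta>: "0 < \<eta>" "\<eta> \<le> 1 / 4" "C * (2 * \<eta>) \<le> 1" using C0 by (auto simp: \<eta>_def field_simps)
  have r3: "3 \<le> r" using q by (simp add: r_def)
  have a3: "3 \<le> a" using a q by linarith
  have p0: "0 < p" using p by simp
  obtain n1 where n1: "\<And>(V :: 'a set) E. path_free V E p \<Longrightarrow> n1 \<le> card V \<Longrightarrow>
    (if even q then 2 else q) * falling a (q - q div 2) * falling (card V - a) (q div 2) \<le> card (cycs V E q) \<Longrightarrow>
    \<exists>T\<subseteq>V. card T = a \<and> (1 - \<eta>) * real (card V) \<le> real (card {x \<in> V - T. \<forall>t\<in>T. E x t})"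
    using many_cycles_imp_hub_set[OF q a p0 p(2), of \<eta>] \<eta> by fastforce
  define n0 where "n0 = n1 + 4 * (a + r) + 4 * a + 20"
  show ?thesis
  proof (intro exI[of _ n0] allI impI)
    fix V :: "'a set" and E and V' :: "'b set" and T' e'
    assume pf: "path_free V E p" and n: "n0 \<le> card V" and V': "finite V'" "card V' = card V"
      "T' \<subseteq> V'" "card T' = a" and e': "p = 2 * a + 1 \<longrightarrow> e' = {}"
      "p = 2 * a + 2 \<longrightarrow> e' \<subseteq> V' - T' \<and> card e' = 2"
    interpret path_free V E p by (rule pf)
    let ?h = "card (cycs V' (hub_rel V' T' e') q)"
    show "card (cycs V E q) \<le> ?h"
    proof (rule ccontr)
      assume more: "\<not> ?thesis"
      have q2: "2 \<le> q" using q by simp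
      have "(if even q then 2 else q) * falling a (q - q div 2) * falling (card V - a) (q div 2) \<le> ?h"
        using card_cycs_hub_rel_ge[OF V'(1,3) q2, of e'] V' by simp
      then have "(if even q then 2 else q) * falling a (q - q div 2) * falling (card V - a) (q div 2) \<le> card (cycs V E q)"
        using more by linarith
      from n1[OF pf _ this] n obtain T where T: "T \<subseteq> V" "card T = a"
        and T_nbrs: "(1 - \<eta>) * real (card V) \<le> real (card {x \<in> V - T. \<forall>t\<in>T. E x t})" by (auto simp: n0_def)
      let ?B = "{x \<in> V - T. \<forall>t\<in>T. E x t}"
      have "3 / 4 * real (card V) \<le> (1 - \<eta>) * real (card V)" using \<eta> by (intro mult_right_mono) auto
      then have "3 / 4 * real (card V) \<le> real (card ?B)" using T_nbrs by linarith
      then have B: "2 * a + 10 \<le> card ?B" using n by (simp add: n0_def)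
      interpret tight_hub_set V E p T a
        using T a3 B p by unfold_locales auto
      obtain e where e: "p = 2 * a + 1 \<longrightarrow> e = {}" "p = 2 * a + 2 \<longrightarrow> e \<subseteq> V - T \<and> card e = 2"
        and sub: "cycs V E q \<subseteq> {xs \<in> cycs V (hub_rel V T e) q. set xs \<inter> detached = {}} \<union> cycs detached E q"
        using cycs_structure[OF q] by blast
      let ?H = "cycs V (hub_rel V T e) q"
      define m where "m = card detached"
      have dV: "detached \<subseteq> V - T" by (auto simp: detached_def)
      have fd: "finite detached" using dV fin finite_subset by blast
      have hub_eq: "card ?H = ?h"
      proof (rule card_cycs_hub_rel_eq)
        have "p = 2 * a + 1 \<or> p = 2 * a + 2" using p by linarith
        then show "e \<subseteq> V - T" "e' \<subseteq> V' - T'" "card e = card e'" using e e' by auto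
      qed (use fin V' T in auto)
      have m: "real m \<le> \<eta> * real (card V)"
      proof -
        have "T \<noteq> {}" using T(2) a3 by auto
        then have "detached \<inter> ?B = {}" by (auto simp: detached_def)
        then have "m + card ?B = card (detached \<union> ?B)"
          using fd fin by (simp add: m_def card_Un_disjoint)
        also have "\<dots> \<le> card V" using dV fin by (intro card_mono) auto
        finally have "real m + real (card ?B) \<le> real (card V)" by linarith
        then show ?thesis using T_nbrs by (simp add: algebra_simps)
      qed
      have "real (card (cycs detached E q)) \<le> C * real m ^ r"
        using card_cycs_le_power[of detached q] dV p0 q by (auto simp: C_def m_def r_def)
      also have "\<dots> \<le> real m * (real (card V) / 2) ^ (r - 1)"
      proof -
        have "real m ^ r = real m * real m ^ (r - 1)" using r3 by (cases r) auto
        moreover have "C * real m ^ (r - 1) \<le> (real (card V) / 2) ^ (r - 1)"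
        proof -
          have "C * real m ^ (r - 1) \<le> C * (\<eta> * real (card V)) ^ (r - 1)"
            using m C0 by (intro mult_left_mono power_mono) auto
          also have "\<eta> * real (card V) = (2 * \<eta>) * (real (card V) / 2)" by simp
          also have "C * ((2 * \<eta>) * (real (card V) / 2)) ^ (r - 1)
            = (C * (2 * \<eta>) ^ (r - 1)) * (real (card V) / 2) ^ (r - 1)"
            by (simp only: power_mult_distrib mult.assoc)
          also have "\<dots> \<le> 1 * (real (card V) / 2) ^ (r - 1)"
          proof (rule mult_right_mono)
            have "(2 * \<eta>) ^ (r - 1) \<le> (2 * \<eta>) ^ 1"
              using \<eta> r3 by (intro power_decreasing) auto
            then have "C * (2 * \<eta>) ^ (r - 1) \<le> C * (2 * \<eta>)" using C0 by (intro mult_left_mono) auto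
            then show "C * (2 * \<eta>) ^ (r - 1) \<le> 1" using \<eta>(3) by linarith
          qed simp
          finally show ?thesis by simp
        qed
        then have "real m * (C * real m ^ (r - 1)) \<le> real m * (real (card V) / 2) ^ (r - 1)"
          by (rule mult_left_mono) simp
        ultimately show ?thesis by (simp add: mult.left_commute)
      qed
      also have "\<dots> \<le> real m * real (falling (card V - a - m) (r - 1))"
      proof (rule mult_left_mono)
        have "real m \<le> 1 / 4 * real (card V)"
          using m mult_right_mono[OF \<eta>(2), of "real (card V)"] by linarith
        then have "real (card V) / 2 \<le> real (card V - a - m - (r - 1))"
          using n by (simp add: n0_def)
        then have "(real (card V) / 2) ^ (r - 1) \<le> real ((card V - a - m - (r - 1)) ^ (r - 1))"
          unfolding of_nat_power by (intro power_mono) auto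
        also have "\<dots> \<le> real (falling (card V - a - m) (r - 1))"
          using power_le_falling by (rule of_nat_mono)
        finally show "(real (card V) / 2) ^ (r - 1) \<le> real (falling (card V - a - m) (r - 1))" .
      qed simp
      finally have "real (card (cycs detached E q)) \<le> real (m * falling (card V - a - m) (r - 1))" by simp
      then have "card (cycs detached E q) \<le> m * falling (card V - a - m) (r - 1)" by (simp only: of_nat_le_iff)
      also have "\<dots> \<le> card {xs \<in> ?H. set xs \<inter> detached \<noteq> {}}"
        using card_cycs_hub_rel_meeting_ge[OF fin T(1) q2 _ dV, of e] a T(2) by (simp add: m_def r_def)
      finally have small: "card (cycs detached E q) \<le> card {xs \<in> ?H. set xs \<inter> detached \<noteq> {}}" .
      have "card (cycs V E q) \<le> card ({xs \<in> ?H. set xs \<inter> detached = {}} \<union> cycs detached E q)"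
        using finite_cycs fin fd by (intro card_mono[OF _ sub]) auto
      also have "\<dots> \<le> card {xs \<in> ?H. set xs \<inter> detached = {}} + card (cycs detached E q)"
        by (rule card_Un_le)
      also have "\<dots> \<le> card {xs \<in> ?H. set xs \<inter> detached = {}} + card {xs \<in> ?H. set xs \<inter> detached \<noteq> {}}"
        using small by simp
      also have "\<dots> = card ({xs \<in> ?H. set xs \<inter> detached = {}} \<union> {xs \<in> ?H. set xs \<inter> detached \<noteq> {}})"
        using finite_cycs[OF fin] by (intro card_Un_disjoint[symmetric]) auto
      also have "{xs \<in> ?H. set xs \<inter> detached = {}} \<union> {xs \<in> ?H. set xs \<inter> detached \<noteq> {}} = ?H" by auto
      finally show False using more hub_eq by simp
    qed
  qed
qed

text \<open>
  Outside \<open>T\<close>, consecutive vertices on the path occur at most once, namely as the two ends of \<open>e\<close>.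
  So the path has at most one vertex more outside \<open>T\<close> than inside, plus one if it uses \<open>e\<close>; the
  middle summand keeps track of the first vertex for the induction.
\<close>

lemma hub_rel_path_le:
  assumes "distinct xs" "successively (hub_rel V T e) xs"
  shows "length xs \<le> 2 * length (filter (\<lambda>x. x \<in> T) xs) +
    (if xs \<noteq> [] \<and> hd xs \<in> T then 0 else 1) + (if e \<noteq> {} \<and> e \<subseteq> set xs then 1 else 0)"
  using assms
proof (induction xs)
  case (Cons x ys)
  define b where "b zs = (if e \<noteq> {} \<and> e \<subseteq> set zs then 1 else (0::nat))" for zs
  have IH: "length ys \<le> 2 * length (filter (\<lambda>x. x \<in> T) ys) +
    (if ys \<noteq> [] \<and> hd ys \<in> T then 0 else 1) + b ys"
  proof -
    have "distinct ys" "successively (hub_rel V T e) ys"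
      using Cons.prems by (auto simp: successively_Cons)
    then show ?thesis unfolding b_def by (rule Cons.IH)
  qed
  have mono: "b ys \<le> b (x # ys)" by (auto simp: b_def)
  have "length (x # ys) \<le> 2 * length (filter (\<lambda>x. x \<in> T) (x # ys)) +
    (if x \<in> T then 0 else 1) + b (x # ys)"
  proof (cases "x \<in> T \<or> ys = [] \<or> hd ys \<in> T")
    case True
    then show ?thesis using IH mono by (auto split: if_splits)
  next
    case False
    \<comment> \<open>Both ends of \<open>e\<close> have now been met, so this cannot happen again.\<close>
    then have "{x, hd ys} = e" using Cons.prems by (auto simp: successively_Cons hub_rel_def)
    then have "e \<noteq> {}" "e \<subseteq> set (x # ys)" "\<not> e \<subseteq> set ys" using Cons.prems(1) False by auto
    then show ?thesis using IH False by (simp add: b_def)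
  qed
  then show ?case by (simp add: b_def)
qed simp

lemma hub_rel_path_length:
  assumes "is_path V (hub_rel V T e) xs" "finite T"
  shows "length xs \<le> 2 * card T + (if e = {} then 1 else 2)"
proof -
  have "distinct (filter (\<lambda>x. x \<in> T) xs)" using assms by (auto simp: is_path_def)
  then have "length (filter (\<lambda>x. x \<in> T) xs) = card (set (filter (\<lambda>x. x \<in> T) xs))" by (simp only: distinct_card)
  also have "\<dots> \<le> card T" using assms(2) by (intro card_mono) auto
  finally show ?thesis using hub_rel_path_le[of xs V T e] assms(1) by (auto simp: is_path_def split: if_splits)
qed

section \<open>Copies of a graph and embeddings\<close>

definition adj :: "'a graph \<Rightarrow> 'a \<Rightarrow> 'a \<Rightarrow> bool" where
  "adj G x y \<longleftrightarrow> {x, y} \<in> edges G"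

definition map_graph :: "('a \<Rightarrow> 'b) \<Rightarrow> 'a graph \<Rightarrow> 'b graph" where
  "map_graph f H = Graph (f ` verts H) ((`) f ` edges H)"

lemma rel_graph_adj:
  assumes "simple_graph G"
  shows "rel_graph (verts G) (adj G)"
proof
  show "finite (verts G)" using assms by (simp add: simple_graph_def)
  show "\<not> adj G x x" for x using assms by (auto simp: simple_graph_def adj_def)
  show "x \<in> verts G" if "adj G x y" for x y using assms that by (auto simp: simple_graph_def adj_def)
qed (auto simp: adj_def insert_commute)

lemma simple_edgeE:
  assumes "simple_graph G" "e \<in> edges G"
  obtains u v where "e = {u, v}" "u \<noteq> v" "u \<in> verts G" "v \<in> verts G"
  using assms unfolding simple_graph_def by (metis card_2_iff insert_subset)

lemma simple_map_graph:
  assumes "simple_graph H" "inj_on f (verts H)"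
  shows "simple_graph (map_graph f H)"
proof -
  have "card (f ` e) = 2" if "e \<in> edges H" for e
    using that assms by (metis card_image inj_on_subset simple_graph_def)
  then show ?thesis using assms by (auto simp: simple_graph_def map_graph_def)
qed

lemma isomorphic_map_graph:
  assumes "simple_graph H" "inj_on f (verts H)"
  shows "isomorphic (map_graph f H) H"
proof -
  let ?g = "inv_into (verts H) f"
  have e: "{f a, f b} \<in> (`) f ` edges H \<longleftrightarrow> {a, b} \<in> edges H" if "a \<in> verts H" "b \<in> verts H" for a b
  proof
    assume "{f a, f b} \<in> (`) f ` edges H"
    then obtain x where x: "x \<in> edges H" "f ` {a, b} = f ` x" by auto
    have "x \<subseteq> verts H" using assms(1) x by (auto simp: simple_graph_def)
    then have "{a, b} = x" using x that inj_on_image_eq_iff[OF assms(2), of "{a, b}" x] by simp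
    then show "{a, b} \<in> edges H" using x by simp
  next
    assume "{a, b} \<in> edges H"
    then show "{f a, f b} \<in> (`) f ` edges H" by (intro image_eqI[of _ _ "{a, b}"]) auto
  qed
  show ?thesis unfolding isomorphic_def map_graph_def
    by (intro exI[of _ ?g] conjI)
       (auto simp: bij_betw_inv_into assms(2) inj_on_imp_bij_betw e)
qed

lemma isomorphic_imp_map_graph:
  assumes "simple_graph S" "simple_graph H" "isomorphic S H"
  obtains f where "inj_on f (verts H)" "S = map_graph f H"
proof -
  obtain g where g: "bij_betw g (verts S) (verts H)"
    and e: "\<And>u v. u \<in> verts S \<Longrightarrow> v \<in> verts S \<Longrightarrow> {u, v} \<in> edges S \<longleftrightarrow> {g u, g v} \<in> edges H"
    using assms(3) unfolding isomorphic_def by blast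
  define f where "f = inv_into (verts S) g"
  have f: "bij_betw f (verts H) (verts S)" using g by (simp add: f_def bij_betw_inv_into)
  have fg: "f (g u) = u" if "u \<in> verts S" for u
    using that g unfolding f_def by (simp add: bij_betw_inv_into_left)
  have gf: "g (f u) = u" if "u \<in> verts H" for u
    using that g unfolding f_def by (simp add: bij_betw_inv_into_right)
  have "edges S = (`) f ` edges H"
  proof (intro set_eqI iffI)
    fix x assume x: "x \<in> edges S"
    then obtain u v where uv: "x = {u, v}" "u \<in> verts S" "v \<in> verts S" using simple_edgeE[OF assms(1)] by metis
    then have "{g u, g v} \<in> edges H" "x = f ` {g u, g v}" using x e fg by auto
    then show "x \<in> (`) f ` edges H" by blast
  next
    fix x assume "x \<in> (`) f ` edges H"
    then obtain y where y: "y \<in> edges H" "x = f ` y" by blast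
    then obtain u v where uv: "y = {u, v}" "u \<in> verts H" "v \<in> verts H" using simple_edgeE[OF assms(2)] by metis
    then have "f u \<in> verts S" "f v \<in> verts S" using f by (auto simp: bij_betw_def)
    then show "x \<in> edges S" using e[of "f u" "f v"] gf uv y by simp
  qed
  moreover have "verts S = f ` verts H" using f by (simp add: bij_betw_def)
  ultimately have "S = map_graph f H" by (cases S) (simp add: map_graph_def)
  then show ?thesis using that f by (auto simp: bij_betw_def)
qed

text \<open>
  For a pattern \<open>H\<close> on the vertices \<open>0, \<dots>, k - 1\<close>, the list of images of these vertices.
\<close>

definition embeddings :: "nat \<Rightarrow> nat graph \<Rightarrow> 'a graph \<Rightarrow> 'a list set" where
  "embeddings k H G = {xs. length xs = k \<and> distinct xs \<and> set xs \<subseteq> verts G \<and>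
     (\<forall>e\<in>edges H. (!) xs ` e \<in> edges G)}"

lemma nth_image_lessThan: "length xs = k \<Longrightarrow> (!) xs ` {..<k} = set xs"
  by (auto simp: set_conv_nth)

lemma embeddings_iff_subgraph:
  assumes "simple_graph H" "verts H = {..<k}" "length xs = k" "distinct xs"
  shows "xs \<in> embeddings k H G \<longleftrightarrow> subgraph (map_graph ((!) xs) H) G"
proof -
  have "inj_on ((!) xs) (verts H)" using assms by (simp add: inj_on_nth)
  then have "simple_graph (map_graph ((!) xs) H)" using assms(1) by (rule simple_map_graph[rotated])
  then show ?thesis
    using assms nth_image_lessThan[OF assms(3)]
    by (auto simp: embeddings_def subgraph_def map_graph_def image_subset_iff)
qed

text \<open>
  An isomorphism from \<open>H\<close> onto a copy, written as the list of its values, is an embedding.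
\<close>

lemma copies_eq_image:
  fixes G :: "'a graph"
  assumes H: "simple_graph H" "verts H = {..<k}"
  shows "{S. subgraph S G \<and> isomorphic S H} = (\<lambda>xs. map_graph ((!) xs) H) ` embeddings k H G"
proof (intro set_eqI iffI)
  fix S :: "'a graph" assume "S \<in> {S. subgraph S G \<and> isomorphic S H}"
  then have S: "subgraph S G" "isomorphic S H" by auto
  then have "simple_graph S" by (simp add: subgraph_def)
  from isomorphic_imp_map_graph[OF this H(1) S(2)]
  obtain f where f: "inj_on f (verts H)" "S = map_graph f H" by auto
  define xs where "xs = map f [0..<k]"
  have nth: "xs ! i = f i" if "i < k" for i using that by (simp add: xs_def)
  have "map_graph ((!) xs) H = map_graph f H"
  proof -
    have im: "(!) xs ` e = f ` e" if "e \<in> edges H" for e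
    proof -
      have "e \<subseteq> {..<k}" using that H by (auto simp: simple_graph_def)
      then show ?thesis using nth by (intro image_cong) auto
    qed
    have "(`) ((!) xs) ` edges H = (`) f ` edges H" by (rule image_cong[OF refl im])
    then show ?thesis using H nth by (auto simp: map_graph_def)
  qed
  moreover have "length xs = k" "distinct xs"
    using f H by (auto simp: xs_def distinct_map atLeast0LessThan)
  ultimately have "xs \<in> embeddings k H G" "S = map_graph ((!) xs) H"
    using embeddings_iff_subgraph[OF H, of xs G] f S by auto
  then show "S \<in> (\<lambda>xs. map_graph ((!) xs) H) ` embeddings k H G" by blast
next
  fix S assume "S \<in> (\<lambda>xs. map_graph ((!) xs) H) ` embeddings k H G"
  then obtain xs where xs: "xs \<in> embeddings k H G" "S = map_graph ((!) xs) H" by blast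
  then have l: "length xs = k" "distinct xs" by (auto simp: embeddings_def)
  then have "inj_on ((!) xs) (verts H)" using H by (simp add: inj_on_nth)
  then show "S \<in> {S. subgraph S G \<and> isomorphic S H}"
    using isomorphic_map_graph[OF H(1)] embeddings_iff_subgraph[OF H l] xs by auto
qed

lemma free_of_iff_embeddings:
  assumes "simple_graph H" "verts H = {..<k}"
  shows "free_of H G \<longleftrightarrow> embeddings k H G = {}"
  using copies_eq_image[OF assms, of G] unfolding free_of_def by blast

lemma finite_embeddings: "finite (verts G) \<Longrightarrow> finite (embeddings k H G)"
  by (rule finite_subset[OF _ finite_lists_length_eq[of "verts G" k]]) (auto simp: embeddings_def)

text \<open>
  An injective map of a finite graph into itself that preserves edges is an automorphism.
\<close>

lemma automorphism_map_graph:
  assumes H: "simple_graph H" "verts H = {..<k}" and ys: "ys \<in> embeddings k H H"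
  shows "map_graph ((!) ys) H = H"
proof -
  have l: "length ys = k" "distinct ys" "set ys \<subseteq> {..<k}" "\<forall>e\<in>edges H. (!) ys ` e \<in> edges H"
    using ys H by (auto simp: embeddings_def)
  have inj: "inj_on ((!) ys) {..<k}" using l by (simp add: inj_on_nth)
  have im: "(!) ys ` {..<k} = {..<k}"
    using nth_image_lessThan[OF l(1)] l(3) distinct_card[OF l(2)] l(1)
    by (metis card_lessThan card_subset_eq finite_lessThan)
  have finE: "finite (edges H)"
    by (rule finite_subset[of _ "Pow {..<k}"]) (use H in \<open>auto simp: simple_graph_def\<close>)
  have injE: "inj_on ((`) ((!) ys)) (edges H)"
  proof (rule inj_onI)
    fix x y assume "x \<in> edges H" "y \<in> edges H" "(!) ys ` x = (!) ys ` y"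
    moreover have "x \<subseteq> {..<k}" "y \<subseteq> {..<k}" using calculation(1,2) H by (auto simp: simple_graph_def)
    ultimately show "x = y" using inj_on_image_eq_iff[OF inj] by blast
  qed
  have "(`) ((!) ys) ` edges H = edges H"
    by (rule endo_inj_surj[OF finE _ injE]) (use l(4) in auto)
  then show ?thesis using im H by (cases H) (simp add: map_graph_def)
qed

text \<open>
  The embeddings with a given image differ from each other by automorphisms of \<open>H\<close>.
\<close>

lemma num_copies_times_automorphisms:
  fixes G :: "'a graph"
  assumes H: "simple_graph H" "verts H = {..<k}" and G: "finite (verts G)"
  shows "num_copies H G * card (embeddings k H H) = card (embeddings k H G)"
proof -
  let ?f = "\<lambda>xs. map_graph ((!) xs) H"
  let ?A = "embeddings k H G"
  have fibre: "card {xs \<in> ?A. ?f xs = S} = card (embeddings k H H)" if S: "S \<in> ?f ` ?A" for S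
  proof -
    from S obtain gs where gs: "gs \<in> ?A" "S = ?f gs" by blast
    then have lg: "length gs = k" "distinct gs" "set gs \<subseteq> verts G"
      "\<forall>e\<in>edges H. (!) gs ` e \<in> edges G" by (auto simp: embeddings_def)
    have inj: "inj_on ((!) gs) {..<k}" using lg by (simp add: inj_on_nth)
    have im: "(!) gs ` {..<k} = set gs" by (rule nth_image_lessThan[OF lg(1)])
    have eH: "e \<subseteq> {..<k}" if "e \<in> edges H" for e using that H by (auto simp: simple_graph_def)
    have "bij_betw (map ((!) gs)) (embeddings k H H) {xs \<in> ?A. ?f xs = S}"
      unfolding bij_betw_def
    proof
      show "inj_on (map ((!) gs)) (embeddings k H H)"
      proof (rule inj_onI)
        fix xs ys assume *: "xs \<in> embeddings k H H" "ys \<in> embeddings k H H" "map ((!) gs) xs = map ((!) gs) ys"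
        then have "set xs \<union> set ys \<subseteq> {..<k}" using H by (auto simp: embeddings_def)
        then show "xs = ys" using map_inj_on[OF *(3)] inj inj_on_subset by blast
      qed
      show "map ((!) gs) ` embeddings k H H = {xs \<in> ?A. ?f xs = S}"
      proof (intro set_eqI iffI)
        fix xs assume "xs \<in> map ((!) gs) ` embeddings k H H"
        then obtain ys where ys: "ys \<in> embeddings k H H" "xs = map ((!) gs) ys" by blast
        then have ly: "length ys = k" "distinct ys" "set ys \<subseteq> {..<k}" using H by (auto simp: embeddings_def)
        have n: "(!) xs ` e = (!) gs ` ((!) ys ` e)" if "e \<subseteq> {..<k}" for e
          unfolding image_image using that ly ys by (intro image_cong) auto
        have "?f xs = map_graph ((!) gs) (map_graph ((!) ys) H)"
        proof -
          have "(`) ((!) xs) ` edges H = (`) ((!) gs) ` (`) ((!) ys) ` edges H"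
            unfolding image_image[of "(`) ((!) gs)"] by (rule image_cong[OF refl n[OF eH]])
          then show ?thesis using n[of "{..<k}"] H by (simp add: map_graph_def)
        qed
        then have S: "?f xs = S" using automorphism_map_graph[OF H ys(1)] gs by simp
        have "length xs = k" using ly ys by simp
        moreover have "distinct xs" using ly ys inj by (auto simp: distinct_map intro: inj_on_subset)
        ultimately have "xs \<in> ?A"
          using embeddings_iff_subgraph[OF H, of xs G] embeddings_iff_subgraph[OF H lg(1,2)] gs S by simp
        then show "xs \<in> {xs \<in> ?A. ?f xs = S}" using S by simp
      next
        fix xs assume "xs \<in> {xs \<in> ?A. ?f xs = S}"
        then have xs: "xs \<in> ?A" "?f xs = ?f gs" using gs by auto
        then have lx: "length xs = k" "distinct xs" by (auto simp: embeddings_def)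
        have sx: "set xs = set gs"
          using xs(2) nth_image_lessThan[OF lx(1)] im H by (simp add: map_graph_def)
        have ex: "(`) ((!) xs) ` edges H = (`) ((!) gs) ` edges H" using xs(2) by (simp add: map_graph_def)
        let ?inv = "inv_into {..<k} ((!) gs)"
        define ys where "ys = map ?inv xs"
        have iv: "?inv x \<in> {..<k} \<and> gs ! ?inv x = x" if "x \<in> set gs" for x
          using that im inv_into_into[of x "(!) gs" "{..<k}"] f_inv_into_f[of x "(!) gs" "{..<k}"] by auto
        have gy: "map ((!) gs) ys = xs"
          unfolding ys_def map_map by (rule map_idI) (use iv sx in auto)
        have ly: "length ys = k" "set ys \<subseteq> {..<k}" using lx iv sx by (auto simp: ys_def)
        have dy: "distinct ys" using lx(2) unfolding gy[symmetric] by (simp add: distinct_map)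
        have "(!) ys ` e \<in> edges H" if e: "e \<in> edges H" for e
        proof -
          have "(!) xs ` e = (!) gs ` ((!) ys ` e)"
            unfolding image_image gy[symmetric] using eH[OF e] ly(1) by (intro image_cong) auto
          moreover obtain e' where e': "e' \<in> edges H" "(!) xs ` e = (!) gs ` e'" using ex e by blast
          moreover have "(!) ys ` e \<subseteq> {..<k}"
            using ly eH[OF e] nth_mem[of _ ys] by (auto simp: subset_iff)
          ultimately show ?thesis using inj_on_image_eq_iff[OF inj, of "(!) ys ` e" e'] eH[of e'] by metis
        qed
        then have "ys \<in> embeddings k H H" using ly dy H by (simp add: embeddings_def)
        then show "xs \<in> map ((!) gs) ` embeddings k H H" using gy by blast
      qed
    qed
    then show ?thesis by (rule bij_betw_same_card[symmetric])
  qed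
  have "card ?A = (\<Sum>S\<in>?f ` ?A. card {xs \<in> ?A. ?f xs = S})"
    using sum.image_gen[OF finite_embeddings[OF G], of "\<lambda>_. 1::nat" k H ?f] by simp
  also have "\<dots> = (\<Sum>S\<in>?f ` ?A. card (embeddings k H H))" using fibre by (intro sum.cong) auto
  also have "\<dots> = num_copies H G * card (embeddings k H H)"
    by (simp add: num_copies_def copies_eq_image[OF H])
  finally show ?thesis by simp
qed

section \<open>Copies of a cycle\<close>

lemma embeddings_cycle: "embeddings q (cycle_graph q) G = cycs (verts G) (adj G) q"
proof -
  have "edges (cycle_graph q) = (\<lambda>i. {i, Suc i mod q}) ` {..<q}" by (auto simp: cycle_graph_def)
  then show ?thesis by (auto simp: embeddings_def cycs_def adj_def)
qed

lemma embeddings_path: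
  "embeddings k (path_graph k) G = {xs. is_path (verts G) (adj G) xs \<and> length xs = k}"
proof -
  have "edges (path_graph k) = (\<lambda>i. {i, Suc i}) ` {i. Suc i < k}" by (auto simp: path_graph_def)
  then show ?thesis by (auto simp: embeddings_def is_path_def adj_def successively_conv_nth)
qed

lemma free_of_path_iff:
  "free_of (path_graph k) G \<longleftrightarrow> (\<forall>xs. is_path (verts G) (adj G) xs \<longrightarrow> length xs < k)"
proof -
  have "free_of (path_graph k) G \<longleftrightarrow> (\<forall>xs. is_path (verts G) (adj G) xs \<longrightarrow> length xs \<noteq> k)"
    using free_of_iff_embeddings[OF simple_graph_path, of k k G] embeddings_path[of k G]
    by (auto simp: path_graph_def)
  also have "\<dots> \<longleftrightarrow> (\<forall>xs. is_path (verts G) (adj G) xs \<longrightarrow> length xs < k)"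
  proof safe
    fix xs assume a: "\<forall>xs. is_path (verts G) (adj G) xs \<longrightarrow> length xs \<noteq> k" "is_path (verts G) (adj G) xs"
    show "length xs < k"
    proof (rule ccontr)
      assume "\<not> length xs < k"
      then have "length (take k xs) = k" by simp
      then show False using a is_path_take by blast
    qed
  qed auto
  finally show ?thesis .
qed

lemma path_free_iff:
  assumes "simple_graph G"
  shows "free_of (path_graph (p + 1)) G \<longleftrightarrow> path_free (verts G) (adj G) p"
  using rel_graph_adj[OF assms]
  by (auto simp: free_of_path_iff path_free_def path_free_axioms_def less_Suc_eq_le)

abbreviation cycle_automorphisms :: "nat \<Rightarrow> nat" where
  "cycle_automorphisms q \<equiv> card (cycs {..<q} (adj (cycle_graph q)) q)"

lemma num_copies_cycle:
  assumes "3 \<le> q" "finite (verts G)"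
  shows "num_copies (cycle_graph q) G * cycle_automorphisms q = card (cycs (verts G) (adj G) q)"
  using num_copies_times_automorphisms[OF simple_graph_cycle[OF assms(1)] _ assms(2), of q]
  by (simp add: embeddings_cycle) (simp add: cycle_graph_def)

lemma adj_cycle:
  assumes "3 \<le> q" "i < q"
  shows "adj (cycle_graph q) i j \<longleftrightarrow> j = Suc i mod q \<or> (j < q \<and> j = (i + (q - 1)) mod q)"
proof -
  have "adj (cycle_graph q) i j \<longleftrightarrow> j = Suc i mod q \<or> (j < q \<and> i = Suc j mod q)"
    using assms by (auto simp: adj_def cycle_graph_def doubleton_eq_iff)
  moreover have "i = Suc j mod q \<longleftrightarrow> j = (i + (q - 1)) mod q" if "j < q"
  proof -
    have "Suc j mod q = (if Suc j = q then 0 else Suc j)" using that by auto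
    moreover have "(i + (q - 1)) mod q = (if i = 0 then q - 1 else i - 1)"
      using assms by (auto simp: le_mod_geq)
    ultimately show ?thesis using that assms by (auto split: if_splits)
  qed
  ultimately show ?thesis by auto
qed

text \<open>
  A walk on a cycle that does not turn back keeps its direction \<open>d\<close>; the direction \<open>-1\<close> is
  represented by \<open>q - 1\<close>.
\<close>

lemma cycle_neighbours_of_step:
  fixes q s :: nat
  assumes "3 \<le> q" "d = 1 \<or> d = q - 1" "v = (s + d * Suc i) mod q"
    "w = Suc v mod q \<or> w = (v + (q - 1)) mod q" "w \<noteq> (s + d * i) mod q"
  shows "w = (s + d * Suc (Suc i)) mod q"
proof -
  define u where "u = s + d * i"
  have v: "v = (u + d) mod q" using assms(3) by (simp add: u_def ac_simps)
  have w: "w = Suc (u + d) mod q \<or> w = (u + d + (q - 1)) mod q"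
    using assms(4) unfolding v by (auto simp: mod_simps)
  have g: "s + d * Suc (Suc i) = u + d + d" by (simp add: u_def)
  have ne: "w \<noteq> u mod q" using assms(5) unfolding u_def .
  from assms(2) show ?thesis
  proof
    assume d: "d = 1"
    then have "(u + d + (q - 1)) mod q = u mod q" using assms(1) by simp
    then have "w = Suc (u + d) mod q" using w ne by metis
    then show ?thesis unfolding g by (simp add: d)
  next
    assume d: "d = q - 1"
    then have "Suc (u + d) mod q = u mod q" using assms(1) by simp
    then have "w = (u + d + (q - 1)) mod q" using w ne by metis
    then show ?thesis unfolding g by (simp add: d)
  qed
qed

text \<open>
  A cyclic list around \<open>C\<^sub>q\<close> is determined by its first vertex and its direction.
\<close>

lemma cycs_cycle_graph:
  assumes q: "3 \<le> q"
  shows "cycs {..<q} (adj (cycle_graph q)) q =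
    (\<lambda>(s, d). map (\<lambda>i. (s + d * i) mod q) [0..<q]) ` ({..<q} \<times> {1, q - 1})"
proof (intro set_eqI iffI)
  fix xs assume xs: "xs \<in> cycs {..<q} (adj (cycle_graph q)) q"
  then have len: "length xs = q" "distinct xs" and sx: "set xs \<subseteq> {..<q}" by (auto simp: cycs_def)
  have lt: "xs ! i < q" if "i < q" for i using subsetD[OF sx nth_mem[of i xs]] that len by simp
  have nb: "xs ! Suc i = Suc (xs ! i) mod q \<or> xs ! Suc i = (xs ! i + (q - 1)) mod q" if "Suc i < q" for i
  proof -
    have "\<forall>i<q. adj (cycle_graph q) (xs ! i) (xs ! (Suc i mod q))" using xs by (simp add: cycs_def)
    then have "adj (cycle_graph q) (xs ! i) (xs ! Suc i)" using that by (metis Suc_lessD mod_less)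
    then show ?thesis using adj_cycle[OF q lt[of i]] that by auto
  qed
  define s where "s = xs ! 0"
  \<comment> \<open>The first step fixes the direction.\<close>
  define d where "d = (if xs ! 1 = Suc s mod q then 1 else q - 1)"
  have x1: "xs ! 1 = (s + d) mod q" using nb[of 0] q by (auto simp: s_def d_def)
  have "xs ! i = (s + d * i) mod q \<and> xs ! Suc i = (s + d * Suc i) mod q" if "Suc i < q" for i
    using that
  proof (induction i)
    case 0
    then show ?case using x1 lt[of 0] q by (simp add: s_def)
  next
    case (Suc i)
    then have IH: "xs ! i = (s + d * i) mod q" "xs ! Suc i = (s + d * Suc i) mod q" by auto
    have "xs ! Suc (Suc i) \<noteq> xs ! i" using len Suc.prems nth_eq_iff_index_eq[OF len(2)] by simp
    then have "xs ! Suc (Suc i) = (s + d * Suc (Suc i)) mod q"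
      using nb[OF Suc.prems] IH by (intro cycle_neighbours_of_step[OF q _ IH(2)]) (auto simp: d_def)
    then show ?case using IH by simp
  qed
  note * = this
  have "xs ! i = (s + d * i) mod q" if "i < q" for i
    using that *[of i] *[of "i - 1"] q by (cases "Suc i < q"; cases i) auto
  then have "xs = map (\<lambda>i. (s + d * i) mod q) [0..<q]" using len by (intro nth_equalityI) auto
  moreover have "(s, d) \<in> {..<q} \<times> {1, q - 1}" using lt[of 0] q by (auto simp: s_def d_def)
  ultimately show "xs \<in> (\<lambda>(s, d). map (\<lambda>i. (s + d * i) mod q) [0..<q]) ` ({..<q} \<times> {1, q - 1})"
    by (intro image_eqI[of _ _ "(s, d)"]) simp_all
next
  fix xs assume "xs \<in> (\<lambda>(s, d). map (\<lambda>i. (s + d * i) mod q) [0..<q]) ` ({..<q} \<times> {1, q - 1})"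
  then obtain s d where sd: "s < q" "d = 1 \<or> d = q - 1" and xs: "xs = map (\<lambda>i. (s + d * i) mod q) [0..<q]"
    by auto
  have dc: "coprime d q" using sd(2) q coprime_diff_one_left_nat[of q] by auto
  have len: "length xs = q" by (simp add: xs)
  have nth: "xs ! i = (s + d * i) mod q" if "i < q" for i using that by (simp add: xs)
  have inj: "i = j" if ij: "i < q" "j < q" "(s + d * i) mod q = (s + d * j) mod q" for i j
  proof -
    have le: "i = j" if "i \<le> j" "j < q" "(s + d * i) mod q = (s + d * j) mod q" for i j
    proof -
      have "q dvd (s + d * j) - (s + d * i)"
        using that mod_eq_dvd_iff_nat[of "s + d * i" "s + d * j" q] by simp
      then have "q dvd d * (j - i)" by (simp add: diff_mult_distrib2)
      then have "q dvd j - i" using dc coprime_commute coprime_dvd_mult_right_iff by blast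
      then show "i = j" using that by (auto dest: dvd_imp_le)
    qed
    show ?thesis using le[of i j] le[of j i] ij by linarith
  qed
  have "distinct xs" unfolding distinct_conv_nth len
  proof (intro allI impI)
    fix i j assume "i < q" "j < q" "i \<noteq> j"
    then show "xs ! i \<noteq> xs ! j" using inj[of i j] nth by auto
  qed
  moreover have "set xs \<subseteq> {..<q}" using q by (auto simp: xs)
  moreover have "adj (cycle_graph q) (xs ! i) (xs ! (Suc i mod q))" if i: "i < q" for i
  proof -
    have "xs ! (Suc i mod q) = (s + d * Suc i) mod q"
    proof -
      have "xs ! (Suc i mod q) = (s + d * (Suc i mod q)) mod q" using nth q by simp
      also have "\<dots> = (s + d * Suc i) mod q" by (metis mod_add_right_eq mod_mult_right_eq)
      finally show ?thesis .
    qed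
    also have "\<dots> = (xs ! i + d) mod q" using nth[OF i] by (simp add: mod_simps ac_simps)
    finally show ?thesis using adj_cycle[OF q, of "xs ! i" "xs ! (Suc i mod q)"] sd(2) nth[OF i] q by auto
  qed
  ultimately show "xs \<in> cycs {..<q} (adj (cycle_graph q)) q" using len by (simp add: cycs_def)
qed

lemma cycle_automorphisms_eq:
  assumes q: "3 \<le> q"
  shows "cycle_automorphisms q = 2 * q"
proof -
  let ?f = "\<lambda>(s, d). map (\<lambda>i. (s + d * i) mod q) [0..<q]"
  have inj: "inj_on ?f ({..<q} \<times> {1, q - 1})"
  proof (rule inj_onI, clarify)
    fix s d s' d' assume sd: "s < q" "d \<in> {1, q - 1}" "s' < q" "d' \<in> {1, q - 1}"
      and eq: "map (\<lambda>i. (s + d * i) mod q) [0..<q] = map (\<lambda>i. (s' + d' * i) mod q) [0..<q]"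
    have e: "(s + d * i) mod q = (s' + d' * i) mod q" if "i < q" for i
      using arg_cong[OF eq, of "\<lambda>xs. xs ! i"] that by simp
    have s: "s = s'" using e[of 0] sd q by simp
    have "(s + 1) mod q = (if Suc s = q then 0 else Suc s)" using sd(1) by simp
    moreover have "(s + (q - 1)) mod q = (if s = 0 then q - 1 else s - 1)"
      using sd(1) q by (auto simp: le_mod_geq)
    ultimately have "(s + 1) mod q \<noteq> (s + (q - 1)) mod q" using sd(1) q by (auto split: if_splits)
    then have "d = d'" using e[of 1] s sd q by auto
    then show "s = s' \<and> d = d'" using s by simp
  qed
  have "1 \<noteq> q - 1" using q by simp
  then have "card {1, q - 1} = 2" by (rule card_2_iff[THEN iffD2, OF exI, OF exI, OF conjI, OF refl])
  then have "card ({..<q} \<times> {1, q - 1}) = q * 2" by (simp only: card_cartesian_product card_lessThan)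
  then show ?thesis unfolding cycs_cycle_graph[OF q] card_image[OF inj] by (simp only: mult.commute)
qed

lemma falling_self: "falling m m = fact m"
  unfolding falling_def using fact_prod_rev[of m, where ?'a = nat] by (simp add: atLeast0LessThan)

section \<open>Forbidding a path with one vertex more than the cycle\<close>

text \<open>
  A neighbour of a cycle outside of it would give a path on \<open>q + 1\<close> vertices. So the vertex sets of
  two cycles are equal or disjoint, and each contains at most \<open>q!\<close> lists.
\<close>

lemma (in path_free) card_cycs_le_components:
  assumes p: "p = q" and q: "1 \<le> q"
  shows "card (cycs V E q) \<le> (card V div q) * fact q"
proof -
  have closed: "v \<in> set xs" if xs: "xs \<in> cycs V E q" and x: "x \<in> set xs" and v: "E x v" for xs x v
  proof (rule ccontr)
    assume nv: "v \<notin> set xs"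
    obtain i where i: "i < q" "xs ! i = x" using xs x by (auto simp: cycs_def in_set_conv_nth)
    let ?ys = "rotate i xs"
    have ys: "?ys \<in> cycs V E q" by (rule cycs_rotate[OF xs])
    then have l: "length ?ys = q" "?ys \<noteq> []" using q by (auto simp: cycs_def)
    have "hd ?ys = x" using i xs l by (simp add: hd_conv_nth cycs_def nth_rotate)
    then have "is_path V E (v # ?ys)"
      using cycs_successively[OF ys] ys nv v sub2[OF v] sym l
      by (auto simp: is_path_def successively_Cons cycs_def)
    from path_le[OF this] show False using l p by simp
  qed
  have same: "set xs = set ys" if xs: "xs \<in> cycs V E q" and ys: "ys \<in> cycs V E q"
    and ne: "set xs \<inter> set ys \<noteq> {}" for xs ys
  proof -
    have "length ys = q" using ys by (simp add: cycs_def)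
    then obtain i where i: "i < q" "ys ! i \<in> set xs" using ne by (metis disjoint_iff in_set_conv_nth)
    let ?zs = "rotate i ys"
    have zs: "?zs \<in> cycs V E q" by (rule cycs_rotate[OF ys])
    then have l: "length ?zs = q" by (simp add: cycs_def)
    have sc: "successively E ?zs" by (rule cycs_successively[OF zs])
    have "?zs ! j \<in> set xs" if "j < q" for j
      using that
    proof (induction j)
      case 0
      then show ?case using i l by (simp add: nth_rotate)
    next
      case (Suc j)
      then show ?case using closed[OF xs, of "?zs ! j"] successively_nth[OF sc, of j] l by simp
    qed
    then have "set ys \<subseteq> set xs" using l by (metis in_set_conv_nth set_rotate subsetI)
    moreover have "card (set ys) = card (set xs)" using xs ys by (simp add: cycs_def distinct_card)
    ultimately show ?thesis by (metis List.finite_set card_subset_eq)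
  qed
  let ?F = "set ` cycs V E q"
  have finC: "finite (cycs V E q)" by (rule finite_cycs[OF fin])
  have cF: "card X = q" "finite X" "X \<subseteq> V" if "X \<in> ?F" for X
    using that by (auto simp: cycs_def distinct_card)
  have "pairwise disjnt ?F"
    using same by (auto simp: pairwise_def disjnt_def)
  then have "card (\<Union>?F) = sum card ?F"
    using cF(2) by (rule card_Union_disjoint)
  also have "\<dots> = (\<Sum>X\<in>?F. q)" using cF(1) by (intro sum.cong) auto
  finally have "card (\<Union>?F) = (\<Sum>X\<in>?F. q)" .
  then have "card ?F * q = card (\<Union>?F)" by simp
  also have "\<dots> \<le> card V" using cF(3) by (intro card_mono[OF fin]) blast
  finally have F: "card ?F \<le> card V div q" using q by (simp add: less_eq_div_iff_mult_less_eq)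
  have "card (cycs V E q) = (\<Sum>X\<in>?F. card {xs \<in> cycs V E q. set xs = X})"
    using sum.image_gen[OF finC, of "\<lambda>_. 1::nat" set] by simp
  also have "\<dots> \<le> (\<Sum>X\<in>?F. fact q)"
  proof (rule sum_mono)
    fix X assume X: "X \<in> ?F"
    have "card {xs \<in> cycs V E q. set xs = X} \<le> card {xs. length xs = q \<and> distinct xs \<and> set xs \<subseteq> X}"
      using finite_distinct_lists[OF cF(2)[OF X]] by (intro card_mono) (auto simp: cycs_def)
    also have "\<dots> = fact q" using card_distinct_lists[OF cF(2)[OF X]] cF(1)[OF X] by (simp add: falling_self)
    finally show "card {xs \<in> cycs V E q. set xs = X} \<le> fact q" .
  qed
  also have "\<dots> = card ?F * fact q" by simp
  also have "\<dots> \<le> (card V div q) * fact q" using F by (rule mult_right_mono) simp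
  finally show ?thesis .
qed

text \<open>
  Disjoint complete graphs on \<open>q\<close> vertices each; the last one may be smaller.
\<close>

definition clique_blocks :: "nat \<Rightarrow> nat \<Rightarrow> nat graph" where
  "clique_blocks n q = Graph {..<n} {{u, v} | u v. u < n \<and> v < n \<and> u \<noteq> v \<and> u div q = v div q}"

lemma adj_clique_blocks:
  "adj (clique_blocks n q) u v \<longleftrightarrow> u < n \<and> v < n \<and> u \<noteq> v \<and> u div q = v div q"
  by (auto simp: adj_def clique_blocks_def doubleton_eq_iff)

lemma simple_clique_blocks: "simple_graph (clique_blocks n q)"
  by (auto simp: simple_graph_def clique_blocks_def)

lemma clique_blocks_path_free:
  assumes "1 \<le> q"
  shows "path_free {..<n} (adj (clique_blocks n q)) q"
proof -
  interpret rel_graph "{..<n}" "adj (clique_blocks n q)"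
    using rel_graph_adj[OF simple_clique_blocks[of n q]] by (simp add: clique_blocks_def)
  show ?thesis
  proof
    fix xs assume xs: "is_path {..<n} (adj (clique_blocks n q)) xs"
    show "length xs \<le> q"
    proof (cases xs)
      case (Cons x ys)
      have "y div q = x div q" if "successively (adj (clique_blocks n q)) (x # ys)" "y \<in> set (x # ys)" for y x ys
        using that
      proof (induction ys arbitrary: x)
        case (Cons z ys)
        then show ?case by (auto simp: adj_clique_blocks)
      qed auto
      then have "y \<in> {x div q * q..<x div q * q + q}" if "y \<in> set xs" for y
        using that xs Cons assms div_mult_mod_eq[of y q] mod_less_divisor[of q y]
        unfolding is_path_def by (metis One_nat_def Suc_le_lessD atLeastLessThan_iff le_add1 nat_add_left_cancel_less)
      then have "set xs \<subseteq> {x div q * q..<x div q * q + q}" by blast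
      then have "card (set xs) \<le> q" using card_mono[of "{x div q * q..<x div q * q + q}" "set xs"] by simp
      then show ?thesis using xs by (simp add: is_path_def distinct_card)
    qed simp
  qed
qed

lemma card_cycs_clique_blocks:
  assumes q: "2 \<le> q"
  shows "card (cycs {..<n} (adj (clique_blocks n q)) q) = (n div q) * fact q"
proof (rule antisym)
  interpret path_free "{..<n}" "adj (clique_blocks n q)" q
    using clique_blocks_path_free[of q n] q by simp
  show "card (cycs {..<n} (adj (clique_blocks n q)) q) \<le> (n div q) * fact q"
    using card_cycs_le_components[OF refl] q by simp
  let ?B = "\<lambda>b. {b * q..<b * q + q}"
  let ?L = "\<lambda>b. {xs. length xs = q \<and> distinct xs \<and> set xs \<subseteq> ?B b}"
  have sub: "?L b \<subseteq> cycs {..<n} (adj (clique_blocks n q)) q" if b: "b < n div q" for b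
  proof
    fix xs assume xs: "xs \<in> ?L b"
    have "b * q + q \<le> n"
      using b by (metis Suc_leI add.commute mult_Suc mult_le_mono1 div_times_less_eq_dividend le_trans)
    then have lt: "y < n" if "y \<in> ?B b" for y using that by simp
    have dv: "y div q = b" if "y \<in> ?B b" for y
      using that q by (intro div_nat_eqI) (auto simp: mult.commute)
    have "adj (clique_blocks n q) (xs ! i) (xs ! (Suc i mod q))" if i: "i < q" for i
    proof -
      have s: "Suc i mod q < q" "Suc i mod q \<noteq> i" using q i by (auto simp: mod_Suc)
      have "xs ! i \<in> ?B b" "xs ! (Suc i mod q) \<in> ?B b" using xs i s nth_mem by blast+
      moreover have "xs ! i \<noteq> xs ! (Suc i mod q)"
        using xs i s nth_eq_iff_index_eq[of xs i "Suc i mod q"] by auto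
      ultimately show ?thesis using lt dv by (simp add: adj_clique_blocks)
    qed
    then show "xs \<in> cycs {..<n} (adj (clique_blocks n q)) q" using xs lt by (auto simp: cycs_def)
  qed
  have "(n div q) * fact q = (\<Sum>b<n div q. card (?L b))"
    using card_distinct_lists[of "?B _" q] by (simp add: falling_self)
  also have "\<dots> = card (\<Union>b<n div q. ?L b)"
  proof (rule card_UN_disjoint[symmetric])
    show "\<forall>b\<in>{..<n div q}. finite (?L b)" by (auto intro: finite_distinct_lists)
    show "\<forall>b\<in>{..<n div q}. \<forall>c\<in>{..<n div q}. b \<noteq> c \<longrightarrow> ?L b \<inter> ?L c = {}"
    proof (intro ballI impI)
      fix b c :: nat assume bc: "b \<noteq> c"
      show "?L b \<inter> ?L c = {}"
      proof (rule ccontr)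
        assume "?L b \<inter> ?L c \<noteq> {}"
        then obtain xs where xs: "xs \<in> ?L b" "xs \<in> ?L c" by blast
        then have "xs ! 0 \<in> set xs" using q by simp
        then have "xs ! 0 \<in> ?B b" "xs ! 0 \<in> ?B c" using xs by blast+
        then have "(xs ! 0) div q = b" "(xs ! 0) div q = c"
          using q by (auto intro!: div_nat_eqI simp: mult.commute)
        then show False using bc by simp
      qed
    qed
  qed simp
  also have "\<dots> \<le> card (cycs {..<n} (adj (clique_blocks n q)) q)"
    using sub by (intro card_mono finite_cycs) auto
  finally show "(n div q) * fact q \<le> card (cycs {..<n} (adj (clique_blocks n q)) q)" .
qed

section \<open>The extremal graph as a relation\<close>

lemma verts_H_graph:
  assumes "L div 2 \<le> n"
  shows "verts (H_graph n L) = {..<L div 2} <+> {..<n - L div 2}"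
  by (simp add: H_graph_def Let_def graph_join_def complete_graph_def add_edge_def empty_graph_def)

lemma adj_graph_join:
  "adj (graph_join G H) (Inl u) (Inl v) \<longleftrightarrow> adj G u v"
  "adj (graph_join G H) (Inr u') (Inr v') \<longleftrightarrow> adj H u' v'"
  "adj (graph_join G H) (Inl u) (Inr v') \<longleftrightarrow> u \<in> verts G \<and> v' \<in> verts H"
  "adj (graph_join G H) (Inr v') (Inl u) \<longleftrightarrow> u \<in> verts G \<and> v' \<in> verts H"
proof -
  have l: "{Inl a, Inl b} = Inl ` e \<longleftrightarrow> e = {a, b}" for a b and e :: "'a set"
    using inj_image_eq_iff[OF inj_Inl, of "{a, b}" e] by auto
  have r: "{Inr a, Inr b} = Inr ` e \<longleftrightarrow> e = {a, b}" for a b and e :: "'b set"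
    using inj_image_eq_iff[OF inj_Inr, of "{a, b}" e] by auto
  show "adj (graph_join G H) (Inl u) (Inl v) \<longleftrightarrow> adj G u v"
    "adj (graph_join G H) (Inr u') (Inr v') \<longleftrightarrow> adj H u' v'"
    by (auto simp: adj_def graph_join_def image_iff l r doubleton_eq_iff)
  show "adj (graph_join G H) (Inl u) (Inr v') \<longleftrightarrow> u \<in> verts G \<and> v' \<in> verts H"
    "adj (graph_join G H) (Inr v') (Inl u) \<longleftrightarrow> u \<in> verts G \<and> v' \<in> verts H"
    by (auto simp: adj_def graph_join_def doubleton_eq_iff)
qed

lemma adj_H_graph:
  assumes "L div 2 + 2 \<le> n"
  shows "adj (H_graph n L) x y \<longleftrightarrow>
    hub_rel (verts (H_graph n L)) (Inl ` {..<L div 2}) (if even L then {} else {Inr 0, Inr 1}) x y"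
proof -
  have c: "adj (complete_graph k) u v \<longleftrightarrow> u < k \<and> v < k \<and> u \<noteq> v" for k u v
    by (auto simp: adj_def complete_graph_def doubleton_eq_iff)
  have e: "\<not> adj (empty_graph k) u v" for k u v
    by (simp add: adj_def empty_graph_def)
  define J where "J = add_edge {0, 1} (empty_graph (n - L div 2))"
  have a: "adj J u v \<longleftrightarrow> {u, v} = {0, 1}" for u v
    by (simp add: J_def adj_def empty_graph_def add_edge_def)
  have v: "verts (complete_graph k) = {..<k}" "verts (empty_graph k) = {..<k}"
    "verts J = {..<n - L div 2}" for k
    by (simp_all add: complete_graph_def empty_graph_def add_edge_def J_def)
  have V: "verts (H_graph n L) = {..<L div 2} <+> {..<n - L div 2}"
    using assms by (intro verts_H_graph) simp
  show ?thesis
  proof (cases "even L")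
    case True
    then have H: "H_graph n L = graph_join (complete_graph (L div 2)) (empty_graph (n - L div 2))"
      by (simp add: H_graph_def Let_def)
    show ?thesis unfolding hub_rel_def V using True
      by (cases x; cases y) (auto simp: H adj_graph_join c e v)
  next
    case False
    then have H: "H_graph n L = graph_join (complete_graph (L div 2)) J"
      by (simp add: H_graph_def Let_def J_def)
    show ?thesis unfolding hub_rel_def V using False assms
      by (cases x; cases y) (auto simp: H adj_graph_join c a v doubleton_eq_iff)
  qed
qed

section \<open>Extremal numbers\<close>

lemma gen_ex_eqI:
  assumes "simple_graph G0" "card (verts G0) = n" "free_of F G0"
    and "\<And>G :: nat graph. simple_graph G \<Longrightarrow> card (verts G) = n \<Longrightarrow> free_of F G \<Longrightarrow>
      num_copies K G \<le> num_copies K G0"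
  shows "gen_ex n K F = num_copies K (G0 :: nat graph)"
  unfolding gen_ex_def
  by (rule Max_eqI[OF finite_ex_values]) (use assms in \<open>auto simp: ex_values_def\<close>)

lemma num_copies_cycle_double:
  assumes "3 \<le> q" "simple_graph G"
  shows "num_copies (cycle_graph q) G * (2 * q) = card (cycs (verts G) (adj G) q)"
  using num_copies_cycle[OF assms(1), of G] cycle_automorphisms_eq[OF assms(1)] assms(2)
  by (simp add: simple_graph_def)

lemma num_copies_cycle_le_iff:
  assumes "3 \<le> q" "simple_graph G" "simple_graph H"
  shows "num_copies (cycle_graph q) G \<le> num_copies (cycle_graph q) H \<longleftrightarrow>
    card (cycs (verts G) (adj G) q) \<le> card (cycs (verts H) (adj H) q)"
proof -
  have "0 < 2 * q" using assms(1) by simp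
  then show ?thesis
    unfolding num_copies_cycle_double[OF assms(1,2), symmetric] num_copies_cycle_double[OF assms(1,3), symmetric]
    by (simp only: mult_le_cancel2 simp_thms)
qed

lemma gen_ex_short_path:
  assumes q: "3 \<le> q" and p: "1 \<le> p" "p \<le> q - 1"
  shows "gen_ex n (cycle_graph q) (path_graph (p + 1)) = 0"
proof -
  have zero: "num_copies (cycle_graph q) G = 0" if G: "simple_graph G" "free_of (path_graph (p + 1)) G" for G :: "nat graph"
  proof -
    interpret path_free "verts G" "adj G" p using G path_free_iff by blast
    have "cycs (verts G) (adj G) q = {}"
    proof (rule ccontr)
      assume "\<not> ?thesis"
      then obtain xs where xs: "xs \<in> cycs (verts G) (adj G) q" by blast
      then have "is_path (verts G) (adj G) xs" "length xs = q"
        using cycs_successively[OF xs] by (auto simp: is_path_def cycs_def)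
      then show False using path_le p q by fastforce
    qed
    then show ?thesis using num_copies_cycle_double[OF q G(1)] q by simp
  qed
  have "{0, 1} \<in> edges (path_graph (p + 1))" using p by (auto simp: path_graph_def)
  then have "ex_values n (cycle_graph q) (path_graph (p + 1)) \<noteq> {}"
    by (intro ex_values_nonempty simple_graph_path) auto
  moreover have "x = 0" if "x \<in> ex_values n (cycle_graph q) (path_graph (p + 1))" for x
    using that zero by (auto simp: ex_values_def)
  ultimately have "ex_values n (cycle_graph q) (path_graph (p + 1)) = {0}" by auto
  then show ?thesis by (simp add: gen_ex_def)
qed

lemma gen_ex_equal_path:
  assumes q: "3 \<le> q"
  shows "real (gen_ex n (cycle_graph q) (path_graph (q + 1))) =
    real_of_int \<lfloor>real n / real q\<rfloor> * (fact (q - 1) / 2)"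
proof -
  let ?G = "clique_blocks n q"
  have v: "verts ?G = {..<n}" by (simp add: clique_blocks_def)
  have c0: "card (cycs (verts ?G) (adj ?G) q) = (n div q) * fact q"
    unfolding v using card_cycs_clique_blocks[of q n] q by simp
  have "gen_ex n (cycle_graph q) (path_graph (q + 1)) = num_copies (cycle_graph q) ?G"
  proof (rule gen_ex_eqI[OF simple_clique_blocks])
    show "free_of (path_graph (q + 1)) ?G"
      using path_free_iff[OF simple_clique_blocks, of q n q] clique_blocks_path_free[of q n] q v by simp
    fix G :: "nat graph"
    assume G: "simple_graph G" "card (verts G) = n" "free_of (path_graph (q + 1)) G"
    interpret path_free "verts G" "adj G" q using G path_free_iff by blast
    have "card (cycs (verts G) (adj G) q) \<le> (n div q) * fact q"
      using card_cycs_le_components[OF refl] q G(2) by simp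
    then show "num_copies (cycle_graph q) G \<le> num_copies (cycle_graph q) ?G"
      using num_copies_cycle_le_iff[OF q G(1) simple_clique_blocks] c0 by simp
  qed (simp add: v)
  moreover have "real (num_copies (cycle_graph q) ?G) * (2 * real q) = real (n div q) * fact q"
  proof -
    have "num_copies (cycle_graph q) ?G * (2 * q) = (n div q) * fact q"
      using num_copies_cycle_double[OF q simple_clique_blocks[of n q]] c0 by simp
    then have "real (num_copies (cycle_graph q) ?G * (2 * q)) = real ((n div q) * fact q)" by simp
    then show ?thesis by simp
  qed
  moreover have "(fact q :: real) = real q * fact (q - 1)" using q by (simp add: fact_reduce)
  moreover have "real_of_int \<lfloor>real n / real q\<rfloor> = real (n div q)"
    by (simp add: floor_divide_of_nat_eq)
  ultimately show ?thesis using q by (simp add: field_simps)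
qed

lemma hub_rel_sym: "hub_rel V T e x y \<Longrightarrow> hub_rel V T e y x"
  by (auto simp: hub_rel_def insert_commute)

lemma hub_rel_path_free:
  assumes "finite V" "T \<subseteq> V" "2 * card T + (if e = {} then 1 else 2) \<le> p"
  shows "path_free V (hub_rel V T e) p"
proof
  show "length xs \<le> p" if "is_path V (hub_rel V T e) xs" for xs
    using hub_rel_path_length[OF that] assms finite_subset by fastforce
qed (use assms hub_rel_sym in \<open>auto simp: hub_rel_def insert_commute\<close>)

text \<open>
  The maximum is attained by a copy of the extremal graph on the vertices \<open>0, \<dots>, n - 1\<close>, which
  has no path on \<open>p + 1\<close> vertices.
\<close>

lemma gen_ex_long_path:
  assumes q: "6 \<le> q" and p: "q + 2 \<le> p \<or> (even q \<and> p = q + 1)"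
  shows "\<exists>n0. \<forall>n\<ge>n0. gen_ex n (cycle_graph q) (path_graph (p + 1)) =
    num_copies (cycle_graph q) (H_graph n (p - 1))"
proof -
  define a where "a = (p - 1) div 2"
  have q3: "3 \<le> q" using q by simp
  have a: "q - q div 2 \<le> a" using p by (auto simp: a_def elim!: evenE)
  have pa: "2 * a + 1 \<le> p" "p \<le> 2 * a + 2" using p q by (auto simp: a_def)
  have par: "even (p - 1) \<longleftrightarrow> p = 2 * a + 1" 
  proof -
    have "p = 2 * a + 1 \<or> p = 2 * a + 2" using pa by linarith
    then show ?thesis by auto
  qed
  obtain n1 where n1: "\<And>(V :: nat set) E (V' :: (nat + nat) set) T' e'. path_free V E p \<Longrightarrow> n1 \<le> card V \<Longrightarrow>
    finite V' \<Longrightarrow> card V' = card V \<Longrightarrow> T' \<subseteq> V' \<Longrightarrow> card T' = a \<Longrightarrow>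
    (p = 2 * a + 1 \<longrightarrow> e' = {}) \<Longrightarrow> (p = 2 * a + 2 \<longrightarrow> e' \<subseteq> V' - T' \<and> card e' = 2) \<Longrightarrow>
    card (cycs V E q) \<le> card (cycs V' (hub_rel V' T' e') q)"
    using card_cycs_le_hub_rel[OF q a pa, where ?'a = nat and ?'b = "nat + nat"] by blast
  show ?thesis
  proof (intro exI[of _ "n1 + a + 2"] allI impI)
    fix n assume n: "n1 + a + 2 \<le> n"
    let ?H = "H_graph n (p - 1)"
    define V' where "V' = verts ?H"
    define T' where "T' = (Inl ` {..<a} :: (nat + nat) set)"
    define e' where "e' = (if even (p - 1) then {} else {Inr 0, Inr 1} :: (nat + nat) set)"
    have n2: "(p - 1) div 2 + 2 \<le> n" using n by (simp add: a_def)
    have H: "simple_graph ?H" "card V' = n" using simple_graph_H[OF n2] by (auto simp: V'_def)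
    have V': "V' = {..<a} <+> {..<n - a}" using verts_H_graph[of "p - 1" n] n2 by (simp add: V'_def a_def)
    have fV': "finite V'" by (simp add: V')
    have T': "T' \<subseteq> V'" "card T' = a" by (auto simp: T'_def V' card_image)
    have e': "p = 2 * a + 1 \<longrightarrow> e' = {}" "p = 2 * a + 2 \<longrightarrow> e' \<subseteq> V' - T' \<and> card e' = 2"
      using n par by (auto simp: e'_def V' T'_def)
    have adjH: "adj ?H = hub_rel V' T' e'"
      using adj_H_graph[OF n2] by (intro ext) (simp add: V'_def T'_def e'_def a_def)
    \<comment> \<open>A copy of the extremal graph whose vertices are natural numbers.\<close>
    define T0 where "T0 = {..<a}"
    define e0 where "e0 = (if even (p - 1) then {} else {a, a + 1})"
    define R where "R = hub_rel {..<n} T0 e0"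
    define G0 where "G0 = Graph {..<n} {{u, v} | u v. R u v}"
    have vG0: "verts G0 = {..<n}" by (simp add: G0_def)
    have adjG0: "adj G0 = R"
    proof (intro ext)
      fix x y
      have "R u v \<Longrightarrow> R v u" for u v unfolding R_def by (rule hub_rel_sym)
      then show "adj G0 x y = R x y" by (auto simp: adj_def G0_def doubleton_eq_iff)
    qed
    have sG0: "simple_graph G0" by (auto simp: simple_graph_def G0_def R_def hub_rel_def)
    have T0: "T0 \<subseteq> {..<n}" "card T0 = a" using n by (auto simp: T0_def)
    have "path_free {..<n} R p" unfolding R_def
      using T0 pa par by (intro hub_rel_path_free) (auto simp: e0_def)
    then have freeG0: "free_of (path_graph (p + 1)) G0"
      using path_free_iff[OF sG0] by (simp add: vG0 adjG0)
    have eq: "card (cycs {..<n} R q) = card (cycs V' (hub_rel V' T' e') q)"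
      unfolding R_def using T0 T' H(2) fV' n
      by (intro card_cycs_hub_rel_eq) (auto simp: e0_def e'_def T0_def T'_def V')
    have "num_copies (cycle_graph q) G0 * (2 * q) = num_copies (cycle_graph q) ?H * (2 * q)"
      unfolding num_copies_cycle_double[OF q3 sG0] num_copies_cycle_double[OF q3 H(1)]
        vG0 adjG0 adjH V'_def[symmetric] by (rule eq)
    then have nc: "num_copies (cycle_graph q) G0 = num_copies (cycle_graph q) ?H" using q by simp
    have "gen_ex n (cycle_graph q) (path_graph (p + 1)) = num_copies (cycle_graph q) G0"
    proof (rule gen_ex_eqI[OF sG0 _ freeG0])
      fix G :: "nat graph"
      assume G: "simple_graph G" "card (verts G) = n" "free_of (path_graph (p + 1)) G"
      have pf: "path_free (verts G) (adj G) p" using G path_free_iff by blast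
      have "card (cycs (verts G) (adj G) q) \<le> card (cycs V' (hub_rel V' T' e') q)"
        by (rule n1[OF pf _ fV' _ T' e']) (use n G(2) H(2) in auto)
      then show "num_copies (cycle_graph q) G \<le> num_copies (cycle_graph q) G0"
        using num_copies_cycle_le_iff[OF q3 G(1) sG0] eq by (simp add: vG0 adjG0)
    qed (simp add: vG0)
    then show "gen_ex n (cycle_graph q) (path_graph (p + 1)) = num_copies (cycle_graph q) ?H"
      using nc by simp
  qed
qed

theorem theorem1p3:
  fixes p q :: nat
  assumes "6 \<le> q" and "1 \<le> p"
  shows "(p \<le> q - 1 \<longrightarrow>
            (\<forall>n. gen_ex n (cycle_graph q) (path_graph (p + 1)) = 0)) \<and>
         (p = q \<longrightarrow>
            (\<forall>n. real (gen_ex n (cycle_graph q) (path_graph (q + 1))) =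
                   real_of_int \<lfloor>real n / real q\<rfloor> * (fact (q - 1) / 2))) \<and>
         (p \<ge> q + 2 \<or> (even q \<and> p = q + 1) \<longrightarrow>
            (\<exists>n0. \<forall>n\<ge>n0. gen_ex n (cycle_graph q) (path_graph (p + 1)) =
                   num_copies (cycle_graph q) (H_graph n (p - 1))))"
proof (intro conjI impI)
  show "\<forall>n. gen_ex n (cycle_graph q) (path_graph (p + 1)) = 0" if "p \<le> q - 1"
    using gen_ex_short_path[of q p] assms that by simp
  show "\<forall>n. real (gen_ex n (cycle_graph q) (path_graph (q + 1))) =
      real_of_int \<lfloor>real n / real q\<rfloor> * (fact (q - 1) / 2)"
    using gen_ex_equal_path[of q] assms(1) by simp
  show "\<exists>n0. \<forall>n\<ge>n0. gen_ex n (cycle_graph q) (path_graph (p + 1)) =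
      num_copies (cycle_graph q) (H_graph n (p - 1))" if "p \<ge> q + 2 \<or> (even q \<and> p = q + 1)"
    using gen_ex_long_path[OF assms(1) that] .
qed

end
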